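(* Let $V$ be a finite-dimensional superspace over $\mathbb{C}$ and let $k,l,p,q\ge0$. The scalar products $$(v^*_t,v_s)=\sum_{i\in I}x_{ti}\,x^*_{is},\qquad t\in T,\ s\in S,$$ form a system of generators of the algebra of $\mathfrak{gl}(V)$-invariants in $\mathfrak{A}^{p,q}_{k,l}$.
   Context: All superspaces are over $\mathbb{C}$; $\dim V=(n,m)$ means $\dim V_{\bar 0}=n$, $\dim V_{\bar 1}=m$; $\Pi$ is the parity shift. Let $U,W$ be superspaces with $\dim U=(k,l)$, $\dim W=(p,q)$ and set $$\mathfrak{A}^{p,q}_{k,l}=S^{\bullet}(V^{k}\oplus\Pi(V)^{l}\oplus V^{*p}\oplus\Pi(V)^{*q})=S^{\bullet}(U\otimes V\oplus V^*\otimes W),$$ where $S^\bullet$ is the symmetric algebra in the super sense, with $\mathfrak{gl}(V)$ acting by superderivations. Invariant means annihilated by $\mathfrak{gl}(V)$. Index sets: $T=\{1,\dots,k,\bar1,\dots,\bar l\}$, $S=\{1,\dots,p,\bar1,\dots,\bar q\}$, $I=\{1,\dots,n,\bar1,\dots,\bar m\}$; barred elements are odd, unbarred are even. Choose homogeneous bases $\{u_t\}_{t\in T}$ of $U$, $\{w_s\}_{s\in S}$ of $W$, $\{e_i\}_{i\in I}$ of $V$ (the parity of a basis vector is that of its index), and let $\{e^*_i\}$ be the basis of $V^*$ dual to $\{e_i\}$, $e_i^*(e_j)=\delta_{ij}$. Put $x_{ti}=u_t\otimes e_i$, $x^*_{is}=e^*_i\otimes w_s$. *)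

theory Defs
  imports Complex_Main "HOL-Library.Poly_Mapping" "HOL-Library.Z2"
    "HOL-Algebra.QuotRing" "HOL-Algebra.Generated_Rings"
begin

section \<open>Superspaces\<close>

text \<open>Parities live in \<^typ>\<open>bit\<close>, the field with two elements: \<^term>\<open>0::bit\<close> is even,
  \<^term>\<open>1::bit\<close> is odd.\<close>

definition ksgn :: "bit \<Rightarrow> complex" where
  "ksgn a = (if a = 0 then 1 else - 1)"

record 'a sspace =
  scl :: "complex \<Rightarrow> 'a \<Rightarrow> 'a"
  gr :: "bit \<Rightarrow> 'a set"

definition superspace :: "'a::ab_group_add sspace \<Rightarrow> bool" where
  "superspace V \<longleftrightarrow>
     vector_space (scl V) \<and>
     (\<forall>a. module.subspace (scl V) (gr V a)) \<and>
     gr V 0 \<inter> gr V 1 = {0} \<and>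
     (\<forall>x. \<exists>y\<in>gr V 0. \<exists>z\<in>gr V 1. x = y + z)"

definition hpart :: "'a::ab_group_add sspace \<Rightarrow> bit \<Rightarrow> 'a \<Rightarrow> 'a" where
  "hpart V a x = (THE y. y \<in> gr V a \<and> x - y \<in> gr V (a + 1))"

text \<open>\<open>twist V d\<close> is the linear map sending a homogeneous \<open>x\<close> to \<open>(-1)^{d |x|} x\<close>. All signs
  of the sign rule for operators of parity \<open>d\<close> are expressed through it.\<close>

definition twist :: "'a::ab_group_add sspace \<Rightarrow> bit \<Rightarrow> 'a \<Rightarrow> 'a" where
  "twist V d x = hpart V 0 x + scl V (ksgn d) (hpart V 1 x)"

text \<open>Tagged indices: \<^const>\<open>Inl\<close> marks the even (unbarred) and \<^const>\<open>Inr\<close> the odd (barred) ones.\<close>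

definition sindex :: "nat \<Rightarrow> nat \<Rightarrow> (nat + nat) set" where
  "sindex n m = {1..n} <+> {1..m}"

fun ipar :: "nat + nat \<Rightarrow> bit" where
  "ipar (Inl i) = 0"
| "ipar (Inr i) = 1"

text \<open>If \<open>homogeneous_basis V n m e\<close> holds then \<open>dim V = (n, m)\<close>.\<close>

definition homogeneous_basis ::
    "'a::ab_group_add sspace \<Rightarrow> nat \<Rightarrow> nat \<Rightarrow> (nat + nat \<Rightarrow> 'a) \<Rightarrow> bool" where
  "homogeneous_basis V n m e \<longleftrightarrow>
     inj_on e (sindex n m) \<and>
     \<not> module.dependent (scl V) (e ` sindex n m) \<and>
     module.span (scl V) (e ` sindex n m) = UNIV \<and>
     (\<forall>i\<in>sindex n m. e i \<in> gr V (ipar i))"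

definition dual :: "'a::ab_group_add sspace \<Rightarrow> ('a \<Rightarrow> complex) set" where
  "dual V = {f. Vector_Spaces.linear (scl V) (*) f}"

definition dual_gr :: "'a::ab_group_add sspace \<Rightarrow> bit \<Rightarrow> ('a \<Rightarrow> complex) set" where
  "dual_gr V a = {f \<in> dual V. \<forall>x\<in>gr V (a + 1). f x = 0}"

definition dual_basis ::
    "'a::ab_group_add sspace \<Rightarrow> nat \<Rightarrow> nat \<Rightarrow> (nat + nat \<Rightarrow> 'a) \<Rightarrow> (nat + nat \<Rightarrow> 'a \<Rightarrow> complex) \<Rightarrow> bool"
  where
  "dual_basis V n m e f \<longleftrightarrow>
     (\<forall>i\<in>sindex n m. f i \<in> dual V \<and> (\<forall>j\<in>sindex n m. f i (e j) = (if i = j then 1 else 0)))"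

definition gl :: "'a::ab_group_add sspace \<Rightarrow> ('a \<Rightarrow> 'a) set" where
  "gl V = {X. Vector_Spaces.linear (scl V) (scl V) X}"

text \<open>The component of parity \<open>d\<close> of an operator \<open>X\<close>.\<close>

definition gl_part :: "'a::ab_group_add sspace \<Rightarrow> bit \<Rightarrow> ('a \<Rightarrow> 'a) \<Rightarrow> 'a \<Rightarrow> 'a" where
  "gl_part V d X x = hpart V d (X (hpart V 0 x)) + hpart V (d + 1) (X (hpart V 1 x))"


section \<open>The free associative algebra\<close>

text \<open>Words under concatenation form the free monoid, so \<open>'g list \<Rightarrow>\<^sub>0 complex\<close> with its convolution
  product is the free associative algebra on \<open>'g\<close>.\<close>

instantiation list :: (type) monoid_add
begin
definition zero_list :: "'a list" where "zero_list = []"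
definition plus_list :: "'a list \<Rightarrow> 'a list \<Rightarrow> 'a list" where "plus_list = (@)"
instance by standard (simp_all add: zero_list_def plus_list_def)
end

definition word :: "'g list \<Rightarrow> 'g list \<Rightarrow>\<^sub>0 complex" where
  "word w = Poly_Mapping.single w 1"

definition const :: "complex \<Rightarrow> 'g list \<Rightarrow>\<^sub>0 complex" where
  "const c = Poly_Mapping.single [] c"

definition free_algebra :: "'g set \<Rightarrow> ('g list \<Rightarrow>\<^sub>0 complex) ring" where
  "free_algebra G =
     \<lparr>carrier = {a. Poly_Mapping.keys a \<subseteq> lists G}, mult = (*), one = 1, zero = 0, add = (+)\<rparr>"


section \<open>The symmetric superalgebra of \<open>U \<otimes> V \<oplus> V\<^sup>* \<otimes> W\<close>\<close>

text \<open>It is presented by the pure tensors \<open>u \<otimes> v\<close> (\<open>UV u v\<close>) and \<open>f \<otimes> w\<close> (\<open>DW f w\<close>, where \<open>f\<close> is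
  a linear functional on \<open>V\<close>) as generators, subject to bilinearity of the tensor products and to
  supercommutativity.\<close>

datatype ('u, 'v, 'w) tens = UV 'u 'v | DW "'v \<Rightarrow> complex" 'w

definition gens :: "'v::ab_group_add sspace \<Rightarrow> ('u, 'v, 'w) tens set" where
  "gens V = {UV u v | u v. True} \<union> {DW f w | f w. f \<in> dual V}"

definition hgens ::
    "'u::ab_group_add sspace \<Rightarrow> 'v::ab_group_add sspace \<Rightarrow> 'w::ab_group_add sspace \<Rightarrow> bit
      \<Rightarrow> ('u, 'v, 'w) tens set" where
  "hgens U V W a =
     {UV u v | u v b c. u \<in> gr U b \<and> v \<in> gr V c \<and> a = b + c} \<union>
     {DW f w | f w b c. f \<in> dual_gr V b \<and> w \<in> gr W c \<and> a = b + c}"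

inductive_set rels ::
    "'u::ab_group_add sspace \<Rightarrow> 'v::ab_group_add sspace \<Rightarrow> 'w::ab_group_add sspace
      \<Rightarrow> (('u, 'v, 'w) tens list \<Rightarrow>\<^sub>0 complex) set"
  for U V W where
  UV_add_left: "word [UV (u + u') v] - word [UV u v] - word [UV u' v] \<in> rels U V W"
| UV_add_right: "word [UV u (v + v')] - word [UV u v] - word [UV u v'] \<in> rels U V W"
| UV_scale_left: "word [UV (scl U c u) v] - const c * word [UV u v] \<in> rels U V W"
| UV_scale_right: "word [UV u (scl V c v)] - const c * word [UV u v] \<in> rels U V W"
| DW_add_left: "f \<in> dual V \<Longrightarrow> f' \<in> dual V \<Longrightarrow>
    word [DW (\<lambda>x. f x + f' x) w] - word [DW f w] - word [DW f' w] \<in> rels U V W"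
| DW_add_right: "f \<in> dual V \<Longrightarrow>
    word [DW f (w + w')] - word [DW f w] - word [DW f w'] \<in> rels U V W"
| DW_scale_left: "f \<in> dual V \<Longrightarrow>
    word [DW (\<lambda>x. c * f x) w] - const c * word [DW f w] \<in> rels U V W"
| DW_scale_right: "f \<in> dual V \<Longrightarrow>
    word [DW f (scl W c w)] - const c * word [DW f w] \<in> rels U V W"
| supercomm: "g \<in> hgens U V W a \<Longrightarrow> h \<in> hgens U V W b \<Longrightarrow>
    word [g, h] - const (ksgn (a * b)) * word [h, g] \<in> rels U V W"

definition sym_ideal ::
    "'u::ab_group_add sspace \<Rightarrow> 'v::ab_group_add sspace \<Rightarrow> 'w::ab_group_add sspace
      \<Rightarrow> (('u, 'v, 'w) tens list \<Rightarrow>\<^sub>0 complex) set" where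
  "sym_ideal U V W = Idl\<^bsub>free_algebra (gens V)\<^esub> (rels U V W)"

definition sym_alg ::
    "'u::ab_group_add sspace \<Rightarrow> 'v::ab_group_add sspace \<Rightarrow> 'w::ab_group_add sspace
      \<Rightarrow> (('u, 'v, 'w) tens list \<Rightarrow>\<^sub>0 complex) set ring" where
  "sym_alg U V W = free_algebra (gens V) Quot sym_ideal U V W"

definition sym_class ::
    "'u::ab_group_add sspace \<Rightarrow> 'v::ab_group_add sspace \<Rightarrow> 'w::ab_group_add sspace
      \<Rightarrow> (('u, 'v, 'w) tens list \<Rightarrow>\<^sub>0 complex) \<Rightarrow> (('u, 'v, 'w) tens list \<Rightarrow>\<^sub>0 complex) set" where
  "sym_class U V W a = sym_ideal U V W +>\<^bsub>free_algebra (gens V)\<^esub> a"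


section \<open>The action of \<open>gl(V)\<close> by superderivations\<close>

fun twist_gen ::
    "'u::ab_group_add sspace \<Rightarrow> 'v::ab_group_add sspace \<Rightarrow> 'w::ab_group_add sspace \<Rightarrow> bit
      \<Rightarrow> ('u, 'v, 'w) tens \<Rightarrow> ('u, 'v, 'w) tens" where
  "twist_gen U V W d (UV u v) = UV (twist U d u) (twist V d v)"
| "twist_gen U V W d (DW f w) = DW (\<lambda>x. f (twist V d x)) (twist W d w)"

text \<open>For \<open>X\<close> of parity \<open>d\<close> and homogeneous arguments:
  \<open>X (u \<otimes> v) = (-1)^{d |u|} u \<otimes> X v\<close> and \<open>X (f \<otimes> w) = X f \<otimes> w\<close> with
  \<open>(X f) x = - (-1)^{d |f|} f (X x)\<close>; note that \<open>f (twist V d x) = (-1)^{d |f|} f x\<close>.\<close>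

fun act_gen ::
    "'u::ab_group_add sspace \<Rightarrow> 'v::ab_group_add sspace \<Rightarrow> bit \<Rightarrow> ('v \<Rightarrow> 'v)
      \<Rightarrow> ('u, 'v, 'w) tens \<Rightarrow> ('u, 'v, 'w) tens" where
  "act_gen U V d X (UV u v) = UV (twist U d u) (X v)"
| "act_gen U V d X (DW f w) = DW (\<lambda>x. - f (twist V d (X x))) w"

text \<open>The super Leibniz rule \<open>X (g w) = (X g) w + (-1)^{d |g|} g (X w)\<close>.\<close>

fun act_word ::
    "'u::ab_group_add sspace \<Rightarrow> 'v::ab_group_add sspace \<Rightarrow> 'w::ab_group_add sspace \<Rightarrow> bit
      \<Rightarrow> ('v \<Rightarrow> 'v) \<Rightarrow> ('u, 'v, 'w) tens list \<Rightarrow> ('u, 'v, 'w) tens list \<Rightarrow>\<^sub>0 complex" where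
  "act_word U V W d X [] = 0"
| "act_word U V W d X (g # w) =
     word [act_gen U V d X g] * word w + word [twist_gen U V W d g] * act_word U V W d X w"

definition act_free ::
    "'u::ab_group_add sspace \<Rightarrow> 'v::ab_group_add sspace \<Rightarrow> 'w::ab_group_add sspace \<Rightarrow> ('v \<Rightarrow> 'v)
      \<Rightarrow> (('u, 'v, 'w) tens list \<Rightarrow>\<^sub>0 complex) \<Rightarrow> (('u, 'v, 'w) tens list \<Rightarrow>\<^sub>0 complex)" where
  "act_free U V W X a =
     (\<Sum>w\<in>Poly_Mapping.keys a. const (Poly_Mapping.lookup a w) *
        (act_word U V W 0 (gl_part V 0 X) w + act_word U V W 1 (gl_part V 1 X) w))"

text \<open>The induced operator on the quotient. It is well defined: for superspaces and linear \<open>X\<close>,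
  \<^const>\<open>act_free\<close> maps the ideal to itself, so this is a union of equal cosets.\<close>

definition act_sym ::
    "'u::ab_group_add sspace \<Rightarrow> 'v::ab_group_add sspace \<Rightarrow> 'w::ab_group_add sspace \<Rightarrow> ('v \<Rightarrow> 'v)
      \<Rightarrow> (('u, 'v, 'w) tens list \<Rightarrow>\<^sub>0 complex) set \<Rightarrow> (('u, 'v, 'w) tens list \<Rightarrow>\<^sub>0 complex) set" where
  "act_sym U V W X C = (\<Union>a\<in>C. sym_class U V W (act_free U V W X a))"

definition gl_invariants ::
    "'u::ab_group_add sspace \<Rightarrow> 'v::ab_group_add sspace \<Rightarrow> 'w::ab_group_add sspace
      \<Rightarrow> (('u, 'v, 'w) tens list \<Rightarrow>\<^sub>0 complex) set set" where
  "gl_invariants U V W =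
     {C \<in> carrier (sym_alg U V W). \<forall>X\<in>gl V. act_sym U V W X C = \<zero>\<^bsub>sym_alg U V W\<^esub>}"

text \<open>The unital complex subalgebra generated by \<open>H\<close>.\<close>

definition generated_subalgebra ::
    "'u::ab_group_add sspace \<Rightarrow> 'v::ab_group_add sspace \<Rightarrow> 'w::ab_group_add sspace
      \<Rightarrow> (('u, 'v, 'w) tens list \<Rightarrow>\<^sub>0 complex) set set
      \<Rightarrow> (('u, 'v, 'w) tens list \<Rightarrow>\<^sub>0 complex) set set" where
  "generated_subalgebra U V W H =
     generate_ring (sym_alg U V W) (range (\<lambda>c. sym_class U V W (const c)) \<union> H)"

text \<open>The scalar product \<open>(v\<^sup>*\<^sub>t, v\<^sub>s) = \<Sum>\<^sub>i x\<^sub>t\<^sub>i x\<^sup>*\<^sub>i\<^sub>s\<close>, where \<open>x\<^sub>t\<^sub>i = u\<^sub>t \<otimes> e\<^sub>i\<close> and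
  \<open>x\<^sup>*\<^sub>i\<^sub>s = e\<^sup>*\<^sub>i \<otimes> w\<^sub>s\<close>; the arguments \<open>ut\<close> and \<open>ws\<close> are \<open>u\<^sub>t\<close> and \<open>w\<^sub>s\<close>.\<close>

definition scalar_product ::
    "'u::ab_group_add sspace \<Rightarrow> 'v::ab_group_add sspace \<Rightarrow> 'w::ab_group_add sspace \<Rightarrow> nat \<Rightarrow> nat
      \<Rightarrow> (nat + nat \<Rightarrow> 'v) \<Rightarrow> (nat + nat \<Rightarrow> 'v \<Rightarrow> complex) \<Rightarrow> 'u \<Rightarrow> 'w
      \<Rightarrow> (('u, 'v, 'w) tens list \<Rightarrow>\<^sub>0 complex) set" where
  "scalar_product U V W n m e e' ut ws =
     (\<Oplus>\<^bsub>sym_alg U V W\<^esub>i\<in>sindex n m.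
        sym_class U V W (word [UV ut (e i)]) \<otimes>\<^bsub>sym_alg U V W\<^esub> sym_class U V W (word [DW (e' i) ws]))"

end

theory Submission
  imports Defs
begin

text \<open>
  In bases of \<open>U\<close>, \<open>V\<close>, \<open>W\<close> the symmetric superalgebra is the free algebra on letters \<open>x\<^sub>t\<^sub>i\<close>,
  \<open>x\<^sup>*\<^sub>i\<^sub>s\<close> modulo supercommutators. An invariant \<open>f\<close> is read as a differential operator: \<open>x\<^sub>t\<^sub>i\<close> acts by
  multiplication and \<open>x\<^sup>*\<^sub>i\<^sub>s\<close> as the derivative with respect to an auxiliary letter \<open>\<eta>\<^sub>s\<^sub>i\<close>, where these
  letters span \<open>W\<^sup>* \<otimes> V\<close>. This operator commutes with \<open>gl(V)\<close>, and by Taylor's formula \<open>f\<close> is the sum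
  of its values on \<open>K\<^sup>d / d!\<close>, where \<open>K = \<Sum> \<plusminus>x\<^sup>*\<^sub>i\<^sub>s \<eta>\<^sub>s\<^sub>i\<close>.

  To compute these values, \<open>V\<close> is enlarged by infinitely many even basis vectors. Every word of
  length \<open>d\<close> in the letters \<open>\<eta>\<close> is obtained from a word \<open>e\<close> with \<open>d\<close> distinct new indices by applying
  matrix units of the larger \<open>gl\<close>. The compression of the enveloping algebra of the larger \<open>gl\<close> to words
  over \<open>V\<close> lies in the enveloping algebra of \<open>gl(V)\<close>, and matrix units are adjoint to matrix units for
  the Hermitian form with orthonormal words; so an orthogonal decomposition of \<open>e\<close> extends the operator
  equivariantly to \<open>e\<close>. Its value there is a combination of words \<open>x\<^sub>t\<^sub>i\<close> with the same distinct indices,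
  and contracting such a word with letters \<open>x\<^sup>*\<^sub>i\<^sub>s\<close> gives a product of scalar products.
\<close>

text \<open>Tensors in both \<open>V\<close> and its dual are in general not semisimple over
  \<open>gl(V)\<close>, so no projection onto invariants is available. Tensors in \<open>V\<close>
  alone behave better: on words in letters \<open>X\<close> the matrix units satisfy
  \<open>ip_D\<close>, and orthogonal complements replace complete reducibility. On letters
  \<open>Y\<close> this adjointness fails, because the sign in \<open>hF\<close> differs for
  \<open>k\<close> and \<open>l\<close> of different parity. That is the reason for reading an
  invariant as an equivariant map whose source and target are both spanned by letters
  \<open>X\<close>. The form lives on the free algebra, where definiteness is immediate;
  supercommutativity enters only through congruences. The enlargement of \<open>V\<close> is forced
  by the degree: a word with \<open>d\<close> distinct indices does not exist over \<open>V\<close>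
  once \<open>d > n + m\<close>. In the large space a single multilinear vector controls all words
  of its type, and the weight space in which its image lies is spanned by the explicit words in
  \<open>Z\<close>, so permutations of tensor factors never have to be introduced.\<close>

text \<open>The default simplification rules of \<^typ>\<open>bit\<close> turn its ring operations into bit operations.\<close>

declare add_bit_eq_xor [simp del] mult_bit_eq_and [simp del]

section \<open>Linear maps on free algebras\<close>

type_synonym 'g falg = "'g list \<Rightarrow>\<^sub>0 complex"

lemma word_Nil [simp]: "word [] = 1"
  by (metis single_one word_def zero_list_def)

lemma word_append: "word (u @ v) = word u * word v"
  by (simp add: word_def mult_single plus_list_def)

lemma word_Cons: "word (g # v) = word [g] * word v"
  using word_append[of "[g]" v] by simp

lemma const_1 [simp]: "const 1 = 1"
  by (metis const_def single_one zero_list_def)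

lemma const_0 [simp]: "const 0 = 0"
  by (simp add: const_def)

lemma const_add: "const (c + d) = const c + const d"
  by (simp add: const_def single_add)

lemma const_minus: "const (- c) = - const c"
  by (simp add: const_def single_uminus)

lemma const_mult: "const (c * d) = const c * const d"
  by (simp add: const_def mult_single plus_list_def)

lemma const_mult_word: "const c * word w = Poly_Mapping.single w c"
  by (simp add: const_def word_def mult_single plus_list_def)

definition sc :: "complex \<Rightarrow> 'g falg \<Rightarrow> 'g falg" (infixr "\<cdot>" 75) where
  "c \<cdot> a = const c * a"

lemma falg_expand: "a = (\<Sum>w\<in>Poly_Mapping.keys a. Poly_Mapping.lookup a w \<cdot> word w)"
  unfolding sc_def const_mult_word
  by (rule poly_mapping_eqI) (simp add: lookup_sum lookup_single when_def in_keys_iff sum.delta)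

lemma falg_induct [case_names zero add scale]:
  assumes "P 0" and "\<And>a b. P a \<Longrightarrow> P b \<Longrightarrow> P (a + b)"
    and "\<And>c w. w \<in> Poly_Mapping.keys a \<Longrightarrow> P (c \<cdot> word w)"
  shows "P a"
proof -
  have "P (\<Sum>w\<in>A. Poly_Mapping.lookup a w \<cdot> word w)"
    if "A \<subseteq> Poly_Mapping.keys a" for A
    using finite_subset[OF that finite_keys] that
    by (induction A rule: finite_induct) (auto intro: assms)
  from this[of "Poly_Mapping.keys a"] show ?thesis
    using falg_expand[of a] by simp
qed

lemma const_commute: "a * const c = const c * a"
proof (induction a rule: falg_induct)
  case (scale d w)
  show ?case
    by (simp add: sc_def const_def word_def mult_single plus_list_def mult.commute)
qed (simp_all add: algebra_simps)

lemma sc_simps: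
  "a * c \<cdot> b = c \<cdot> (a * b)" "c \<cdot> a * b = c \<cdot> (a * b)" "c \<cdot> d \<cdot> a = (c * d) \<cdot> a"
  "c \<cdot> (a + b) = c \<cdot> a + c \<cdot> b" "c \<cdot> (a - b) = c \<cdot> a - c \<cdot> b" "c \<cdot> (- a) = - (c \<cdot> a)"
  by (simp_all add: sc_def const_mult algebra_simps) (metis const_commute mult.assoc)

lemma sc_1 [simp]: "1 \<cdot> a = a" and sc_0 [simp]: "0 \<cdot> a = 0" "c \<cdot> 0 = 0"
  by (simp_all add: sc_def)

lemma sc_minus: "(- c) \<cdot> a = - (c \<cdot> a)"
  by (simp add: sc_def const_minus)

lemma sc_add: "(c + d) \<cdot> a = c \<cdot> a + d \<cdot> a"
  by (simp add: sc_def const_add distrib_right)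

lemma sc_sum: "c \<cdot> (\<Sum>i\<in>A. f i) = (\<Sum>i\<in>A. c \<cdot> f i)"
  by (simp add: sc_def sum_distrib_left)

lemma const_sc: "const c = c \<cdot> 1"
  by (simp add: sc_def)

lemmas falg_simps = sc_simps mult.assoc distrib_left distrib_right left_diff_distrib right_diff_distrib

definition clinear :: "('g falg \<Rightarrow> 'h falg) \<Rightarrow> bool" where
  "clinear F \<longleftrightarrow> (\<forall>a b. F (a + b) = F a + F b) \<and> (\<forall>c a. F (c \<cdot> a) = c \<cdot> F a)"

lemma clinearI:
  "(\<And>a b. F (a + b) = F a + F b) \<Longrightarrow> (\<And>c a. F (c \<cdot> a) = c \<cdot> F a) \<Longrightarrow> clinear F"
  by (simp add: clinear_def)

lemma clinear_add: "clinear F \<Longrightarrow> F (a + b) = F a + F b"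
  by (simp add: clinear_def)

lemma clinear_scale: "clinear F \<Longrightarrow> F (c \<cdot> a) = c \<cdot> F a"
  by (simp add: clinear_def)

lemma clinear_zero: "clinear F \<Longrightarrow> F 0 = 0"
  using clinear_scale[of F 0 0] by simp

lemma clinear_minus: "clinear F \<Longrightarrow> F (- a) = - F a"
  using clinear_scale[of F "- 1" a] by (simp add: sc_minus)

lemma clinear_diff: "clinear F \<Longrightarrow> F (a - b) = F a - F b"
  using clinear_add[of F a "- b"] by (simp add: clinear_minus)

lemma clinear_sum: "clinear F \<Longrightarrow> F (\<Sum>i\<in>A. f i) = (\<Sum>i\<in>A. F (f i))"
  by (induction A rule: infinite_finite_induct) (auto simp: clinear_zero clinear_add)

lemma clinear_id: "clinear (\<lambda>a. a)"
  by (simp add: clinear_def)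

lemma clinear_0: "clinear (\<lambda>a. 0)"
  by (simp add: clinear_def)

lemma clinear_comp: "clinear F \<Longrightarrow> clinear G \<Longrightarrow> clinear (\<lambda>a. F (G a))"
  by (simp add: clinear_def)

lemma clinear_plus: "clinear F \<Longrightarrow> clinear G \<Longrightarrow> clinear (\<lambda>a. F a + G a)"
  by (simp add: clinear_def sc_simps algebra_simps)

lemma clinear_mult_left: "clinear F \<Longrightarrow> clinear (\<lambda>a. b * F a)"
  by (simp add: clinear_def falg_simps)

lemma clinear_mult_right: "clinear F \<Longrightarrow> clinear (\<lambda>a. F a * b)"
  by (simp add: clinear_def falg_simps)

lemma clinear_sc: "clinear F \<Longrightarrow> clinear (\<lambda>a. c \<cdot> F a)"
  unfolding sc_def by (rule clinear_mult_left)

lemma clinear_if: "clinear F \<Longrightarrow> clinear G \<Longrightarrow> clinear (\<lambda>a. if b then F a else G a)"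
  by (cases b) simp_all

lemma clinear_sub: "clinear F \<Longrightarrow> clinear G \<Longrightarrow> clinear (\<lambda>a. F a - G a)"
  by (simp add: clinear_def falg_simps)

lemma clinear_sum': "(\<And>i. clinear (F i)) \<Longrightarrow> clinear (\<lambda>a. \<Sum>i\<in>A. F i a)"
  by (rule clinearI) (simp_all add: clinear_add clinear_scale sum.distrib sc_sum)

text \<open>Most identities below are checked on words through \<open>clinear_eqI\<close>; these
  rules discharge its linearity premises.\<close>

named_theorems clin

lemmas [clin] = clinear_id clinear_0 clinear_plus clinear_sub clinear_mult_left clinear_mult_right
  clinear_sc clinear_if clinear_sum'

definition lin :: "('g list \<Rightarrow> 'h falg) \<Rightarrow> 'g falg \<Rightarrow> 'h falg" where
  "lin k a = (\<Sum>w\<in>Poly_Mapping.keys a. (Poly_Mapping.lookup a w) \<cdot> k w)"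

lemma lin_superset:
  "finite A \<Longrightarrow> Poly_Mapping.keys a \<subseteq> A \<Longrightarrow> lin k a = (\<Sum>w\<in>A. (Poly_Mapping.lookup a w) \<cdot> k w)"
  unfolding lin_def by (rule sum.mono_neutral_left) (auto simp: in_keys_iff)

lemma lookup_sc:
  fixes a :: "'g falg"
  shows "Poly_Mapping.lookup (c \<cdot> a) w = c * Poly_Mapping.lookup a w"
proof -
  have "c \<cdot> a = Poly_Mapping.map ((*) c) a"
    by (simp add: sc_def const_def mult_map_scale_conv_mult zero_list_def)
  then show ?thesis
    by (simp add: Poly_Mapping.map.rep_eq when_def)
qed

lemma keys_sc: "Poly_Mapping.keys (c \<cdot> a) \<subseteq> Poly_Mapping.keys a"
  by (auto simp: in_keys_iff lookup_sc)

lemma clinear_lin: "clinear (lin k)"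
proof (rule clinearI)
  fix a b :: "'a falg"
  let ?A = "Poly_Mapping.keys a \<union> Poly_Mapping.keys b"
  show "lin k (a + b) = lin k a + lin k b"
    using lin_superset[of ?A "a + b" k] lin_superset[of ?A a k] lin_superset[of ?A b k]
      keys_add[of a b]
    by (simp add: lookup_add sc_add sum.distrib)
next
  fix c and a :: "'a falg"
  show "lin k (c \<cdot> a) = c \<cdot> lin k a"
    using lin_superset[of "Poly_Mapping.keys a" "c \<cdot> a" k] keys_sc[of c a]
    by (simp add: lookup_sc lin_def sc_simps sc_sum)
qed

lemma keys_word [simp]: "Poly_Mapping.keys (word w) = {w}"
  by (simp add: word_def)

lemma lookup_word: "Poly_Mapping.lookup (word w) v = (if v = w then 1 else 0)"
  by (simp add: word_def lookup_single when_def)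

lemma lin_word [simp]: "lin k (word w) = k w"
  by (simp add: lin_def lookup_word)

lemma clinear_eq_on:
  assumes "clinear F" and "clinear G" and "\<And>w. w \<in> Poly_Mapping.keys a \<Longrightarrow> F (word w) = G (word w)"
  shows "F a = G a"
  by (induction a rule: falg_induct) (use assms in \<open>auto simp: clinear_zero clinear_add clinear_scale\<close>)

lemma clinear_eqI:
  "clinear F \<Longrightarrow> clinear G \<Longrightarrow> (\<And>w. F (word w) = G (word w)) \<Longrightarrow> F a = G a"
  by (rule clinear_eq_on)

definition Free :: "'g set \<Rightarrow> 'g falg set" where
  "Free A = {a. Poly_Mapping.keys a \<subseteq> lists A}"

lemma Free_add: "a \<in> Free A \<Longrightarrow> b \<in> Free A \<Longrightarrow> a + b \<in> Free A"
  using keys_add[of a b] by (auto simp: Free_def)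

lemma Free_0: "0 \<in> Free A"
  by (simp add: Free_def)

lemma Free_word: "word w \<in> Free A \<longleftrightarrow> w \<in> lists A"
  by (simp add: Free_def)

lemma Free_1: "1 \<in> Free A"
  using Free_word[of "[]" A] by simp

lemma Free_mult: "a \<in> Free A \<Longrightarrow> b \<in> Free A \<Longrightarrow> a * b \<in> Free A"
  using keys_mult[of a b] by (fastforce simp: Free_def plus_list_def)

lemma Free_scale: "a \<in> Free A \<Longrightarrow> c \<cdot> a \<in> Free A"
  using keys_sc[of c a] by (auto simp: Free_def)

lemma Free_const: "const c \<in> Free A"
  using Free_scale[OF Free_1, of c A] by (simp add: const_sc)

lemma Free_minus: "a \<in> Free A \<Longrightarrow> - a \<in> Free A"
  using Free_scale[of a A "- 1"] by (simp add: sc_minus)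

lemma Free_diff: "a \<in> Free A \<Longrightarrow> b \<in> Free A \<Longrightarrow> a - b \<in> Free A"
  using Free_add[of a A "- b"] Free_minus[of b A] by simp

lemma Free_sum: "(\<And>i. i \<in> B \<Longrightarrow> f i \<in> Free A) \<Longrightarrow> (\<Sum>i\<in>B. f i) \<in> Free A"
  by (induction B rule: infinite_finite_induct) (auto intro: Free_0 Free_add)

lemma Free_mono: "A \<subseteq> B \<Longrightarrow> a \<in> Free A \<Longrightarrow> a \<in> Free B"
  unfolding Free_def by (auto dest: lists_mono[THEN subsetD] subsetD)

lemma Free_UNIV: "a \<in> Free UNIV"
  by (simp add: Free_def)

lemma clinear_closed:
  assumes "clinear F" and "\<And>w. w \<in> Poly_Mapping.keys a \<Longrightarrow> F (word w) \<in> M"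
    and "0 \<in> M" and "\<And>x y. x \<in> M \<Longrightarrow> y \<in> M \<Longrightarrow> x + y \<in> M" and "\<And>c x. x \<in> M \<Longrightarrow> c \<cdot> x \<in> M"
  shows "F a \<in> M"
  by (induction a rule: falg_induct) (use assms in \<open>auto simp: clinear_zero clinear_add clinear_scale\<close>)

lemma Free_clinear:
  "clinear F \<Longrightarrow> a \<in> Free A \<Longrightarrow> (\<And>w. w \<in> lists A \<Longrightarrow> F (word w) \<in> Free B) \<Longrightarrow> F a \<in> Free B"
  by (rule clinear_closed[where F=F])
    (auto simp: Free_def[of A] subset_iff intro: Free_0 Free_add Free_scale simp del: in_lists_conv_set)

text \<open>The universal property of the free algebra: the unital homomorphism with prescribed
  values on letters.\<close>

definition subst :: "('g \<Rightarrow> 'h falg) \<Rightarrow> 'g falg \<Rightarrow> 'h falg" where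
  "subst h = lin (\<lambda>w. prod_list (map h w))"

lemma clinear_subst: "clinear (subst h)"
  by (simp add: subst_def clinear_lin)

lemmas [clin] = clinear_comp[OF clinear_subst]

lemma subst_word: "subst h (word w) = prod_list (map h w)"
  by (simp add: subst_def)

lemma subst_letter [simp]: "subst h (word [g]) = h g"
  by (simp add: subst_word)

lemma subst_mult: "subst h (a * b) = subst h a * subst h b"
proof (rule clinear_eqI[where a=a])
  fix w show "subst h (word w * b) = subst h (word w) * subst h b"
  proof (rule clinear_eqI[where a=b])
    fix v show "subst h (word w * word v) = subst h (word w) * subst h (word v)"
      by (simp add: word_append[symmetric] subst_word)
  qed (intro clin)+
qed (intro clin)+

lemma subst_1 [simp]: "subst h 1 = 1"
  using subst_word[of h "[]"] by simp

lemma subst_const [simp]: "subst h (const c) = const c"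
  using clinear_scale[OF clinear_subst, of h c 1] by (simp add: const_sc)

lemmas subst_linear = clinear_add[OF clinear_subst] clinear_scale[OF clinear_subst]
  clinear_diff[OF clinear_subst] clinear_sum[OF clinear_subst] clinear_zero[OF clinear_subst]
  clinear_minus[OF clinear_subst]

lemma subst_Free:
  assumes "a \<in> Free A" and "\<And>g. g \<in> A \<Longrightarrow> h g \<in> Free B"
  shows "subst h a \<in> Free B"
proof (rule Free_clinear[OF clinear_subst assms(1)])
  fix w assume "w \<in> lists A"
  then show "subst h (word w) \<in> Free B"
    by (induction w) (auto simp: subst_word intro: Free_1 Free_mult assms)
qed

lemma subst_letter_id [simp]: "subst (\<lambda>g. word [g]) a = a"
proof (rule clinear_eqI[where a=a])
  fix w show "subst (\<lambda>g. word [g]) (word w) = word w"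
    by (induction w) (simp_all add: subst_word word_Cons[symmetric])
qed (intro clin)+

section \<open>Superderivations\<close>

lemma ksgn_add: "ksgn (a + b) = ksgn a * ksgn b"
  by (cases a; cases b) (simp_all add: ksgn_def)

lemma ksgn_0 [simp]: "ksgn 0 = 1" and ksgn_1 [simp]: "ksgn 1 = - 1"
  by (simp_all add: ksgn_def)

lemma ksgn_sq [simp]: "ksgn a * ksgn a = 1" "ksgn a * (ksgn a * x) = x"
  by (simp_all add: ksgn_def)

lemma bit_double [simp]: "a + a = (0::bit)"
  by (cases a) simp_all

locale super_letters =
  fixes par :: "'l \<Rightarrow> bit"
begin

abbreviation wpar :: "'l list \<Rightarrow> bit" where
  "wpar w \<equiv> sum_list (map par w)"

text \<open>The sign that an operator of parity \<open>d\<close> picks up when it passes an element,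
  as an automorphism; sign rules can then be stated for inhomogeneous elements.\<close>

definition tw :: "bit \<Rightarrow> 'l falg \<Rightarrow> 'l falg" where
  "tw d = subst (\<lambda>g. (ksgn (d * par g)) \<cdot> word [g])"

lemma clinear_tw: "clinear (tw d)"
  by (simp add: tw_def clinear_subst)

lemma tw_mult: "tw d (a * b) = tw d a * tw d b"
  by (simp add: tw_def subst_mult)

lemma tw_1 [simp]: "tw d 1 = 1"
  by (simp add: tw_def)

lemma tw_const [simp]: "tw d (const c) = const c"
  by (simp add: tw_def)

lemma tw_letter: "tw d (word [g]) = (ksgn (d * par g)) \<cdot> word [g]"
  by (simp add: tw_def)

lemmas [clin] = clinear_comp[OF clinear_tw]

lemmas tw_linear = clinear_add[OF clinear_tw] clinear_scale[OF clinear_tw]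
  clinear_diff[OF clinear_tw] clinear_sum[OF clinear_tw] clinear_zero[OF clinear_tw]

lemma tw_word: "tw d (word w) = (ksgn (d * wpar w)) \<cdot> word w"
proof (induction w)
  case (Cons g w)
  show ?case
    by (subst (1 2) word_Cons) (simp add: tw_mult Cons tw_letter falg_simps ksgn_add mult.commute)
qed simp

lemma tw_tw: "tw d (tw e a) = tw (d + e) a"
proof (rule clinear_eqI[where a=a])
  fix w show "tw d (tw e (word w)) = tw (d + e) (word w)"
    by (simp add: tw_word tw_linear sc_simps distrib_right ksgn_add mult.commute)
qed (intro clin)+

lemma tw_0 [simp]: "tw 0 a = a"
  by (simp add: tw_def)

lemma tw_commute: "tw d (tw e a) = tw e (tw d a)"
  unfolding tw_tw by (subst add.commute) (rule refl)

fun der_word :: "bit \<Rightarrow> ('l \<Rightarrow> 'l falg) \<Rightarrow> 'l list \<Rightarrow> 'l falg" where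
  "der_word d h [] = 0"
| "der_word d h (g # w) = h g * word w + tw d (word [g]) * der_word d h w"

text \<open>The superderivation of parity \<open>d\<close> with prescribed values on
  letters.\<close>

definition der :: "bit \<Rightarrow> ('l \<Rightarrow> 'l falg) \<Rightarrow> 'l falg \<Rightarrow> 'l falg" where
  "der d h = lin (der_word d h)"

lemma clinear_der: "clinear (der d h)"
  by (simp add: der_def clinear_lin)

lemmas [clin] = clinear_comp[OF clinear_der]

lemmas der_linear = clinear_add[OF clinear_der] clinear_scale[OF clinear_der]
  clinear_diff[OF clinear_der] clinear_sum[OF clinear_der] clinear_zero[OF clinear_der]

lemma der_word_append:
  "der_word d h (u @ v) = der_word d h u * word v + tw d (word u) * der_word d h v"
proof (induction u)
  case (Cons g u)
  then show ?case
    by (simp add: word_Cons[of g u] tw_mult word_append algebra_simps)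
qed simp

lemma der_mult: "der d h (a * b) = der d h a * b + tw d a * der d h b"
proof (rule clinear_eqI[where a=a])
  fix w show "der d h (word w * b) = der d h (word w) * b + tw d (word w) * der d h b"
  proof (rule clinear_eqI[where a=b])
    fix v show "der d h (word w * word v) = der d h (word w) * word v + tw d (word w) * der d h (word v)"
      by (simp add: word_append[symmetric] der_def der_word_append)
  qed (intro clin)+
qed (intro clin)+

lemma der_letter [simp]: "der d h (word [g]) = h g"
  by (simp add: der_def const_sc)

lemma der_const [simp]: "der d h (const c) = 0"
  using clinear_scale[OF clinear_der, of d h c "word []"] lin_word[of "der_word d h" "[]"]
  by (simp add: der_def const_sc)

lemma der_1 [simp]: "der d h 1 = 0"
  using der_const[of d h 1] by simp

text \<open>Right superderivations: the sign is picked up by the factors to the right.\<close>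

fun rder_word :: "'l \<Rightarrow> 'l list \<Rightarrow> 'l falg" where
  "rder_word x [] = 0"
| "rder_word x (g # w) = (if g = x then tw (par x) (word w) else 0) + word [g] * rder_word x w"

definition rder :: "'l \<Rightarrow> 'l falg \<Rightarrow> 'l falg" where
  "rder x = lin (rder_word x)"

lemma clinear_rder: "clinear (rder x)"
  by (simp add: rder_def clinear_lin)

lemmas [clin] = clinear_comp[OF clinear_rder]

lemmas rder_linear = clinear_add[OF clinear_rder] clinear_scale[OF clinear_rder]
  clinear_diff[OF clinear_rder] clinear_sum[OF clinear_rder] clinear_zero[OF clinear_rder]

lemma rder_word_append:
  "rder_word x (u @ v) = rder_word x u * tw (par x) (word v) + word u * rder_word x v"
proof (induction u)
  case (Cons g u)
  then show ?case
    by (simp add: word_Cons[of g u] tw_mult word_append algebra_simps)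
qed simp

lemma rder_mult: "rder x (a * b) = rder x a * tw (par x) b + a * rder x b"
proof (rule clinear_eqI[where a=a])
  fix w show "rder x (word w * b) = rder x (word w) * tw (par x) b + word w * rder x b"
  proof (rule clinear_eqI[where a=b])
    fix v show "rder x (word w * word v) = rder x (word w) * tw (par x) (word v) + word w * rder x (word v)"
      by (simp add: word_append[symmetric] rder_def rder_word_append)
  qed (intro clin)+
qed (intro clin)+

lemma rder_letter: "rder x (word [g]) = (if g = x then 1 else 0)"
  by (simp add: rder_def const_sc)

lemma rder_const [simp]: "rder x (const c) = 0"
  using clinear_scale[OF clinear_rder, of x c "word []"] lin_word[of "rder_word x" "[]"]
  by (simp add: rder_def const_sc)

lemma rder_1 [simp]: "rder x 1 = 0"
  using rder_const[of x 1] by simp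

lemma tw_rder: "tw d (rder x a) = (ksgn (d * par x)) \<cdot> rder x (tw d a)"
proof (rule clinear_eqI[where a=a])
  fix w show "tw d (rder x (word w)) = (ksgn (d * par x)) \<cdot> rder x (tw d (word w))"
  proof (induction w)
    case (Cons g w)
    let ?c = "ksgn (d * par x)" and ?g = "ksgn (d * par g)"
    let ?e = "if g = x then 1 else 0 :: 'l falg"
    have "tw d (rder x (word (g # w)))
        = ?e * tw (par x) (tw d (word w)) + ?g \<cdot> (word [g] * (?c \<cdot> rder x (tw d (word w))))"
      by (subst word_Cons)
        (simp add: rder_mult rder_letter tw_mult tw_linear Cons tw_letter tw_commute[of d] falg_simps ac_simps)
    moreover have "?c \<cdot> rder x (tw d (word (g # w)))
        = ?c \<cdot> (?g \<cdot> (?e * tw (par x) (tw d (word w)) + word [g] * rder x (tw d (word w))))"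
      by (subst word_Cons) (simp add: rder_mult rder_letter tw_mult rder_linear tw_letter falg_simps)
    moreover have "?c \<cdot> (?g \<cdot> (?e * t)) = ?e * t" for t
      by (simp add: sc_simps)
    ultimately show ?case
      by (simp add: falg_simps mult.commute)
  qed (simp add: tw_linear)
qed (intro clin)+

text \<open>A composite of two derivatives removes two letters, and the order of removal changes
  only the sign. This holds already in the free algebra.\<close>

lemma rder_rder:
  "rder x (rder y a) = (ksgn (par x * par y)) \<cdot> rder y (rder x a)"
proof (rule clinear_eqI[where a=a])
  fix w show "rder x (rder y (word w)) = (ksgn (par x * par y)) \<cdot> rder y (rder x (word w))"
  proof (induction w)
    case (Cons g w)
    let ?c = "ksgn (par x * par y)"
    let ?e = "\<lambda>u. if g = u then 1 else 0 :: 'l falg"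
    have tr: "rder u (tw (par v) b) = (ksgn (par v * par u)) \<cdot> tw (par v) (rder u b)" for u v b
      by (simp add: tw_rder sc_simps)
    have r: "rder u (?e v) = 0" for u v
      by (simp add: rder_linear)
    have *: "rder u (rder v (word (g # w)))
        = ?e v * ((ksgn (par v * par u)) \<cdot> tw (par v) (rder u (word w)))
          + (?e u * tw (par u) (rder v (word w)) + word [g] * rder u (rder v (word w)))" for u v
      by (subst word_Cons) (simp only: rder_mult rder_letter rder_linear tr r mult_zero_left add_0_left)
    show ?case
      unfolding * Cons
      by (cases "g = x"; cases "g = y"; simp only: if_True if_False)
        (simp_all add: sc_simps ac_simps)
  qed (simp add: rder_linear)
qed (intro clin)+


section \<open>The supercommutator ideal\<close>

definition scomm :: "'l \<Rightarrow> 'l \<Rightarrow> 'l falg" where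
  "scomm g h = word [g, h] - (ksgn (par g * par h)) \<cdot> word [h, g]"

text \<open>Described as a linear span of two-sided word multiples, so that a linear map can be
  tested on these (\<open>sid_clinear\<close>); that it is an ideal is \<open>sid_left\<close> and
  \<open>sid_right\<close>. The quotient is the symmetric superalgebra on the letters.\<close>

inductive_set sid :: "'l falg set" where
  zero: "0 \<in> sid"
| add: "a \<in> sid \<Longrightarrow> b \<in> sid \<Longrightarrow> a + b \<in> sid"
| base: "c \<cdot> (word u * (scomm g h * word v)) \<in> sid"

lemma sid_scale: "a \<in> sid \<Longrightarrow> c \<cdot> a \<in> sid"
  by (induction rule: sid.induct) (auto simp: sc_simps intro: sid.intros)

lemma sid_minus: "a \<in> sid \<Longrightarrow> - a \<in> sid"
  using sid_scale[of a "- 1"] by (simp add: sc_minus)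

lemma sid_sum: "(\<And>i. i \<in> A \<Longrightarrow> f i \<in> sid) \<Longrightarrow> (\<Sum>i\<in>A. f i) \<in> sid"
  by (induction A rule: infinite_finite_induct) (auto intro: sid.intros)

lemma sid_word_left: "a \<in> sid \<Longrightarrow> word w * a \<in> sid"
proof (induction rule: sid.induct)
  case (base c u g h v)
  show ?case
    using sid.base[of c "w @ u" g h v] by (simp add: word_append falg_simps)
qed (auto simp: falg_simps intro: sid.intros)

lemma sid_word_right: "a \<in> sid \<Longrightarrow> a * word w \<in> sid"
proof (induction rule: sid.induct)
  case (base c u g h v)
  show ?case
    using sid.base[of c u g h "v @ w"] by (simp add: word_append falg_simps)
qed (auto simp: falg_simps intro: sid.intros)

lemma sid_left: "a \<in> sid \<Longrightarrow> b * a \<in> sid"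
  by (rule clinear_closed[where F="\<lambda>b. b * a"])
    (auto intro: sid.intros sid_scale sid_word_left clin)

lemma sid_right: "a \<in> sid \<Longrightarrow> a * b \<in> sid"
  by (rule clinear_closed[where F="\<lambda>b. a * b"])
    (auto intro: sid.intros sid_scale sid_word_right clin)

lemma scomm_in_sid: "scomm g h \<in> sid"
  using sid.base[of 1 "[]" g h "[]"] by simp

lemma sid_clinear:
  assumes "clinear F" and "a \<in> sid" and "\<And>u g h v. F (word u * (scomm g h * word v)) \<in> M"
    and "0 \<in> M" and "\<And>x y. x \<in> M \<Longrightarrow> y \<in> M \<Longrightarrow> x + y \<in> M" and "\<And>c x. x \<in> M \<Longrightarrow> c \<cdot> x \<in> M"
  shows "F a \<in> M"
  using assms(2)
  by (induction rule: sid.induct) (use assms in \<open>auto simp: clinear_zero clinear_add clinear_scale\<close>)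

text \<open>Congruence takes the place of a quotient type: all operators stay on the free algebra,
  and identities of the symmetric superalgebra are congruences.\<close>

definition eqv :: "'l falg \<Rightarrow> 'l falg \<Rightarrow> bool" (infix "\<approx>" 50) where
  "a \<approx> b \<longleftrightarrow> a - b \<in> sid"

lemma eqv_refl [simp, intro]: "a \<approx> a"
  by (simp add: eqv_def sid.zero)

lemma eqv_sym: "a \<approx> b \<Longrightarrow> b \<approx> a"
  unfolding eqv_def using sid_minus by fastforce

lemma eqv_trans [trans]: "a \<approx> b \<Longrightarrow> b \<approx> c \<Longrightarrow> a \<approx> c"
  unfolding eqv_def using sid.add by fastforce

lemma eqv_0: "a \<approx> 0 \<longleftrightarrow> a \<in> sid"
  by (simp add: eqv_def)

lemma eqv_add: "a \<approx> b \<Longrightarrow> c \<approx> d \<Longrightarrow> a + c \<approx> b + d"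
  unfolding eqv_def using sid.add[of "a - b" "c - d"] by (simp add: algebra_simps)

lemma eqv_sum: "(\<And>i. i \<in> A \<Longrightarrow> f i \<approx> g i) \<Longrightarrow> (\<Sum>i\<in>A. f i) \<approx> (\<Sum>i\<in>A. g i)"
  unfolding eqv_def by (simp add: sum_subtractf[symmetric] sid_sum)

lemma eqv_mult: "a \<approx> b \<Longrightarrow> c \<approx> d \<Longrightarrow> a * c \<approx> b * d"
  unfolding eqv_def using sid.add[OF sid_right[of "a - b" c] sid_left[of "c - d" b]]
  by (simp add: algebra_simps)

lemma eqv_mult_left: "c \<approx> d \<Longrightarrow> a * c \<approx> a * d"
  by (simp add: eqv_mult)

lemma eqv_mult_right: "a \<approx> b \<Longrightarrow> a * c \<approx> b * c"
  by (simp add: eqv_mult)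

lemma eqv_scale: "a \<approx> b \<Longrightarrow> c \<cdot> a \<approx> c \<cdot> b"
  unfolding eqv_def using sid_scale[of "a - b" c] by (simp add: sc_simps)

lemma eqv_clinear: "clinear F \<Longrightarrow> (\<And>x. x \<in> sid \<Longrightarrow> F x \<in> sid) \<Longrightarrow> a \<approx> b \<Longrightarrow> F a \<approx> F b"
  unfolding eqv_def by (metis clinear_diff)

lemma eqv_clinear_on:
  assumes "clinear F" and "clinear G" and "\<And>w. w \<in> Poly_Mapping.keys a \<Longrightarrow> F (word w) \<approx> G (word w)"
  shows "F a \<approx> G a"
  by (induction a rule: falg_induct)
    (use assms in \<open>auto simp: clinear_zero clinear_add clinear_scale eqv_add eqv_scale\<close>)

lemma supercommute_letter: "word [g] * tw (par g) a \<approx> a * word [g]"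
proof (rule eqv_clinear_on[where a=a])
  fix w show "word [g] * tw (par g) (word w) \<approx> word w * word [g]"
  proof (induction w)
    case (Cons h w)
    have "scomm h g = word [h] * word [g] - (ksgn (par h * par g)) \<cdot> (word [g] * word [h])"
      unfolding scomm_def by (metis append_Cons append_Nil word_append)
    then have c: "(ksgn (par h * par g)) \<cdot> (word [g] * word [h]) \<approx> word [h] * word [g]"
      using scomm_in_sid[of h g] unfolding eqv_def by (metis minus_diff_eq sid_minus)
    have "word [g] * tw (par g) (word (h # w))
        = (ksgn (par h * par g)) \<cdot> (word [g] * word [h]) * tw (par g) (word w)"
      by (subst word_Cons) (simp add: tw_mult tw_letter falg_simps mult.commute)
    also have "\<dots> \<approx> word [h] * word [g] * tw (par g) (word w)"
      by (intro eqv_mult_right c)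
    also have "\<dots> \<approx> word [h] * (word w * word [g])"
      unfolding mult.assoc by (intro eqv_mult_left Cons)
    finally show ?case by (simp add: word_Cons[of h w] mult.assoc)
  qed simp
qed (intro clin)+

lemma tw_scomm: "tw d (scomm g h) = ksgn (d * (par g + par h)) \<cdot> scomm g h"
  by (simp add: scomm_def tw_linear tw_word falg_simps algebra_simps)

lemma tw_sid: "a \<in> sid \<Longrightarrow> tw d a \<in> sid"
proof (rule sid_clinear[OF clinear_tw])
  fix u g h v
  show "tw d (word u * (scomm g h * word v)) \<in> sid"
    unfolding tw_mult tw_scomm by (rule sid_left, rule sid_right, rule sid_scale, rule scomm_in_sid)
qed (auto intro: sid.intros sid_scale)

lemma subst_sid:
  assumes "a \<in> sid" and "\<And>g h. subst k (scomm g h) \<in> sid"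
  shows "subst k a \<in> sid"
proof (rule sid_clinear[OF clinear_subst assms(1)])
  fix u g h v
  show "subst k (word u * (scomm g h * word v)) \<in> sid"
    unfolding subst_mult by (rule sid_left, rule sid_right, rule assms(2))
qed (auto intro: sid.intros sid_scale)

lemma der_sid:
  assumes "a \<in> sid" and "\<And>g h. der d k (scomm g h) \<in> sid"
  shows "der d k a \<in> sid"
proof (rule sid_clinear[OF clinear_der assms(1)])
  fix u g h v
  show "der d k (word u * (scomm g h * word v)) \<in> sid"
    unfolding der_mult
    by (intro sid.add sid_left[of "scomm g h * word v"] sid_left[of "_ + _"] sid_right[of "der _ _ (scomm g h)"]
        sid_right[of "tw _ _"] sid_right[of "scomm g h"] tw_sid scomm_in_sid assms(2))
qed (auto intro: sid.intros sid_scale)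

text \<open>The sign picked up by the derivative from the right cancels the sign in the
  supercommutator, so generators are annihilated exactly, not only modulo the ideal.\<close>

lemma rder_scomm [simp]: "rder x (scomm g h) = 0"
proof -
  have "word [g, h] = word [g] * word [h]" for g h :: 'l
    by (metis append_Cons append_Nil word_append)
  then show ?thesis
    by (auto simp: scomm_def rder_linear rder_mult rder_letter tw_letter sc_simps mult.commute
        split: if_splits)
qed

lemma rder_sid:
  assumes "a \<in> sid"
  shows "rder x a \<in> sid"
proof (rule sid_clinear[OF clinear_rder assms])
  fix u g h v
  show "rder x (word u * (scomm g h * word v)) \<in> sid"
    unfolding rder_mult tw_mult rder_scomm mult_zero_left add_0_left
    by (intro sid.add sid_left[of "scomm g h * _"] sid_left[of "tw _ (scomm g h) * _"]
        sid_right[of "tw _ (scomm g h)"] sid_right[of "scomm g h"] tw_sid scomm_in_sid)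
qed (auto intro: sid.intros sid_scale)

end

section \<open>Letters\<close>

text \<open>\<open>X (Inl t) i\<close> stands for \<open>x\<^sub>t\<^sub>i\<close> and \<open>Y i s\<close> for \<open>x\<^sup>*\<^sub>i\<^sub>s\<close>. The letters \<open>X (Inr s) i\<close> are
  auxiliary: they are dual to \<open>Y i s\<close>, that is, a basis of \<open>W\<^sup>* \<otimes> V\<close>. The index \<open>i\<close> ranges over a
  superspace of infinite dimension that contains \<open>V\<close>.\<close>

type_synonym idx = "nat + nat"

datatype letter = X "idx + idx" idx | Y idx idx

fun tpar :: "idx + idx \<Rightarrow> bit" where
  "tpar (Inl t) = ipar t"
| "tpar (Inr s) = ipar s"

fun lpar :: "letter \<Rightarrow> bit" where
  "lpar (X t i) = tpar t + ipar i"
| "lpar (Y i s) = ipar i + ipar s"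

interpretation L: super_letters lpar .

notation L.eqv (infix "\<approx>" 50)

abbreviation epar :: "idx \<Rightarrow> idx \<Rightarrow> bit" where
  "epar k l \<equiv> ipar k + ipar l"

text \<open>The action of the matrix unit \<open>E\<^sub>k\<^sub>l\<close> on letters, and its variant that ignores the letters \<open>Y\<close>.\<close>

fun hF :: "idx \<Rightarrow> idx \<Rightarrow> letter \<Rightarrow> letter falg" where
  "hF k l (X t i) = (if i = l then ksgn (epar k l * tpar t) \<cdot> word [X t k] else 0)"
| "hF k l (Y i s) = (if i = k then - (ksgn (epar k l * ipar k) \<cdot> word [Y l s]) else 0)"

fun hD :: "idx \<Rightarrow> idx \<Rightarrow> letter \<Rightarrow> letter falg" where
  "hD k l (X t i) = (if i = l then ksgn (epar k l * tpar t) \<cdot> word [X t k] else 0)"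
| "hD k l (Y i s) = 0"

definition DF :: "idx \<Rightarrow> idx \<Rightarrow> letter falg \<Rightarrow> letter falg" where
  "DF k l = L.der (epar k l) (hF k l)"

text \<open>\<open>D\<close> acts on the arguments of the differential operators and
  \<open>DF\<close> on the operators themselves; \<open>D_ra\<close> relates the two.\<close>

definition D :: "idx \<Rightarrow> idx \<Rightarrow> letter falg \<Rightarrow> letter falg" where
  "D k l = L.der (epar k l) (hD k l)"

lemma clinear_D: "clinear (D k l)" and clinear_DF: "clinear (DF k l)"
  by (simp_all add: D_def DF_def L.clinear_der)

lemmas [clin] = clinear_comp[OF clinear_D] clinear_comp[OF clinear_DF]

lemmas D_linear = clinear_add[OF clinear_D] clinear_scale[OF clinear_D]
  clinear_diff[OF clinear_D] clinear_sum[OF clinear_D] clinear_zero[OF clinear_D]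

lemmas DF_linear = clinear_add[OF clinear_DF] clinear_scale[OF clinear_DF]
  clinear_diff[OF clinear_DF] clinear_sum[OF clinear_DF] clinear_zero[OF clinear_DF]

lemma D_mult: "D k l (a * b) = D k l a * b + L.tw (epar k l) a * D k l b"
  and DF_mult: "DF k l (a * b) = DF k l a * b + L.tw (epar k l) a * DF k l b"
  by (simp_all add: D_def DF_def L.der_mult)

lemma D_letter: "D k l (word [g]) = hD k l g" and DF_letter: "DF k l (word [g]) = hF k l g"
  by (simp_all add: D_def DF_def)

lemma D_1 [simp]: "D k l 1 = 0" and DF_1 [simp]: "DF k l 1 = 0"
  and D_const [simp]: "D k l (const c) = 0" and DF_const [simp]: "DF k l (const c) = 0"
  by (simp_all add: D_def DF_def)

lemma word2: "word [g, h] = word [g] * word [h]"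
  using word_Cons[of g "[h]"] .

lemma scomm_eqv: "word [g] * word [h] \<approx> ksgn (lpar g * lpar h) \<cdot> (word [h] * word [g])"
  using L.scomm_in_sid[of g h] by (simp add: L.scomm_def L.eqv_def word2)

text \<open>Each letter goes to a multiple of a letter whose parity is shifted by \<open>d\<close>,
  so the derived supercommutator is a sum of two multiples of supercommutators. The alternatives
  with coefficient 0 cover annihilated letters, which have no meaningful target.\<close>

lemma der_scomm_sid:
  assumes "h g = cg \<cdot> word [g']" and "h g1 = cg1 \<cdot> word [g1']"
    and "cg = 0 \<or> lpar g' = d + lpar g" and "cg1 = 0 \<or> lpar g1' = d + lpar g1"
  shows "L.der d h (L.scomm g g1) \<in> L.sid"
proof -
  let ?s = "ksgn (lpar g * lpar g1)"
  let ?a = "word [g'] * word [g1]" and ?a' = "word [g1] * word [g']"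
  let ?b = "word [g] * word [g1']" and ?b' = "word [g1'] * word [g]"
  have "L.der d h (L.scomm g g1)
      = cg \<cdot> (?a - (?s * ksgn (d * lpar g1)) \<cdot> ?a') + (cg1 * ksgn (d * lpar g)) \<cdot> (?b - (?s * ksgn (d * lpar g)) \<cdot> ?b')"
    by (simp add: L.scomm_def word2 L.der_linear L.der_mult assms(1,2) L.tw_letter falg_simps algebra_simps)
  moreover have "cg = 0 \<or> ?s * ksgn (d * lpar g1) = ksgn (lpar g' * lpar g1)"
    using assms(3) by (auto simp: distrib_right ksgn_add)
  then have "cg \<cdot> (?a - (?s * ksgn (d * lpar g1)) \<cdot> ?a') \<in> L.sid"
    using scomm_eqv[of g' g1] by (cases "cg = 0") (auto simp: L.eqv_def L.sid.zero intro: L.sid_scale)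
  moreover have "cg1 = 0 \<or> ?s * ksgn (d * lpar g) = ksgn (lpar g * lpar g1')"
    using assms(4) by (auto simp: distrib_left ksgn_add mult.commute)
  then have "(cg1 * ksgn (d * lpar g)) \<cdot> (?b - (?s * ksgn (d * lpar g)) \<cdot> ?b') \<in> L.sid"
    using scomm_eqv[of g g1'] by (cases "cg1 = 0") (auto simp: L.eqv_def L.sid.zero intro: L.sid_scale)
  ultimately show ?thesis
    by (auto intro: L.sid.add)
qed

lemma hD_form: "\<exists>c g'. hD k l g = c \<cdot> word [g'] \<and> (c = 0 \<or> lpar g' = epar k l + lpar g)"
proof (cases "\<exists>t. g = X t l")
  case True
  then obtain t where "g = X t l" ..
  then show ?thesis
    by (intro exI[of _ "ksgn (epar k l * tpar t)"] exI[of _ "X t k"])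
      (cases "ipar k"; cases "ipar l"; cases "tpar t"; simp)
next
  case False
  then have "hD k l g = 0 \<cdot> word [g]" by (cases g) auto
  then show ?thesis by blast
qed

lemma hF_form: "\<exists>c g'. hF k l g = c \<cdot> word [g'] \<and> (c = 0 \<or> lpar g' = epar k l + lpar g)"
proof (cases g)
  case (X t i)
  then show ?thesis using hD_form[of k l g] by simp
next
  case (Y i s)
  show ?thesis
  proof (cases "i = k")
    case True
    then show ?thesis
      by (intro exI[of _ "- ksgn (epar k l * ipar k)"] exI[of _ "Y l s"])
        (cases "ipar k"; cases "ipar l"; cases "ipar s"; simp add: Y sc_minus)
  next
    case False
    then have "hF k l g = 0 \<cdot> word [g]" by (simp add: Y)
    then show ?thesis by blast
  qed
qed

lemma D_sid: "a \<in> L.sid \<Longrightarrow> D k l a \<in> L.sid"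
  unfolding D_def
proof (erule L.der_sid)
  fix g h
  obtain c g' d h' where "hD k l g = c \<cdot> word [g']" "c = 0 \<or> lpar g' = epar k l + lpar g"
    "hD k l h = d \<cdot> word [h']" "d = 0 \<or> lpar h' = epar k l + lpar h"
    using hD_form[of k l g] hD_form[of k l h] by blast
  then show "L.der (epar k l) (hD k l) (L.scomm g h) \<in> L.sid"
    by (intro der_scomm_sid)
qed

lemma DF_sid: "a \<in> L.sid \<Longrightarrow> DF k l a \<in> L.sid"
  unfolding DF_def
proof (erule L.der_sid)
  fix g h
  obtain c g' d h' where "hF k l g = c \<cdot> word [g']" "c = 0 \<or> lpar g' = epar k l + lpar g"
    "hF k l h = d \<cdot> word [h']" "d = 0 \<or> lpar h' = epar k l + lpar h"
    using hF_form[of k l g] hF_form[of k l h] by blast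
  then show "L.der (epar k l) (hF k l) (L.scomm g h) \<in> L.sid"
    by (intro der_scomm_sid)
qed

lemma DF_eqv: "a \<approx> b \<Longrightarrow> DF k l a \<approx> DF k l b"
  by (auto intro: L.eqv_clinear clinear_DF DF_sid)

lemma hD_tw: "L.tw d (hD k l g) = ksgn (d * (epar k l + lpar g)) \<cdot> hD k l g"
  using hD_form[of k l g] by (auto simp: L.tw_linear L.tw_letter sc_simps mult.commute)

lemma D_tw: "D k l (L.tw d a) = ksgn (d * epar k l) \<cdot> L.tw d (D k l a)"
proof (rule clinear_eqI[where a=a])
  fix w show "D k l (L.tw d (word w)) = ksgn (d * epar k l) \<cdot> L.tw d (D k l (word w))"
  proof (induction w)
    case (Cons g w)
    let ?e = "epar k l"
    have "ksgn (d * ?e) * ksgn (d * (?e + lpar g)) = ksgn (d * lpar g)"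
      by (cases d; cases "ipar k"; cases "ipar l"; simp add: ksgn_add del: lpar.simps)
    then show ?case
      by (subst (1 2) word_Cons) (simp add: L.tw_mult D_mult L.tw_linear Cons L.tw_letter D_linear
          D_letter hD_tw falg_simps L.tw_commute[of d ?e] ac_simps)
  qed (simp add: L.tw_linear)
qed (intro clin)+

lemma bit_idem: "a * a = (a::bit)"
  by (cases a) simp_all

text \<open>The relation for the supercommutator of two matrix units. Both sides obey the same
  Leibniz rule, so it holds on the free algebra once it holds on letters.\<close>

lemma D_D:
  "D k l (D i j a) = ksgn (epar k l * epar i j) \<cdot> D i j (D k l a)
     + (if l = i then D k j a else 0)
     - (if j = k then ksgn (epar k l * epar i j) \<cdot> D i l a else 0)"
proof (rule clinear_eqI[where a=a])
  let ?s = "ksgn (epar k l * epar i j)"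
  fix w show "D k l (D i j (word w)) = ?s \<cdot> D i j (D k l (word w))
     + (if l = i then D k j (word w) else 0) - (if j = k then ?s \<cdot> D i l (word w) else 0)"
  proof (induction w)
    case (Cons g w)
    let ?c = "\<lambda>a. (if l = i then D k j a else 0) - (if j = k then ?s \<cdot> D i l a else 0)"
    have g: "D k l (D i j (word [g])) = ?s \<cdot> D i j (D k l (word [g])) + ?c (word [g])"
    proof (cases g)
      case (X t r)
      then show ?thesis
        by (cases "r = j"; cases "i = l"; cases "r = l"; cases "j = k")
          (simp_all add: D_letter D_linear sc_simps ksgn_add distrib_left distrib_right bit_idem ac_simps)
    qed (simp add: D_letter D_linear)
    \<comment> \<open>If the inner indices agree, the parities of the two matrix units add up to
      that of their product, so the two twists merge.\<close>
    have tw: "L.tw (epar k l) (L.tw (epar i j) (word [g])) * ?c (word w)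
        = (if l = i then L.tw (epar k j) (word [g]) * D k j (word w) else 0)
          - (if j = k then ?s \<cdot> L.tw (epar i l) (word [g]) * D i l (word w) else 0)"
    proof -
      have "l = i \<Longrightarrow> epar k l + epar i j = epar k j" "j = k \<Longrightarrow> epar k l + epar i j = epar i l"
        by (cases "ipar l"; cases "ipar k"; simp add: ac_simps)+
      then show ?thesis by (cases "l = i"; cases "j = k") (simp_all add: L.tw_tw sc_simps right_diff_distrib ac_simps)
    qed
    let ?g = "word [g]" and ?w = "word w"
    let ?ts = "\<lambda>e b. L.tw e b"
    have "D k l (D i j (word (g # w)))
        = D k l (D i j ?g) * ?w + L.tw (epar k l) (D i j ?g) * D k l ?w
          + (ksgn (epar i j * epar k l) \<cdot> L.tw (epar i j) (D k l ?g)) * D i j ?w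
          + L.tw (epar k l) (L.tw (epar i j) ?g) * D k l (D i j ?w)"
      by (subst word_Cons) (simp only: D_mult D_linear D_tw add.assoc)
    moreover have "D i j (D k l (word (g # w)))
        = D i j (D k l ?g) * ?w + L.tw (epar i j) (D k l ?g) * D i j ?w
          + (ksgn (epar k l * epar i j) \<cdot> L.tw (epar k l) (D i j ?g)) * D k l ?w
          + L.tw (epar i j) (L.tw (epar k l) ?g) * D i j (D k l ?w)"
      by (subst word_Cons) (simp only: D_mult D_linear D_tw add.assoc)
    moreover have "?c (word (g # w)) = ?c ?g * ?w + L.tw (epar k l) (L.tw (epar i j) ?g) * ?c ?w"
      unfolding tw by (subst (1 2) word_Cons) (simp add: D_mult falg_simps)
    moreover have "D k l (D i j ?w) = ?s \<cdot> D i j (D k l ?w) + ?c ?w"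
      using Cons by simp
    moreover have "?s \<cdot> (?s \<cdot> x) = x" for x :: "letter falg" by (simp add: sc_simps)
    moreover have "ksgn (epar i j * epar k l) = ?s" by (simp add: mult.commute)
    ultimately show ?case
      unfolding g by (simp add: falg_simps L.tw_commute[of "epar i j" "epar k l"] del: lpar.simps)
  qed (simp add: D_linear)
qed (intro clin)+

section \<open>Superpolynomials as differential operators\<close>

text \<open>The letters \<open>Y i s\<close> act from the right as the derivatives dual to the auxiliary letters
  \<open>X (Inr s) i\<close>, and the letters \<open>X (Inl t) i\<close> as multiplications. The sign in the last equation makes the pairing
  of \<open>V\<^sup>*\<close> and \<open>V\<close> invariant.\<close>

fun rletter :: "letter \<Rightarrow> letter falg \<Rightarrow> letter falg" where
  "rletter (X (Inl t) i) v = v * word [X (Inl t) i]"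
| "rletter (X (Inr s) i) v = 0"
| "rletter (Y i s) v = ksgn (ipar i) \<cdot> L.rder (X (Inr s) i) v"

text \<open>The operator \<open>f\<close> acts on the argument \<open>v\<close> from the right,
  leftmost letter first; left factors of \<open>v\<close> free of auxiliary letters then pass
  through without a sign.\<close>

definition ra :: "letter falg \<Rightarrow> letter falg \<Rightarrow> letter falg" where
  "ra v = lin (\<lambda>w. fold rletter w v)"

lemma clinear_ra: "clinear (ra v)"
  by (simp add: ra_def clinear_lin)

lemma clinear_rletter: "clinear (rletter g)"
proof (cases "(g, 0::letter falg)" rule: rletter.cases)
  case (1 t i v)
  then have "rletter g = (\<lambda>v. v * word [X (Inl t) i])" by (intro ext) simp
  then show ?thesis by simp (intro clin)
next
  case (2 s i v)
  then have "rletter g = (\<lambda>v. 0)" by (intro ext) simp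
  then show ?thesis by simp (intro clin)
next
  case (3 i s v)
  then have "rletter g = (\<lambda>v. ksgn (ipar i) \<cdot> L.rder (X (Inr s) i) v)" by (intro ext) simp
  then show ?thesis by simp (intro clin)
qed

lemma clinear_fold: "(\<And>g. clinear (F g)) \<Longrightarrow> clinear (fold F w)"
proof (induction w)
  case (Cons g w)
  then show ?case using clinear_comp[of "fold F w" "F g"] by (simp add: o_def)
qed (simp add: id_def clinear_id)

lemma clinear_ra_left: "clinear (\<lambda>v. ra v f)"
proof -
  have "clinear (\<lambda>v. ra v f)" if "\<And>w. w \<in> Poly_Mapping.keys f \<Longrightarrow> clinear (fold rletter w)"
    unfolding ra_def lin_def sc_def[symmetric]
    using that by (intro clinearI) (auto simp: clinear_add clinear_scale sc_simps sum.distrib sc_sum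
        mult.commute intro!: sum.cong)
  then show ?thesis by (simp add: clinear_fold clinear_rletter)
qed

lemmas [clin] = clinear_comp[OF clinear_ra] clinear_comp[OF clinear_rletter]
  clinear_comp[OF clinear_ra_left]

lemmas ra_linear = clinear_add[OF clinear_ra] clinear_scale[OF clinear_ra]
  clinear_diff[OF clinear_ra] clinear_sum[OF clinear_ra] clinear_zero[OF clinear_ra]
  clinear_minus[OF clinear_ra]

lemmas ra_left_linear = clinear_add[OF clinear_ra_left] clinear_scale[OF clinear_ra_left]
  clinear_diff[OF clinear_ra_left] clinear_sum[OF clinear_ra_left] clinear_zero[OF clinear_ra_left]

lemmas rletter_linear = clinear_add[OF clinear_rletter] clinear_scale[OF clinear_rletter]
  clinear_diff[OF clinear_rletter] clinear_sum[OF clinear_rletter] clinear_zero[OF clinear_rletter]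

lemma ra_word: "ra v (word w) = fold rletter w v"
  by (simp add: ra_def)

lemma ra_letter: "ra v (word [g]) = rletter g v"
  by (simp add: ra_word)

lemma ra_1 [simp]: "ra v 1 = v"
  using ra_word[of v "[]"] by simp

lemma ra_mult: "ra v (f * g) = ra (ra v f) g"
proof (rule clinear_eqI[where a=f])
  fix w show "ra v (word w * g) = ra (ra v (word w)) g"
  proof (rule clinear_eqI[where a=g])
    fix u show "ra v (word w * word u) = ra (ra v (word w)) (word u)"
      by (simp add: word_append[symmetric] ra_word)
  qed (intro clin)+
qed (intro clin)+

lemma rletter_sid: "a \<in> L.sid \<Longrightarrow> rletter g a \<in> L.sid"
  by (induction g a rule: rletter.induct)
    (auto intro: L.sid_right L.sid.zero L.sid_scale L.rder_sid)

lemma ra_sid_left: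
  assumes "a \<in> L.sid"
  shows "ra a f \<in> L.sid"
proof (rule clinear_closed[OF clinear_ra])
  fix w show "ra a (word w) \<in> L.sid"
    using assms by (induction w arbitrary: a) (auto simp: ra_word rletter_sid)
qed (auto intro: L.sid.intros L.sid_scale)

text \<open>Multiplications use letters \<open>X (Inl t) i\<close> and derivatives refer to letters
  \<open>X (Inr s) i\<close>. The two families are disjoint, so no Weyl algebra term appears and the
  operators supercommute; the ideal is needed only for two multiplications.\<close>

lemma rletter_scomm: "rletter h (rletter g v) - ksgn (lpar g * lpar h) \<cdot> rletter g (rletter h v) \<in> L.sid"
proof -
  have XY: "rletter (Y i s) (rletter (X (Inl t) j) v)
      = ksgn (lpar (X (Inl t) j) * lpar (Y i s)) \<cdot> rletter (X (Inl t) j) (rletter (Y i s) v)" for i s t j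
    by (simp add: L.rder_mult L.rder_letter L.tw_letter sc_simps ac_simps)
  have YX: "rletter (X (Inl t) j) (rletter (Y i s) v)
      = ksgn (lpar (Y i s) * lpar (X (Inl t) j)) \<cdot> rletter (Y i s) (rletter (X (Inl t) j) v)" for i s t j
    unfolding XY by (simp add: sc_simps ac_simps del: lpar.simps rletter.simps)
  have YY: "rletter (Y j r) (rletter (Y i s) v)
      = ksgn (lpar (Y i s) * lpar (Y j r)) \<cdot> rletter (Y i s) (rletter (Y j r) v)" for i s j r
    by (simp add: L.rder_linear L.rder_rder[of "X (Inr r) j" "X (Inr s) i"] sc_simps ac_simps)
  have XX: "rletter (X (Inl t) j) (rletter (X (Inl r) i) v)
      - ksgn (lpar (X (Inl r) i) * lpar (X (Inl t) j)) \<cdot> rletter (X (Inl r) i) (rletter (X (Inl t) j) v) \<in> L.sid"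
    for t j r i
    using L.sid_left[OF L.scomm_in_sid[of "X (Inl r) i" "X (Inl t) j"], of v]
    by (simp add: L.scomm_def word2 falg_simps)
  show ?thesis
  proof (cases "(g, v)" rule: rletter.cases)
    case g: (1 t i)
    show ?thesis
    proof (cases "(h, v)" rule: rletter.cases)
      case (1 r j)
      then show ?thesis using g XX by (simp del: lpar.simps rletter.simps)
    next
      case (2 s j)
      then show ?thesis using g by (simp add: L.sid.zero)
    next
      case (3 j s)
      then have *: "g = X (Inl t) i" "h = Y j s" using g by simp_all
      show ?thesis unfolding * XY by (simp add: L.sid.zero del: lpar.simps rletter.simps)
    qed
  next
    case g: (3 i s)
    show ?thesis
    proof (cases "(h, v)" rule: rletter.cases)
      case (1 r j)
      then have *: "g = Y i s" "h = X (Inl r) j" using g by simp_all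
      show ?thesis unfolding * YX by (simp add: L.sid.zero del: lpar.simps rletter.simps)
    next
      case (2 s j)
      then show ?thesis using g by (simp add: L.sid.zero L.rder_linear)
    next
      case (3 j r)
      then have *: "g = Y i s" "h = Y j r" using g by simp_all
      show ?thesis unfolding * YY[of j r i s] by (simp add: L.sid.zero del: lpar.simps rletter.simps)
    qed
  qed (simp add: L.sid.zero rletter_linear)
qed

lemma ra_sid:
  assumes "f \<in> L.sid"
  shows "ra v f \<in> L.sid"
proof (rule L.sid_clinear[OF clinear_ra assms])
  fix u g h w
  have "ra (ra v (word u)) (L.scomm g h) \<in> L.sid"
    using rletter_scomm by (simp add: L.scomm_def ra_linear ra_word)
  then show "ra v (word u * (L.scomm g h * word w)) \<in> L.sid"
    by (simp add: ra_mult ra_sid_left)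
qed (auto intro: L.sid.intros L.sid_scale)

text \<open>The derivatives transform like a basis dual to the letters. The twist of
  \<open>v\<close> arises because \<open>D k l\<close> comes from the left and passes
  \<open>v\<close> before it reaches the derivative on the right.\<close>

lemma D_rder:
  "D k l (L.rder (X t i) v) = L.rder (X t i) (D k l v)
     - (if i = k then ksgn (epar k l + epar k l * ipar k) \<cdot> L.rder (X t l) (L.tw (epar k l) v) else 0)"
proof (rule clinear_eqI[where a=v])
  let ?e = "epar k l"
  let ?c = "ksgn (?e + ?e * ipar k)"
  fix w show "D k l (L.rder (X t i) (word w)) = L.rder (X t i) (D k l (word w))
     - (if i = k then ?c \<cdot> L.rder (X t l) (L.tw ?e (word w)) else 0)"
  proof (induction w)
    case (Cons g w)
    let ?g = "word [g]" and ?w = "word w"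
    let ?i = "if g = X t i then 1 else 0 :: letter falg"
    have 1: "D k l (L.rder (X t i) (word (g # w)))
        = ?i * (ksgn (?e * lpar (X t i)) \<cdot> L.tw (lpar (X t i)) (D k l ?w))
          + (D k l ?g * L.rder (X t i) ?w + L.tw ?e ?g * D k l (L.rder (X t i) ?w))"
    proof -
      have "D k l (?i * L.tw (lpar (X t i)) ?w) = ?i * D k l (L.tw (lpar (X t i)) ?w)"
        by (simp add: D_linear)
      moreover have "L.rder (X t i) (word (g # w)) = ?i * L.tw (lpar (X t i)) ?w + ?g * L.rder (X t i) ?w"
        by (subst word_Cons) (simp add: L.rder_mult L.rder_letter)
      ultimately show ?thesis
        by (simp add: D_linear D_mult D_tw mult.commute[of "lpar (X t i)"] del: lpar.simps)
    qed
    have 2: "L.rder (X t i) (D k l (word (g # w)))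
        = L.rder (X t i) (D k l ?g) * L.tw (lpar (X t i)) ?w + D k l ?g * L.rder (X t i) ?w
          + (L.rder (X t i) (L.tw ?e ?g) * L.tw (lpar (X t i)) (D k l ?w)
          + L.tw ?e ?g * L.rder (X t i) (D k l ?w))"
      by (subst word_Cons) (simp only: L.rder_mult D_mult L.rder_linear)
    have 3: "L.rder (X t l) (L.tw ?e (word (g # w)))
        = L.rder (X t l) (L.tw ?e ?g) * L.tw (lpar (X t l)) (L.tw ?e ?w)
          + L.tw ?e ?g * L.rder (X t l) (L.tw ?e ?w)"
      by (subst word_Cons) (simp only: L.rder_mult L.tw_mult)
    have 4: "L.rder (X t i) (L.tw ?e ?g)
        = ksgn (?e * lpar (X t i)) \<cdot> (if g = X t i then 1 else 0)" for i
      by (simp add: L.tw_letter L.rder_linear L.rder_letter)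
    \<comment> \<open>The correction term has one source: \<open>D k l\<close> turns
      \<open>X t l\<close> into \<open>X t k\<close>, which the derivative then removes.\<close>
    have 5: "L.rder (X t i) (D k l ?g) * L.tw (lpar (X t i)) ?w
        = (if i = k then ?c \<cdot> (L.rder (X t l) (L.tw ?e ?g) * L.tw (lpar (X t l)) (L.tw ?e ?w)) else 0)"
    proof (cases "i = k \<and> g = X t l")
      case True
      have "ksgn (?e * tpar t) = ?c * ksgn (?e * (tpar t + ipar l))"
        by (cases "ipar k"; cases "ipar l"; cases "tpar t"; simp)
      moreover have "tpar t + ipar l + ?e = tpar t + ipar k"
        by (cases "ipar k"; cases "ipar l"; cases "tpar t"; simp)
      ultimately show ?thesis
        using True by (simp add: L.tw_tw D_letter L.rder_linear L.rder_letter L.tw_letter sc_simps)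
    next
      case False
      then have "L.rder (X t i) (D k l ?g) = 0"
        by (cases g) (auto simp: D_letter L.rder_linear L.rder_letter)
      moreover have "i = k \<Longrightarrow> L.rder (X t l) (L.tw ?e ?g) = 0"
        using False by (auto simp: L.tw_letter L.rder_linear L.rder_letter)
      ultimately show ?thesis by simp
    qed
    show ?case
      unfolding 1 2 3 5 Cons 4[of i]
      by (simp add: falg_simps del: lpar.simps)
  qed (simp add: D_linear L.rder_linear L.tw_linear)
qed (intro clin)+

lemma D_rletter:
  "D k l (rletter g v) = rletter g (D k l v) + ra (L.tw (epar k l) v) (hF k l g)"
proof (cases "(g, v)" rule: rletter.cases)
  case (1 t i)
  then show ?thesis
    by (simp add: D_mult D_letter ra_linear ra_letter sc_simps)
next
  case (2 s i)
  then show ?thesis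
    by (simp add: D_linear ra_linear ra_letter)
next
  case (3 i s)
  \<comment> \<open>Here the sign \<open>ksgn (ipar i)\<close> in \<open>rletter\<close> is used: it
    converts the coefficient of \<open>D_rder\<close> into that of \<open>hF\<close>.\<close>
  have "ksgn (ipar k) * ksgn (epar k l + epar k l * ipar k) = ksgn (epar k l * ipar k) * ksgn (ipar l)"
    by (cases "ipar k"; cases "ipar l"; simp)
  with 3 show ?thesis
    by (simp add: D_linear D_rder ra_linear ra_letter sc_simps)
qed

lemma tw_rletter: "L.tw d (rletter g v) = ksgn (d * lpar g) \<cdot> rletter g (L.tw d v)"
  by (cases "(g, v)" rule: rletter.cases)
    (simp_all add: L.tw_mult L.tw_letter L.tw_linear L.tw_rder sc_simps ac_simps)

text \<open>The Leibniz rule for applying an operator to an argument. If \<open>f\<close> is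
  invariant, the last term lies in the ideal, and acting by \<open>f\<close> commutes with
  \<open>gl(V)\<close>.\<close>

lemma D_ra: "D k l (ra v f) = ra (D k l v) f + ra (L.tw (epar k l) v) (DF k l f)"
proof (rule clinear_eqI[where a=f])
  fix w show "D k l (ra v (word w)) = ra (D k l v) (word w) + ra (L.tw (epar k l) v) (DF k l (word w))"
  proof (induction w arbitrary: v)
    case (Cons g w)
    let ?e = "epar k l"
    have "D k l (ra v (word (g # w))) = D k l (ra (rletter g v) (word w))"
      by (simp add: ra_word)
    also have "\<dots> = ra (rletter g (D k l v)) (word w) + (ra (ra (L.tw ?e v) (hF k l g)) (word w)
        + ra (L.tw ?e (rletter g v)) (DF k l (word w)))"
      by (simp add: Cons D_rletter ra_left_linear)
    also have "ra (rletter g (D k l v)) (word w) = ra (D k l v) (word (g # w))"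
      by (simp add: ra_word)
    also have "ra (ra (L.tw ?e v) (hF k l g)) (word w) + ra (L.tw ?e (rletter g v)) (DF k l (word w))
        = ra (L.tw ?e v) (DF k l (word (g # w)))"
      by (subst word_Cons)
        (simp add: DF_mult DF_letter L.tw_letter tw_rletter ra_linear ra_left_linear ra_mult ra_letter sc_simps)
    finally show ?case .
  qed (simp add: ra_linear)
qed (intro clin)+


section \<open>The contravariant Hermitian form\<close>

definition ip :: "letter falg \<Rightarrow> letter falg \<Rightarrow> complex" where
  "ip a b = (\<Sum>w\<in>Poly_Mapping.keys a. Poly_Mapping.lookup a w * cnj (Poly_Mapping.lookup b w))"

lemma ip_superset:
  "finite A \<Longrightarrow> Poly_Mapping.keys a \<subseteq> A \<Longrightarrow>
    ip a b = (\<Sum>w\<in>A. Poly_Mapping.lookup a w * cnj (Poly_Mapping.lookup b w))"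
  unfolding ip_def by (rule sum.mono_neutral_left) (auto simp: in_keys_iff)

lemma ip_add_left: "ip (a + b) c = ip a c + ip b c"
  using ip_superset[of "Poly_Mapping.keys a \<union> Poly_Mapping.keys b" "a + b" c]
    ip_superset[of "Poly_Mapping.keys a \<union> Poly_Mapping.keys b" a c]
    ip_superset[of "Poly_Mapping.keys a \<union> Poly_Mapping.keys b" b c] keys_add[of a b]
  by (simp add: lookup_add distrib_right sum.distrib)

lemma ip_scale_left: "ip (c \<cdot> a) b = c * ip a b"
  using ip_superset[of "Poly_Mapping.keys a" "c \<cdot> a" b] keys_sc[of c a]
  by (simp add: lookup_sc ip_def sum_distrib_left mult.assoc)

lemma ip_commute: "ip a b = cnj (ip b a)"
  using ip_superset[of "Poly_Mapping.keys a \<union> Poly_Mapping.keys b" a b]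
    ip_superset[of "Poly_Mapping.keys a \<union> Poly_Mapping.keys b" b a]
  by (simp add: mult.commute)

lemma ip_add_right: "ip c (a + b) = ip c a + ip c b"
  by (metis ip_commute ip_add_left complex_cnj_add)

lemma ip_scale_right: "ip a (c \<cdot> b) = cnj c * ip a b"
  by (metis ip_commute ip_scale_left complex_cnj_mult)

lemma ip_0 [simp]: "ip 0 a = 0" "ip a 0 = 0"
  using ip_scale_left[of 0 0 a] ip_scale_right[of a 0 0] by simp_all

lemma ip_diff_left: "ip (a - b) c = ip a c - ip b c"
  using ip_add_left[of "a - b" b c] by simp

lemma ip_diff_right: "ip c (a - b) = ip c a - ip c b"
  using ip_add_right[of c "a - b" b] by simp

lemma ip_word_left: "ip (word w) b = cnj (Poly_Mapping.lookup b w)"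
  by (simp add: ip_def lookup_word)

lemma ip_self_eq_0:
  assumes "ip a a = 0"
  shows "a = 0"
proof -
  have "ip a a = of_real (\<Sum>w\<in>Poly_Mapping.keys a. (cmod (Poly_Mapping.lookup a w))\<^sup>2)"
    by (simp add: ip_def complex_mult_cnj cmod_power2)
  with assms have "(\<Sum>w\<in>Poly_Mapping.keys a. (cmod (Poly_Mapping.lookup a w))\<^sup>2) = 0"
    by (metis of_real_eq_0_iff)
  then have "\<forall>w\<in>Poly_Mapping.keys a. Poly_Mapping.lookup a w = 0"
    by (subst (asm) sum_nonneg_eq_0_iff) auto
  then show ?thesis
    by (metis in_keys_iff lookup_zero poly_mapping_eqI)
qed

lemma ip_eqI:
  assumes "\<And>a b. F (a + b) = F a + F b" "\<And>c a. F (c \<cdot> a) = c * F a"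
    and "\<And>a b. G (a + b) = G a + G b" "\<And>c a. G (c \<cdot> a) = c * G a"
    and "\<And>w. F (word w) = (G (word w) :: complex)"
  shows "F a = G a"
  by (induction a rule: falg_induct)
    (use assms assms(2)[of 0 0] assms(4)[of 0 0] in auto)

lemma lookup_letter_mult_Cons:
  "Poly_Mapping.lookup (word [h] * b) (g # w) = (if h = g then Poly_Mapping.lookup b w else 0)"
  for b :: "letter falg"
proof (rule falg_induct[of _ b])
  fix c u
  show "Poly_Mapping.lookup (word [h] * c \<cdot> word u) (g # w)
    = (if h = g then Poly_Mapping.lookup (c \<cdot> word u) w else 0)"
    by (simp add: sc_simps lookup_sc word_append[symmetric] lookup_word)
qed (simp_all add: distrib_left lookup_add)

lemma lookup_letter_mult_Nil: "Poly_Mapping.lookup (word [h] * b) [] = 0" for b :: "letter falg"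
  using keys_mult[of "word [h]" b] by (auto simp: plus_list_def in_keys_iff)

lemma hD_real: "\<exists>c h. hD k l g = c \<cdot> word [h] \<and> cnj c = c"
proof (cases "\<exists>t. g = X t l")
  case True
  then obtain t where "g = X t l" ..
  then show ?thesis
    by (intro exI[of _ "ksgn (epar k l * tpar t)"] exI[of _ "X t k"]) (simp add: ksgn_def)
next
  case False
  then have "hD k l g = 0 \<cdot> word [g]" by (cases g) auto
  then show ?thesis by (metis complex_cnj_zero)
qed

lemma lookup_D_Nil: "Poly_Mapping.lookup (D k l (word w)) [] = 0"
proof (cases w)
  case (Cons g v)
  obtain c h where "hD k l g = c \<cdot> word [h]" using hD_real by blast
  then show ?thesis
    unfolding Cons by (subst word_Cons)
      (simp add: D_mult D_letter L.tw_letter sc_simps lookup_add lookup_sc lookup_letter_mult_Nil)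
qed simp

lemma lookup_D_Cons:
  "Poly_Mapping.lookup (D k l (word (g # w))) (h # u)
    = Poly_Mapping.lookup (hD k l g) [h] * (if u = w then 1 else 0)
      + ksgn (epar k l * lpar g) * (if g = h then Poly_Mapping.lookup (D k l (word w)) u else 0)"
proof -
  obtain c g' where "hD k l g = c \<cdot> word [g']" using hD_real by blast
  then show ?thesis
    by (subst word_Cons)
      (simp add: D_mult D_letter L.tw_letter sc_simps lookup_add lookup_sc lookup_letter_mult_Cons
        lookup_word del: lpar.simps)
qed

text \<open>\<open>D k l\<close> changes one letter. Its sign depends on \<open>epar k l\<close>, on
  the unchanged preceding letters and on the label \<open>t\<close> of the changed letter, but not
  on the order of \<open>k\<close> and \<open>l\<close>, and all coefficients are real.\<close>

lemma lookup_D: "Poly_Mapping.lookup (D k l (word w)) v = cnj (Poly_Mapping.lookup (D l k (word v)) w)"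
proof (induction w arbitrary: v)
  case Nil
  then show ?case by (simp add: lookup_D_Nil)
next
  case (Cons g w)
  show ?case
  proof (cases v)
    case Nil
    then show ?thesis by (simp add: lookup_D_Nil)
  next
    case v: (Cons h u)
    have 2: "Poly_Mapping.lookup (hD k l g) [h] = cnj (Poly_Mapping.lookup (hD l k h) [g])"
      by (cases g; cases h) (auto simp: lookup_sc lookup_word add.commute[of "ipar l"] ksgn_def)
    show ?thesis
      unfolding v lookup_D_Cons 2 Cons
      by (auto simp: add.commute[of "ipar l"] ksgn_def simp del: lpar.simps)
  qed
qed

lemma ip_D: "ip (D k l a) b = ip a (D l k b)"
proof (rule ip_eqI[where a=a])
  fix w
  have "cnj (ip (D k l (word w)) b) = cnj (ip (word w) (D l k b))"
  proof (rule ip_eqI[where a=b])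
    fix v
    have "ip (D k l (word w)) (word v) = cnj (ip (word v) (D k l (word w)))"
      by (rule ip_commute)
    then show "cnj (ip (D k l (word w)) (word v)) = cnj (ip (word w) (D l k (word v)))"
      using lookup_D[of k l w v] by (simp add: ip_word_left)
  qed (simp_all add: ip_add_right ip_scale_right D_linear)
  then show "ip (D k l (word w)) b = ip (word w) (D l k b)" by simp
qed (simp_all add: ip_add_left ip_scale_left D_linear)

text \<open>Gram-Schmidt over the index set; the values of \<open>G\<close> may be linearly
  dependent. The induction hypothesis is applied both to \<open>e\<close> and to the new vector
  \<open>G b\<close>.\<close>

lemma orthogonal_decomposition:
  assumes "finite A"
  shows "\<exists>c. \<forall>g\<in>A. ip (e - (\<Sum>h\<in>A. c h \<cdot> G h)) (G g) = 0"
  using assms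
proof (induction A arbitrary: e rule: finite_induct)
  case (insert b A)
  obtain c where c: "\<forall>g\<in>A. ip (e - (\<Sum>h\<in>A. c h \<cdot> G h)) (G g) = 0" using insert.IH by blast
  obtain d where d: "\<forall>g\<in>A. ip (G b - (\<Sum>h\<in>A. d h \<cdot> G h)) (G g) = 0" using insert.IH by blast
  define e2 where "e2 = e - (\<Sum>h\<in>A. c h \<cdot> G h)"
  define b2 where "b2 = G b - (\<Sum>h\<in>A. d h \<cdot> G h)"
  \<comment> \<open>If \<open>b2 = 0\<close>, the quotient is 0 by convention, which is consistent
    since every vector is orthogonal to \<open>b2\<close> then.\<close>
  define r where "r = ip e2 b2 / ip b2 b2"
  let ?c = "\<lambda>h. if h = b then r else c h - r * d h"
  have s: "(\<Sum>h\<in>A. ?c h \<cdot> G h) = (\<Sum>h\<in>A. c h \<cdot> G h) - r \<cdot> (\<Sum>h\<in>A. d h \<cdot> G h)"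
  proof -
    have "(c h - r * d h) \<cdot> x = c h \<cdot> x - r \<cdot> d h \<cdot> x" for h x
      using sc_add[of "c h" "- (r * d h)" x] by (simp add: sc_minus sc_simps)
    then have "(\<Sum>h\<in>A. ?c h \<cdot> G h) = (\<Sum>h\<in>A. c h \<cdot> G h - r \<cdot> d h \<cdot> G h)"
      using insert.hyps by (intro sum.cong) auto
    then show ?thesis by (simp add: sum_subtractf sc_sum)
  qed
  have e: "e - (\<Sum>h\<in>insert b A. ?c h \<cdot> G h) = e2 - r \<cdot> b2"
    unfolding sum.insert[OF insert.hyps] s by (simp add: e2_def b2_def sc_simps)
  have A: "ip (e2 - r \<cdot> b2) (G g) = 0" if "g \<in> A" for g
    using c d that by (simp add: e2_def b2_def ip_diff_left ip_scale_left)
  have "ip x (\<Sum>h\<in>A. d h \<cdot> G h) = (\<Sum>h\<in>A. cnj (d h) * ip x (G h))" for x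
    by (induction A rule: infinite_finite_induct) (auto simp: ip_add_right ip_scale_right)
  then have sum: "ip (e2 - r \<cdot> b2) (\<Sum>h\<in>A. d h \<cdot> G h) = 0"
    using A by simp
  have "ip (e2 - r \<cdot> b2) b2 = 0"
    using ip_self_eq_0[of b2] by (auto simp: r_def ip_diff_left ip_scale_left)
  then have "ip (e2 - r \<cdot> b2) (G b) = 0"
    using sum by (simp add: b2_def ip_diff_right)
  with A show ?case
    unfolding e[symmetric] by (intro exI[of _ ?c]) auto
qed simp

section \<open>Restriction of letters, and degrees\<close>

text \<open>Used for two purposes: as the projection onto words over \<open>V\<close>, and as the
  evaluation of the auxiliary letters at 0.\<close>

definition res :: "(letter \<Rightarrow> bool) \<Rightarrow> letter falg \<Rightarrow> letter falg" where
  "res Q = subst (\<lambda>g. if Q g then word [g] else 0)"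

lemma clinear_res: "clinear (res Q)"
  by (simp add: res_def clinear_subst)

lemmas [clin] = clinear_comp[OF clinear_res]

lemmas res_linear = clinear_add[OF clinear_res] clinear_scale[OF clinear_res]
  clinear_diff[OF clinear_res] clinear_sum[OF clinear_res] clinear_zero[OF clinear_res]

lemma res_mult: "res Q (a * b) = res Q a * res Q b"
  by (simp add: res_def subst_mult)

lemma res_letter: "res Q (word [g]) = (if Q g then word [g] else 0)"
  by (simp add: res_def)

lemma res_1 [simp]: "res Q 1 = 1"
  by (simp add: res_def)

lemma res_word: "res Q (word w) = (if \<forall>g\<in>set w. Q g then word w else 0)"
proof (induction w)
  case (Cons g w)
  then show ?case by (subst (1 2) word_Cons) (auto simp: res_mult res_letter)
qed simp

lemma lookup_res: "Poly_Mapping.lookup (res Q a) v = (if \<forall>g\<in>set v. Q g then Poly_Mapping.lookup a v else 0)"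
proof (induction a rule: falg_induct)
  case (scale c w)
  then show ?case by (auto simp: res_linear res_word lookup_sc lookup_word)
qed (simp_all add: res_linear lookup_add)

lemma res_Free: "a \<in> Free A \<Longrightarrow> (\<And>g. g \<in> A \<Longrightarrow> Q g) \<Longrightarrow> res Q a = a"
  by (rule poly_mapping_eqI) (auto simp: lookup_res Free_def in_keys_iff subset_iff)

lemma Free_res: "a \<in> Free A \<Longrightarrow> res Q a \<in> Free (A \<inter> Collect Q)"
  by (rule Free_clinear[OF clinear_res]) (auto simp: res_word Free_word Free_0)

lemma res_sid: "a \<in> L.sid \<Longrightarrow> res Q a \<in> L.sid"
  unfolding res_def
proof (erule L.subst_sid)
  fix g h
  show "subst (\<lambda>g. if Q g then word [g] else 0) (L.scomm g h) \<in> L.sid"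
    using L.scomm_in_sid[of g h] by (auto simp: L.scomm_def word2 subst_linear subst_mult L.sid.zero)
qed

lemma res_eqv: "a \<approx> b \<Longrightarrow> res Q a \<approx> res Q b"
  by (rule L.eqv_clinear[OF clinear_res res_sid])

lemma res_tw: "res Q (L.tw d a) = L.tw d (res Q a)"
proof (rule clinear_eqI[where a=a])
  fix w show "res Q (L.tw d (word w)) = L.tw d (res Q (word w))"
    by (simp add: L.tw_word res_linear res_word L.tw_linear)
qed (intro clin)+

lemma res_D:
  assumes "\<And>t. Q (X t k) \<longleftrightarrow> Q (X t l)"
  shows "res Q (D k l a) = D k l (res Q a)"
proof (rule clinear_eqI[where a=a])
  have g: "res Q (hD k l g) = (if Q g then hD k l g else 0)" for g
    using assms by (cases g) (auto simp: res_linear res_letter)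
  fix w show "res Q (D k l (word w)) = D k l (res Q (word w))"
  proof (induction w)
    case (Cons h w)
    then show ?case
      by (subst (1 2) word_Cons) (auto simp: D_mult D_letter res_linear res_mult g res_letter res_tw D_linear)
  qed (simp add: res_linear)
qed (intro clin)+

lemma res_D_eq_0:
  assumes "\<And>t. \<not> Q (X t k)"
  shows "res Q (D k l a) = 0"
proof (rule clinear_eqI[where a=a])
  have g: "res Q (hD k l g) = 0" for g
    using assms by (cases g) (auto simp: res_linear res_letter)
  fix w show "res Q (D k l (word w)) = 0"
  proof (induction w)
    case (Cons h w)
    then show ?case
      by (subst word_Cons) (auto simp: D_mult D_letter res_linear res_mult g)
  qed (simp add: res_linear)
qed (intro clin)+

lemma Free_tw: "a \<in> Free A \<Longrightarrow> L.tw d a \<in> Free A"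
  unfolding L.tw_def by (rule subst_Free) (auto simp: Free_scale Free_word)

lemma Free_D:
  assumes "a \<in> Free A" and "\<And>g. g \<in> A \<Longrightarrow> hD k l g \<in> Free A"
  shows "D k l a \<in> Free A"
proof (rule Free_clinear[OF clinear_D assms(1)])
  fix w assume "w \<in> lists A"
  then show "D k l (word w) \<in> Free A"
  proof (induction w)
    case (Cons g w)
    then show ?case
      by (subst word_Cons)
        (auto simp: D_mult D_letter Free_word intro!: Free_add Free_mult Free_tw assms(2))
  qed (simp add: Free_0)
qed

lemma D_eq_0:
  assumes "a \<in> Free A" and "\<And>g. g \<in> A \<Longrightarrow> hD k l g = 0"
  shows "D k l a = 0"
proof (rule clinear_eq_on[OF clinear_D clinear_0])
  fix w assume "w \<in> Poly_Mapping.keys a"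
  then have "set w \<subseteq> A" using assms(1) by (auto simp: Free_def)
  then show "D k l (word w) = 0"
  proof (induction w)
    case (Cons g w)
    then show ?case by (subst word_Cons) (simp add: D_mult D_letter assms(2))
  qed simp
qed

lemma rder_eq_0:
  assumes "a \<in> Free A" and "x \<notin> A"
  shows "L.rder x a = 0"
proof (rule clinear_eq_on[OF L.clinear_rder clinear_0])
  fix w assume "w \<in> Poly_Mapping.keys a"
  then have "set w \<subseteq> A" using assms(1) by (auto simp: Free_def)
  then show "L.rder x (word w) = 0"
  proof (induction w)
    case (Cons g w)
    then show ?case using assms(2) by (subst word_Cons) (auto simp: L.rder_mult L.rder_letter)
  qed simp
qed

lemma Free_rder:
  assumes "a \<in> Free A"
  shows "L.rder x a \<in> Free A"
proof (rule Free_clinear[OF L.clinear_rder assms])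
  fix w assume "w \<in> lists A"
  then show "L.rder x (word w) \<in> Free A"
  proof (induction w)
    case (Cons g w)
    then show ?case
      by (subst word_Cons)
        (auto simp: L.rder_mult L.rder_letter Free_word Free_0 intro!: Free_add Free_mult Free_tw)
  qed (simp add: Free_0)
qed

lemma Free_ra:
  assumes "v \<in> Free A" and "f \<in> Free B" and "\<And>t i. X (Inl t) i \<in> B \<Longrightarrow> X (Inl t) i \<in> A"
  shows "ra v f \<in> Free A"
proof (rule Free_clinear[OF clinear_ra assms(2)])
  fix w assume "w \<in> lists B"
  then show "ra v (word w) \<in> Free A"
    using assms(1)
  proof (induction w arbitrary: v)
    case (Cons g w)
    have "rletter g v \<in> Free A"
      using Cons.prems Cons.hyps assms(3)
      by (cases "(g, v)" rule: rletter.cases)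
        (auto simp: Free_0 Free_word intro!: Free_mult Free_scale Free_rder)
    then show ?case using Cons.IH[of "rletter g v"] by (simp add: ra_word)
  qed simp
qed

section \<open>Homogeneous components by word length\<close>

definition Deg :: "nat \<Rightarrow> letter falg set" where
  "Deg d = {a. \<forall>w\<in>Poly_Mapping.keys a. length w = d}"

lemma Deg_0: "0 \<in> Deg d"
  by (simp add: Deg_def)

lemma Deg_add: "a \<in> Deg d \<Longrightarrow> b \<in> Deg d \<Longrightarrow> a + b \<in> Deg d"
  using keys_add[of a b] by (auto simp: Deg_def)

lemma Deg_scale: "a \<in> Deg d \<Longrightarrow> c \<cdot> a \<in> Deg d"
  using keys_sc[of c a] by (auto simp: Deg_def)

lemma Deg_diff: "a \<in> Deg d \<Longrightarrow> b \<in> Deg d \<Longrightarrow> a - b \<in> Deg d"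
  using Deg_add[of a d "- b"] Deg_scale[of b d "- 1"] by (simp add: sc_minus)

lemma Deg_sum: "(\<And>i. i \<in> A \<Longrightarrow> f i \<in> Deg d) \<Longrightarrow> sum f A \<in> Deg d"
  by (induction A rule: infinite_finite_induct) (auto intro: Deg_0 Deg_add)

lemma Deg_word: "word w \<in> Deg d \<longleftrightarrow> length w = d"
  by (simp add: Deg_def)

lemma Deg_mult: "a \<in> Deg d \<Longrightarrow> b \<in> Deg e \<Longrightarrow> a * b \<in> Deg (d + e)"
  using keys_mult[of a b] by (fastforce simp: Deg_def plus_list_def)

lemma Deg_D_word: "D k l (word w) \<in> Deg (length w)"
proof (induction w)
  case (Cons g w)
  obtain c h where "hD k l g = c \<cdot> word [h]" using hD_real by blast
  then have "hD k l g \<in> Deg 1" by (simp add: Deg_scale Deg_word)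
  moreover have "L.tw (epar k l) (word [g]) \<in> Deg 1"
    by (simp add: L.tw_letter Deg_scale Deg_word)
  ultimately show ?case
    using Deg_mult[of "hD k l g" 1 "word w" "length w"] Deg_mult[of "L.tw (epar k l) (word [g])" 1 _ "length w"] Cons
    by (subst word_Cons) (auto simp: D_mult D_letter Deg_word intro!: Deg_add)
qed (simp add: Deg_0)

lemma Deg_D: "a \<in> Deg d \<Longrightarrow> D k l a \<in> Deg d"
proof (rule clinear_closed[OF clinear_D])
  fix w assume "a \<in> Deg d" "w \<in> Poly_Mapping.keys a"
  then show "D k l (word w) \<in> Deg d" using Deg_D_word[of k l w] by (simp add: Deg_def)
qed (auto intro: Deg_0 Deg_add Deg_scale)

definition hpr :: "nat \<Rightarrow> letter falg \<Rightarrow> letter falg" where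
  "hpr d = lin (\<lambda>w. if length w = d then word w else 0)"

lemma clinear_hpr: "clinear (hpr d)"
  by (simp add: hpr_def clinear_lin)

lemmas [clin] = clinear_comp[OF clinear_hpr]

lemmas hpr_linear = clinear_add[OF clinear_hpr] clinear_scale[OF clinear_hpr]
  clinear_diff[OF clinear_hpr] clinear_sum[OF clinear_hpr] clinear_zero[OF clinear_hpr]

lemma hpr_word: "hpr d (word w) = (if length w = d then word w else 0)"
  by (simp add: hpr_def)

lemma hpr_Deg: "a \<in> Deg e \<Longrightarrow> hpr d a = (if d = e then a else 0)"
proof -
  assume a: "a \<in> Deg e"
  show "hpr d a = (if d = e then a else 0)"
    by (rule clinear_eq_on[where F="hpr d" and G="\<lambda>a. if d = e then a else 0"])
      (use a in \<open>auto simp: hpr_word Deg_def intro: clin clinear_hpr\<close>)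
qed

lemma hpr_in_Deg: "hpr d a \<in> Deg d"
  by (rule clinear_closed[OF clinear_hpr]) (auto simp: hpr_word Deg_word intro: Deg_0 Deg_add Deg_scale)

lemma Free_hpr: "a \<in> Free A \<Longrightarrow> hpr d a \<in> Free A"
  by (rule Free_clinear[OF clinear_hpr]) (auto simp: hpr_word Free_word Free_0)

lemma scomm_Deg: "L.scomm g h \<in> Deg 2"
  unfolding L.scomm_def by (intro Deg_diff Deg_scale) (simp_all add: Deg_word)

text \<open>The ideal is graded because supercommutators are homogeneous of degree 2.\<close>

lemma hpr_sid: "a \<in> L.sid \<Longrightarrow> hpr d a \<in> L.sid"
proof (rule L.sid_clinear[OF clinear_hpr])
  fix u g h v
  have "word u * (L.scomm g h * word v) \<in> Deg (length u + (2 + length v))"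
    by (intro Deg_mult scomm_Deg) (simp_all add: Deg_word)
  then show "hpr d (word u * (L.scomm g h * word v)) \<in> L.sid"
    using L.sid.base[of 1 u g h v] by (auto simp: hpr_Deg L.sid.zero)
qed (auto intro: L.sid.intros L.sid_scale)

lemma sum_hpr: "(\<And>w. w \<in> Poly_Mapping.keys a \<Longrightarrow> length w \<le> N) \<Longrightarrow> (\<Sum>d\<le>N. hpr d a) = a"
proof (rule clinear_eq_on[where F="\<lambda>a. \<Sum>d\<le>N. hpr d a"])
  fix w assume "\<And>w. w \<in> Poly_Mapping.keys a \<Longrightarrow> length w \<le> N" "w \<in> Poly_Mapping.keys a"
  then show "(\<Sum>d\<le>N. hpr d (word w)) = word w" by (simp add: hpr_word)
qed (intro clin)+

text \<open>The linear span saturated under \<open>\<approx>\<close>, so membership depends only on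
  the class in the symmetric superalgebra.\<close>

inductive_set spn :: "letter falg set \<Rightarrow> letter falg set" for B where
  base: "b \<in> B \<Longrightarrow> b \<in> spn B"
| zero: "0 \<in> spn B"
| add: "a \<in> spn B \<Longrightarrow> b \<in> spn B \<Longrightarrow> a + b \<in> spn B"
| scale: "a \<in> spn B \<Longrightarrow> c \<cdot> a \<in> spn B"
| eqv: "a \<in> spn B \<Longrightarrow> a \<approx> b \<Longrightarrow> b \<in> spn B"

lemma spn_clinear:
  assumes "clinear F" and "\<And>a. a \<in> L.sid \<Longrightarrow> F a \<in> L.sid" and "\<And>b. b \<in> B \<Longrightarrow> F b \<in> spn C" and "a \<in> spn B"
  shows "F a \<in> spn C"
  using assms(4)
proof (induction rule: spn.induct)
  case (eqv a b)
  then show ?case using L.eqv_clinear[OF assms(1,2)] by (blast intro: spn.eqv)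
qed (use assms in \<open>auto simp: clinear_zero clinear_add clinear_scale intro: spn.intros\<close>)

lemma spn_sum: "(\<And>i. i \<in> A \<Longrightarrow> f i \<in> spn B) \<Longrightarrow> sum f A \<in> spn B"
  by (induction A rule: infinite_finite_induct) (auto intro: spn.intros)

section \<open>Products of matrix units and the enveloping algebra\<close>

fun Dl :: "(idx \<times> idx) list \<Rightarrow> letter falg \<Rightarrow> letter falg" where
  "Dl [] a = a"
| "Dl ((k, l) # ps) a = D k l (Dl ps a)"

lemma Dl_append: "Dl (ps @ qs) a = Dl ps (Dl qs a)"
  by (induction ps) auto

lemma clinear_Dl: "clinear (Dl ps)"
proof (induction ps)
  case (Cons p ps)
  obtain k l where p: "p = (k, l)" by force
  show ?case using clinear_comp[OF clinear_D Cons, of k l] by (simp add: p fun_eq_iff[symmetric, of "Dl _"])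
qed (simp add: clinear_id[unfolded id_def] fun_eq_iff)

lemmas [clin] = clinear_comp[OF clinear_Dl]

lemmas Dl_linear = clinear_add[OF clinear_Dl] clinear_scale[OF clinear_Dl]
  clinear_diff[OF clinear_Dl] clinear_sum[OF clinear_Dl] clinear_zero[OF clinear_Dl]

lemma Dl_sid: "a \<in> L.sid \<Longrightarrow> Dl ps a \<in> L.sid"
  by (induction ps) (auto intro: D_sid)

lemma Dl_eqv: "a \<approx> b \<Longrightarrow> Dl ps a \<approx> Dl ps b"
  by (rule L.eqv_clinear[OF clinear_Dl Dl_sid])

lemma Deg_Dl: "a \<in> Deg d \<Longrightarrow> Dl ps a \<in> Deg d"
  by (induction ps) (auto intro: Deg_D)

lemma ip_Dl: "ip (Dl ps a) b = ip a (Dl (rev (map prod.swap ps)) b)"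
  by (induction ps arbitrary: b) (auto simp: ip_D Dl_append)

lemma Dl_letter_mult:
  assumes "\<And>k l. (k, l) \<in> set ps \<Longrightarrow> hD k l g = 0"
  shows "\<exists>c. \<forall>q. Dl ps (word [g] * q) = c \<cdot> (word [g] * Dl ps q)"
  using assms
proof (induction ps)
  case Nil
  then show ?case by (intro exI[of _ 1]) simp
next
  case (Cons p ps)
  obtain k l where p: "p = (k, l)" by force
  obtain c where c: "\<And>q. Dl ps (word [g] * q) = c \<cdot> (word [g] * Dl ps q)"
    using Cons by (metis list.set_intros(2))
  show ?case
    using Cons.prems by (intro exI[of _ "c * ksgn (epar k l * lpar g)"])
      (auto simp: p c D_linear D_mult D_letter L.tw_letter sc_simps)
qed

text \<open>The operators through which the enveloping algebra of \<open>gl(V)\<close> acts. New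
  factors are added on the right, the side from which \<open>compression\<close> peels them
  off.\<close>

inductive Uop :: "idx set \<Rightarrow> (letter falg \<Rightarrow> letter falg) \<Rightarrow> bool" for V where
  id: "Uop V (\<lambda>a. a)"
| zero: "Uop V (\<lambda>a. 0)"
| add: "Uop V F \<Longrightarrow> Uop V G \<Longrightarrow> Uop V (\<lambda>a. F a + G a)"
| scale: "Uop V F \<Longrightarrow> Uop V (\<lambda>a. c \<cdot> F a)"
| D: "Uop V F \<Longrightarrow> k \<in> V \<Longrightarrow> l \<in> V \<Longrightarrow> Uop V (\<lambda>a. F (D k l a))"

lemma Uop_clinear: "Uop V F \<Longrightarrow> clinear F"
proof (induction rule: Uop.induct)
  case (D F k l)
  then show ?case using clinear_comp[OF D.IH clinear_D] by blast
qed (intro clin; simp)+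

lemma Uop_sid: "Uop V F \<Longrightarrow> a \<in> L.sid \<Longrightarrow> F a \<in> L.sid"
  by (induction arbitrary: a rule: Uop.induct) (auto intro: L.sid.intros L.sid_scale D_sid)

definition VX :: "idx set \<Rightarrow> letter set" where
  "VX V = {X t i | t i. i \<in> V}"

definition inV :: "idx set \<Rightarrow> letter \<Rightarrow> bool" where
  "inV V g \<longleftrightarrow> (case g of X t i \<Rightarrow> i \<in> V | Y i s \<Rightarrow> True)"

lemma inV_simps [simp]: "inV V (X t i) \<longleftrightarrow> i \<in> V" "inV V (Y i s)"
  by (simp_all add: inV_def)

lemma res_inV_VX: "a \<in> Free (VX V) \<Longrightarrow> res (inV V) a = a"
  by (erule res_Free) (auto simp: VX_def)

lemma D_VX: "a \<in> Free (VX V) \<Longrightarrow> k \<in> V \<Longrightarrow> D k l a \<in> Free (VX V)"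
  by (erule Free_D) (auto simp: VX_def Free_0 Free_word intro!: Free_scale)

lemma D_VX_0: "a \<in> Free (VX V) \<Longrightarrow> l \<notin> V \<Longrightarrow> D k l a = 0"
  by (erule D_eq_0) (auto simp: VX_def)

text \<open>The compression of the enveloping algebra of \<open>gl\<close> of the large space to words in letters of
  \<open>V\<close> is contained in the enveloping algebra of \<open>gl(V)\<close>: factors \<open>E\<^sub>k\<^sub>l\<close> with \<open>l\<close> outside \<open>V\<close>
  annihilate such words, and factors with \<open>k\<close> outside \<open>V\<close> are moved to the left, where the
  projection annihilates them.\<close>

lemma compression:
  "\<exists>F. Uop V F \<and> (\<forall>v\<in>Free (VX V). res (inV V) (Dl ps v) = F v)"
proof (induction ps rule: length_induct)
  case (1 ps)
  define Q where "Q G \<longleftrightarrow> (\<exists>F. Uop V F \<and> (\<forall>v\<in>Free (VX V). res (inV V) (G v) = F v))" for G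
  have Q_add: "Q (\<lambda>v. G v + H v)" if "Q G" "Q H" for G H
  proof -
    obtain F F' where "Uop V F" "\<forall>v\<in>Free (VX V). res (inV V) (G v) = F v"
      "Uop V F'" "\<forall>v\<in>Free (VX V). res (inV V) (H v) = F' v"
      using \<open>Q G\<close> \<open>Q H\<close> unfolding Q_def by blast
    then show ?thesis unfolding Q_def
      by (intro exI[of _ "\<lambda>v. F v + F' v"]) (auto intro: Uop.add simp: res_linear)
  qed
  have Q_scale: "Q (\<lambda>v. c \<cdot> G v)" if "Q G" for G c
  proof -
    obtain F where "Uop V F" "\<forall>v\<in>Free (VX V). res (inV V) (G v) = F v"
      using \<open>Q G\<close> unfolding Q_def by blast
    then show ?thesis unfolding Q_def
      by (intro exI[of _ "\<lambda>v. c \<cdot> F v"]) (auto intro: Uop.scale simp: res_linear)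
  qed
  have Q_0: "Q (\<lambda>v. 0)"
    unfolding Q_def by (intro exI[of _ "\<lambda>v. 0"]) (auto intro: Uop.zero simp: res_linear)
  have Q_cong: "Q G" if "Q H" "\<And>v. v \<in> Free (VX V) \<Longrightarrow> G v = H v" for G H
    using that unfolding Q_def by auto
  have IH: "Q (Dl qs)" if "length qs < length ps" for qs
    using 1 that unfolding Q_def by blast
  have "Q (Dl ps)"
  proof (cases ps rule: rev_cases)
    case Nil
    then show ?thesis unfolding Q_def
      by (intro exI[of _ "\<lambda>v. v"]) (auto intro: Uop.id simp: res_inV_VX)
  next
    case (snoc qs p)
    obtain k l where p: "p = (k, l)" by force
    consider "l \<notin> V" | "k \<in> V" "l \<in> V" | "k \<notin> V" "l \<in> V" by blast
    then show ?thesis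
    proof cases
      case 1
      then show ?thesis
        by (intro Q_cong[OF Q_0]) (simp add: snoc p Dl_append D_VX_0 Dl_linear)
    next
      case 2
      obtain F where F: "Uop V F" "\<forall>v\<in>Free (VX V). res (inV V) (Dl qs v) = F v"
        using IH[of qs] unfolding Q_def snoc by auto
      then show ?thesis unfolding Q_def
        using 2 by (intro exI[of _ "\<lambda>v. F (D k l v)"]) (auto intro: Uop.D simp: snoc p Dl_append D_VX)
    next
      case 3
      have "Q (\<lambda>v. Dl as (D k l (Dl bs v)))" if "length as + length bs = length qs" for as bs
        using that
      proof (induction as arbitrary: bs rule: rev_induct)
        case Nil
        show ?case
          unfolding Q_def using 3
          by (intro exI[of _ "\<lambda>v. 0"]) (auto intro: Uop.zero simp: res_D_eq_0)
      next
        case (snoc ij as)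
        obtain i j where ij: "ij = (i, j)" by force
        let ?s = "ksgn (epar i j * epar k l)"
        have 1: "Q (\<lambda>v. Dl as (D k l (Dl ((i, j) # bs) v)))"
          using snoc by (intro snoc.IH) simp
        \<comment> \<open>Each exchange of neighbouring factors costs two correction terms with one
          factor fewer; hence the induction on the length of \<open>ps\<close>.\<close>
        have 2: "Q (Dl (as @ (i, l) # bs))" "Q (Dl (as @ (k, j) # bs))"
          using snoc.prems \<open>ps = qs @ [p]\<close> by (auto intro!: IH)
        have "Q (\<lambda>v. (?s \<cdot> Dl as (D k l (Dl ((i, j) # bs) v))
            + (if j = k then 1 else 0) \<cdot> Dl (as @ (i, l) # bs) v)
            + (if l = i then - ?s else 0) \<cdot> Dl (as @ (k, j) # bs) v)"
          by (rule Q_add[OF Q_add[OF Q_scale[OF 1] Q_scale[OF 2(1)]] Q_scale[OF 2(2)]])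
        then show ?case
          by (rule Q_cong) (auto simp: ij Dl_append D_D[of i j k l] Dl_linear sc_minus)
      qed
      from this[of qs "[]"] show ?thesis
        by (rule Q_cong) (simp_all add: snoc p Dl_append)
    qed
  qed
  then show ?case unfolding Q_def .
qed

section \<open>The first fundamental theorem on words\<close>

lemma finite_sindex: "finite (sindex n m)"
  by (simp add: sindex_def)

fun isaux :: "letter \<Rightarrow> bool" where
  "isaux (X (Inr s) i) = True"
| "isaux g = False"

text \<open>The constant term in the auxiliary letters.\<close>

definition eps :: "letter falg \<Rightarrow> letter falg" where
  "eps = res (\<lambda>g. \<not> isaux g)"

lemma eps_D: "eps (D k l a) = D k l (eps a)"
proof -
  have "isaux (X t k) = isaux (X t l)" for t by (cases t) auto
  then show ?thesis unfolding eps_def by (intro res_D) simp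
qed

section \<open>Multilinear words, raising and lowering operators\<close>

locale fft_words =
  fixes n m :: nat and T S :: "idx set"
  assumes finite_T: "finite T" and finite_S: "finite S"
begin

abbreviation V :: "idx set" where
  "V \<equiv> sindex n m"

text \<open>The even indices of \<open>V\<close> run from 1 to \<open>n\<close>, so these are new.
  Being even, they make \<open>epar j (aux r)\<close> equal to \<open>ipar j\<close>.\<close>

definition aux :: "nat \<Rightarrow> idx" where
  "aux r = Inl (Suc (n + r))"

lemma aux_notin [simp]: "aux r \<notin> V"
  by (auto simp: aux_def sindex_def)

lemma aux_neq: "i \<in> V \<Longrightarrow> aux r \<noteq> i" "i \<in> V \<Longrightarrow> i \<noteq> aux r"
  using aux_notin by blast+

lemma ipar_aux [simp]: "ipar (aux r) = 0"
  by (simp add: aux_def)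

lemma aux_inj [simp]: "aux r = aux r' \<longleftrightarrow> r = r'"
  by (simp add: aux_def)

fun xw :: "nat \<Rightarrow> (idx + idx) list \<Rightarrow> letter list" where
  "xw r [] = []"
| "xw r (t # ts) = X t (aux r) # xw (Suc r) ts"

fun up :: "nat \<Rightarrow> idx list \<Rightarrow> (idx \<times> idx) list" where
  "up r [] = []"
| "up r (j # js) = (j, aux r) # up (Suc r) js"

text \<open>The order is opposite to that of \<open>up\<close>, so that \<open>Dl (dn r js)\<close>
  is the adjoint of \<open>Dl (up r js)\<close>; see \<open>rev_up\<close> and
  \<open>ip_Dl\<close>.\<close>

fun dn :: "nat \<Rightarrow> idx list \<Rightarrow> (idx \<times> idx) list" where
  "dn r [] = []"
| "dn r (i # is) = dn (Suc r) is @ [(aux r, i)]"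

lemma rev_up: "rev (map prod.swap (up r js)) = dn r js"
  by (induction js arbitrary: r) auto

lemma length_xw [simp]: "length (xw r ts) = length ts"
  by (induction ts arbitrary: r) auto

lemma xw_snoc: "xw r (ts @ [t]) = xw r ts @ [X t (aux (r + length ts))]"
  by (induction ts arbitrary: r) auto

lemma up_aux: "(k, l) \<in> set (up r js) \<Longrightarrow> \<exists>r'\<ge>r. l = aux r'"
proof (induction js arbitrary: r)
  case (Cons j js)
  show ?case
  proof (cases "(k, l) = (j, aux r)")
    case False
    then obtain r' where "r' \<ge> Suc r" "l = aux r'" using Cons by auto
    then show ?thesis by (intro exI[of _ r']) simp
  qed auto
qed simp

lemma Dl_up_letter:
  assumes "\<And>t r'. r' \<ge> r \<Longrightarrow> g \<noteq> X t (aux r')"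
  shows "\<exists>c. \<forall>q. Dl (up r js) (word [g] * q) = c \<cdot> (word [g] * Dl (up r js) q)"
proof (rule Dl_letter_mult)
  fix k l assume "(k, l) \<in> set (up r js)"
  then show "hD k l g = 0" using up_aux[of k l r js] assms by (cases g) auto
qed

text \<open>Each raising operator finds its new index in exactly one letter and replaces it, so no
  new index survives.\<close>

lemma Dl_up_xw:
  "length ts = length js \<Longrightarrow> set js \<subseteq> V \<Longrightarrow> Dl (up r js) (word (xw r ts)) \<in> Free (VX V)"
proof (induction js arbitrary: r ts)
  case (Cons j js)
  then obtain t us where ts: "ts = t # us" "length us = length js" by (cases ts) auto
  obtain c where c: "\<And>q. Dl (up (Suc r) js) (word [X t (aux r)] * q)
      = c \<cdot> (word [X t (aux r)] * Dl (up (Suc r) js) q)"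
    using Dl_up_letter[of "Suc r" "X t (aux r)" js] by auto
  let ?q = "Dl (up (Suc r) js) (word (xw (Suc r) us))"
  have q: "?q \<in> Free (VX V)" using Cons ts by auto
  have "Dl (up r (j # js)) (word (xw r ts)) = c \<cdot> (hD j (aux r) (X t (aux r)) * ?q)"
    by (simp add: ts word_Cons[of _ "xw (Suc r) us"] c D_linear D_mult D_letter D_VX_0[OF q])
  also have "\<dots> \<in> Free (VX V)"
    using Cons.prems q by (intro Free_scale Free_mult) (auto simp: Free_word VX_def intro!: Free_scale)
  finally show ?case .
qed (simp add: Free_1)

definition XT :: "letter set" where
  "XT = {X (Inl t) i | t i. t \<in> T \<and> i \<in> V}"

definition XA :: "letter set" where
  "XA = {X (Inr s) i | s i. s \<in> S \<and> i \<in> V}"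

definition YS :: "letter set" where
  "YS = {Y i s | i s. i \<in> V \<and> s \<in> S}"

lemma XT_VX: "XT \<subseteq> VX V" and XA_VX: "XA \<subseteq> VX V"
  by (auto simp: XT_def XA_def VX_def)

text \<open>A matrix unit changes one letter at a time, and modulo supercommutators the changed
  letter can be moved to the front.\<close>

lemma move_aux:
  assumes "w \<in> lists XT" and "length w = Suc d" and "i \<in> V"
  shows "D (aux r) i (word w)
    \<in> spn {word [X (Inl t) (aux r)] * word v | t v. t \<in> T \<and> v \<in> lists XT \<and> length v = d}"
  using assms
proof (induction w arbitrary: d rule: list.induct)
  case (Cons g w)
  let ?S = "\<lambda>d. spn {word [X (Inl t) (aux r)] * word v | t v. t \<in> T \<and> v \<in> lists XT \<and> length v = d}"
  obtain t i' where g: "g = X (Inl t) i'" "t \<in> T" "i' \<in> V" using Cons.prems by (auto simp: XT_def)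
  have w: "w \<in> lists XT" "length w = d" using Cons.prems by auto
  have 1: "hD (aux r) i g * word w \<in> ?S d"
  proof (cases "i' = i")
    case True
    have "word [X (Inl t) (aux r)] * word w \<in> ?S d" using g w by (intro spn.base) blast
    from spn.scale[OF this] show ?thesis using True by (simp add: g sc_simps)
  qed (simp add: g spn.zero)
  have 2: "word [g] * D (aux r) i (word w) \<in> ?S d"
  proof (cases w)
    case Nil
    then show ?thesis by (simp add: spn.zero)
  next
    case (Cons h w')
    then obtain d' where d: "d = Suc d'" using w by (cases d) auto
    have "D (aux r) i (word w) \<in> ?S d'"
      using Cons.IH[of d'] w d \<open>i \<in> V\<close> by auto
    then show ?thesis
    proof (rule spn_clinear[rotated -1])
      show "clinear (\<lambda>a. word [g] * a)" by (intro clin)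
      fix b assume "b \<in> {word [X (Inl t) (aux r)] * word v | t v. t \<in> T \<and> v \<in> lists XT \<and> length v = d'}"
      then obtain t v where b: "b = word [X (Inl t) (aux r)] * word v" "t \<in> T" "v \<in> lists XT" "length v = d'"
        by blast
      let ?x = "X (Inl t) (aux r)"
      have "t \<in> T \<and> g # v \<in> lists XT \<and> length (g # v) = d" using b Cons.prems d by simp
      then have "word [?x] * word (g # v) \<in> ?S d" by (intro spn.base) blast
      then have "ksgn (lpar g * lpar ?x) \<cdot> (word [?x] * word (g # v)) \<in> ?S d" by (rule spn.scale)
      moreover have "ksgn (lpar g * lpar ?x) \<cdot> (word [?x] * word (g # v)) \<approx> word [g] * b"
      proof (rule L.eqv_sym)
        have "word [g] * b = word [g] * word [?x] * word v"
          by (simp only: b(1) mult.assoc)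
        also have "\<dots> \<approx> ksgn (lpar g * lpar ?x) \<cdot> (word [?x] * word [g]) * word v"
          by (intro L.eqv_mult_right scomm_eqv)
        also have "\<dots> = ksgn (lpar g * lpar ?x) \<cdot> (word [?x] * word (g # v))"
          by (simp only: word_Cons[of g v] sc_simps mult.assoc)
        finally show "word [g] * b \<approx> ksgn (lpar g * lpar ?x) \<cdot> (word [?x] * word (g # v))" .
      qed
      ultimately show "word [g] * b \<in> ?S d" by (rule spn.eqv)
    qed (rule L.sid_left)
  qed
  show ?case
    using spn.add[OF 1 spn.scale[OF 2, of "ksgn (epar (aux r) i * lpar g)"]]
    by (simp only: word_Cons[of g w] D_mult D_letter L.tw_letter sc_simps)
qed simp

text \<open>The multilinear weight space: each of the first \<open>d\<close> new indices occurs once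
  and no other index occurs. Modulo supercommutators the letters can be sorted by index, so only the
  list \<open>ts\<close> of labels remains.\<close>

definition Z :: "nat \<Rightarrow> letter falg set" where
  "Z d = spn {word (xw 0 (map Inl ts)) | ts. ts \<in> lists T \<and> length ts = d}"

lemma D_xw: "i \<in> V \<Longrightarrow> D k i (word (xw r ts)) = 0"
proof (induction ts arbitrary: r)
  case (Cons t ts)
  then show ?case by (simp add: word_Cons[of _ "xw (Suc r) ts"] D_mult D_letter aux_neq)
qed simp

text \<open>Invariant of the induction: the first \<open>r\<close> letters carry new indices in
  increasing order and are annihilated by the remaining operators, while \<open>w\<close> is still a
  word over \<open>V\<close>. Each step lowers one letter of \<open>w\<close> and moves it next to
  the finished ones; the lengths agree, so none is left over.\<close>

lemma Dl_dn_word: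
  assumes "set is \<subseteq> V" and "w \<in> lists XT" and "length w = length is" and "ts \<in> lists T" and "length ts = r"
  shows "Dl (dn r is) (word (xw 0 (map Inl ts)) * word w) \<in> Z (r + length is)"
  using assms
proof (induction "is" arbitrary: r w ts)
  case Nil
  then show ?case by (auto simp: Z_def intro!: spn.base)
next
  case (Cons i "is")
  let ?x = "word (xw 0 (map Inl ts)) :: letter falg"
  have "Dl (dn (Suc r) is) (?x * b) \<in> Z (r + length (i # is))"
    if "b \<in> spn {word [X (Inl t) (aux r)] * word v | t v. t \<in> T \<and> v \<in> lists XT \<and> length v = length is}" for b
    using that
  proof (rule spn_clinear[where F="\<lambda>b. Dl (dn (Suc r) is) (?x * b)" and C="{word (xw 0 (map Inl ts)) | ts. ts \<in> lists T \<and> length ts = r + length (i # is)}",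
        folded Z_def, rotated -1])
    fix b assume "b \<in> {word [X (Inl t) (aux r)] * word v | t v. t \<in> T \<and> v \<in> lists XT \<and> length v = length is}"
    then obtain t v where b: "b = word [X (Inl t) (aux r)] * word v" "t \<in> T" "v \<in> lists XT" "length v = length is"
      by blast
    have "?x * b = word (xw 0 (map Inl (ts @ [t]))) * word v"
      using Cons.prems by (simp add: xw_snoc b word_append mult.assoc)
    then show "Dl (dn (Suc r) is) (?x * b) \<in> Z (r + length (i # is))"
      using Cons.IH[of v "ts @ [t]" "Suc r"] Cons.prems b by auto
  qed (intro clin, auto intro: Dl_sid L.sid_left)
  then have 1: "Dl (dn (Suc r) is) (?x * D (aux r) i (word w)) \<in> Z (r + length (i # is))"
    using move_aux[of w "length is" i r] Cons.prems by simp
  have "Dl (dn r (i # is)) (?x * word w)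
      = ksgn (epar (aux r) i * L.wpar (xw 0 (map Inl ts))) \<cdot> Dl (dn (Suc r) is) (?x * D (aux r) i (word w))"
    using Cons.prems by (simp add: Dl_append D_mult D_xw L.tw_word sc_simps Dl_linear)
  with spn.scale[OF 1[unfolded Z_def]] show ?case by (simp add: Z_def)
qed

lemma Dl_dn:
  assumes "set is \<subseteq> V" and "b \<in> Free XT" and "b \<in> Deg (length is)"
  shows "Dl (dn 0 is) b \<in> Z (length is)"
proof (rule clinear_closed[OF clinear_Dl])
  fix w assume "w \<in> Poly_Mapping.keys b"
  then show "Dl (dn 0 is) (word w) \<in> Z (length is)"
    using Dl_dn_word[of "is" w "[]" 0] assms by (auto simp: Free_def Deg_def)
qed (auto simp: Z_def intro: spn.intros)

text \<open>The identity of \<open>V\<close> as an element of \<open>gl(V)\<close>. It acts by the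
  degree, so commuting with it forces an operator to preserve degrees.\<close>

definition euler :: "letter falg \<Rightarrow> letter falg" where
  "euler a = (\<Sum>i\<in>V. D i i a)"

lemma clinear_euler: "clinear euler"
proof -
  have "euler = (\<lambda>a. \<Sum>i\<in>V. D i i a)" by (intro ext) (simp add: euler_def)
  then show ?thesis by simp (intro clin)
qed

lemma euler_word: "w \<in> lists (VX V) \<Longrightarrow> euler (word w) = of_nat (length w) \<cdot> word w"
proof (induction w)
  case (Cons g w)
  then obtain t j where g: "g = X t j" "j \<in> V" by (auto simp: VX_def)
  have "D i i (word (g # w)) = (if i = j then word [g] else 0) * word w + word [g] * D i i (word w)" for i
    by (subst word_Cons) (simp add: D_mult D_letter g)
  then have "euler (word (g # w)) = (\<Sum>i\<in>V. (if i = j then word [g] else 0)) * word w + word [g] * euler (word w)"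
    by (simp add: euler_def sum.distrib sum_distrib_left sum_distrib_right)
  moreover have "(\<Sum>i\<in>V. (if i = j then word [g] else 0)) = word [g]"
    using g finite_sindex by (simp add: sum.delta')
  ultimately show ?case
    using Cons by (simp add: word_Cons[of g w] sc_simps sc_add)
qed (simp add: euler_def)

end

section \<open>The equivariant operator attached to an invariant\<close>

locale fft_invariant = fft_words +
  fixes f :: "letter falg"
  assumes f_Free: "f \<in> Free (XT \<union> YS)"
    and invariant: "\<And>i j. i \<in> V \<Longrightarrow> j \<in> V \<Longrightarrow> DF i j f \<in> L.sid"
begin

text \<open>On representatives, the map from polynomials in the auxiliary letters to polynomials in
  the letters \<open>X (Inl t) i\<close>; auxiliary letters not consumed by derivatives are set to
  0.\<close>

definition TT :: "letter falg \<Rightarrow> letter falg" where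
  "TT v = eps (ra v f)"

lemma clinear_TT: "clinear TT"
proof -
  have "TT = (\<lambda>v. res (\<lambda>g. \<not> isaux g) (ra v f))" by (intro ext) (simp add: TT_def eps_def)
  then show ?thesis by simp (intro clin)
qed

lemmas TT_linear = clinear_add[OF clinear_TT] clinear_scale[OF clinear_TT]
  clinear_diff[OF clinear_TT] clinear_sum[OF clinear_TT] clinear_zero[OF clinear_TT]

lemma TT_sid: "v \<in> L.sid \<Longrightarrow> TT v \<in> L.sid"
  by (simp add: TT_def eps_def res_sid ra_sid_left)

lemma TT_eqv: "a \<approx> b \<Longrightarrow> TT a \<approx> TT b"
  by (rule L.eqv_clinear[OF clinear_TT TT_sid])

lemma TT_D: "k \<in> V \<Longrightarrow> l \<in> V \<Longrightarrow> TT (D k l v) \<approx> D k l (TT v)"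
proof -
  assume "k \<in> V" "l \<in> V"
  then have "ra (L.tw (epar k l) v) (DF k l f) \<in> L.sid" by (intro ra_sid invariant)
  then have "ra (D k l v) f \<approx> D k l (ra v f)"
    unfolding D_ra by (simp add: L.eqv_def L.sid_minus)
  then have "eps (ra (D k l v) f) \<approx> eps (D k l (ra v f))" unfolding eps_def by (rule res_eqv)
  then show ?thesis by (simp add: TT_def eps_D)
qed

lemma TT_Uop: "Uop V F \<Longrightarrow> TT (F v) \<approx> F (TT v)"
proof (induction arbitrary: v rule: Uop.induct)
  case (D F k l)
  have "TT (F (D k l v)) \<approx> F (TT (D k l v))" by (rule D.IH)
  also have "\<dots> \<approx> F (D k l (TT v))"
    using D by (intro L.eqv_clinear[OF Uop_clinear[OF D.hyps(1)] Uop_sid[OF D.hyps(1)]] TT_D)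
  finally show ?case .
qed (auto simp: TT_linear intro: L.eqv_add L.eqv_scale)

lemma TT_XA: "v \<in> Free XA \<Longrightarrow> TT v \<in> Free XT"
proof -
  assume "v \<in> Free XA"
  then have "ra v f \<in> Free (XA \<union> XT)"
    by (intro Free_ra[OF _ f_Free]) (auto intro: Free_mono simp: YS_def)
  then have "eps (ra v f) \<in> Free ((XA \<union> XT) \<inter> {g. \<not> isaux g})"
    unfolding eps_def by (rule Free_res)
  then show ?thesis
    unfolding TT_def by (rule Free_mono[rotated]) (auto simp: XA_def)
qed

text \<open>Since \<open>f\<close> is an arbitrary representative, \<open>TT\<close> preserves the
  degree only modulo the ideal. It commutes with the Euler operator, which multiplies the argument
  by its length and the component of degree \<open>r\<close> of the value by \<open>r\<close>; the
  components with other \<open>r\<close> therefore lie in the ideal.\<close>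

lemma TT_hpr:
  assumes "w \<in> lists XA"
  shows "TT (word w) \<approx> hpr (length w) (TT (word w))"
proof -
  let ?a = "TT (word w)" and ?d = "length w"
  have a: "?a \<in> Free (VX V)"
    using TT_XA[of "word w"] assms XT_VX by (auto simp: Free_word intro: Free_mono)
  have "TT (euler (word w)) \<approx> euler ?a"
    unfolding euler_def TT_linear by (intro L.eqv_sum TT_D)
  moreover have "w \<in> lists (VX V)" using assms XA_VX by auto
  ultimately have "of_nat ?d \<cdot> ?a \<approx> euler ?a"
    by (simp add: euler_word TT_linear)
  then have eu: "euler ?a - of_nat ?d \<cdot> ?a \<in> L.sid"
    using L.eqv_sym L.eqv_def by blast
  have "hpr r ?a \<in> L.sid" if "r \<noteq> ?d" for r
  proof -
    have "hpr r (euler ?a) = of_nat r \<cdot> hpr r ?a"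
    proof (rule clinear_eq_on[where F="\<lambda>a. hpr r (euler a)" and G="\<lambda>a. of_nat r \<cdot> hpr r a"])
      show "clinear (\<lambda>a. hpr r (euler a))" by (rule clinear_comp[OF clinear_hpr clinear_euler])
      show "clinear (\<lambda>a. of_nat r \<cdot> hpr r a)" by (intro clin)
      fix v assume "v \<in> Poly_Mapping.keys ?a"
      then have "v \<in> lists (VX V)" using a by (auto simp: Free_def)
      then show "hpr r (euler (word v)) = of_nat r \<cdot> hpr r (word v)"
        by (simp add: euler_word hpr_linear hpr_word)
    qed
    then have "(of_nat r - of_nat ?d) \<cdot> hpr r ?a \<in> L.sid"
      using hpr_sid[OF eu, of r] sc_add[of "of_nat r" "- of_nat ?d" "hpr r ?a"]
      by (simp add: hpr_linear sc_minus)
    from L.sid_scale[OF this, of "1 / (of_nat r - of_nat ?d)"] that show ?thesis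
      by (simp add: sc_simps)
  qed note small = this
  let ?N = "?d + (\<Sum>v\<in>Poly_Mapping.keys ?a. length v)"
  have "?a = (\<Sum>r\<le>?N. hpr r ?a)"
    by (rule sum_hpr[symmetric]) (rule trans_le_add2, rule member_le_sum, auto)
  also have "\<dots> \<approx> (\<Sum>r\<le>?N. if r = ?d then hpr ?d ?a else 0)"
    by (rule L.eqv_sum) (auto simp: L.eqv_0 small)
  also have "\<dots> = hpr ?d ?a" by (simp add: sum.delta')
  finally show ?thesis .
qed

text \<open>The key step: \<open>TT\<close> is induced by a vector of the multilinear weight space. The vector
  \<open>e\<close> splits orthogonally into a part in the image of the lowering operators \<open>Dl (dn 0 is)\<close>, on
  which \<open>TT\<close> extends by equivariance, and a part annihilated by all adjoints \<open>Dl (up 0 js)\<close>.\<close>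

lemma multilinear_vector:
  assumes "ss \<in> lists S"
  shows "\<exists>z\<in>Z (length ss). \<forall>js. set js \<subseteq> V \<and> length js = length ss \<longrightarrow>
    TT (Dl (up 0 js) (word (xw 0 (map Inr ss)))) \<approx> Dl (up 0 js) z"
proof -
  let ?d = "length ss"
  let ?P = "res (inV V)"
  define e :: "letter falg" where "e = word (xw 0 (map Inr ss))"
  define J where "J = {js. set js \<subseteq> V \<and> length js = ?d}"
  define WA where "WA = {w. set w \<subseteq> XA \<and> length w = ?d}"
  define G where "G p = Dl (dn 0 (fst p)) (word (snd p))" for p :: "idx list \<times> letter list"
  have "XA \<subseteq> (\<lambda>(s, i). X (Inr s) i) ` (S \<times> V)" by (auto simp: XA_def)
  then have "finite XA" using finite_S finite_sindex by (meson finite_SigmaI finite_imageI finite_subset)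
  then have "finite (J \<times> WA)"
    unfolding J_def WA_def using finite_sindex by (intro finite_cartesian_product finite_lists_length_eq)
  from orthogonal_decomposition[OF this, of e G]
  obtain c where c: "\<And>p. p \<in> J \<times> WA \<Longrightarrow> ip (e - (\<Sum>h\<in>J \<times> WA. c h \<cdot> G h)) (G p) = 0"
    by blast
  define e1 where "e1 = (\<Sum>h\<in>J \<times> WA. c h \<cdot> G h)"
  define b where "b w = hpr ?d (TT (word w))" for w
  \<comment> \<open>The intended value of \<open>TT\<close> on \<open>e\<close>: in
    \<open>e1\<close> each word over \<open>V\<close> is replaced by its value under
    \<open>TT\<close>. The representative \<open>b w\<close> has exact degree, so lowering leaves no
    letter with an index in \<open>V\<close>.\<close>
  define z where "z = (\<Sum>h\<in>J \<times> WA. c h \<cdot> Dl (dn 0 (fst h)) (b (snd h)))"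
  have b: "TT (word w) \<approx> b w" "b w \<in> Free XT" "b w \<in> Deg ?d" if "w \<in> WA" for w
    using that TT_hpr[of w] TT_XA[of "word w"] unfolding b_def WA_def
    by (auto simp: Free_word hpr_in_Deg intro!: Free_hpr)
  have z: "z \<in> Z ?d"
    unfolding z_def Z_def
  proof (intro spn_sum spn.scale, fold Z_def)
    fix h assume "h \<in> J \<times> WA"
    then show "Dl (dn 0 (fst h)) (b (snd h)) \<in> Z ?d"
      using Dl_dn[of "fst h" "b (snd h)"] b[of "snd h"] by (auto simp: J_def)
  qed
  have "TT (Dl (up 0 js) e) \<approx> Dl (up 0 js) z" if js: "js \<in> J" for js
  proof -
    have len: "length js = ?d" "set js \<subseteq> V" using js by (auto simp: J_def)
    have PDl: "?P (Dl (up 0 js) x) \<approx> Dl (up 0 js) x" if "x \<in> Z ?d" for x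
      using that unfolding Z_def
    proof (induction rule: spn.induct)
      case (base x)
      then obtain ts where "x = word (xw 0 (map Inl ts))" "length ts = ?d" by blast
      then show ?case using Dl_up_xw[of "map Inl ts" js 0] len by (simp add: res_inV_VX)
    next
      case (eqv x y)
      have "?P (Dl (up 0 js) y) \<approx> ?P (Dl (up 0 js) x)" by (intro res_eqv Dl_eqv) (rule L.eqv_sym, rule eqv.hyps)
      also have "\<dots> \<approx> Dl (up 0 js) x" by (rule eqv)
      also have "\<dots> \<approx> Dl (up 0 js) y" by (intro Dl_eqv eqv)
      finally show ?case .
    next
      case zero
      show ?case by (simp add: Dl_linear res_linear)
    next
      case (add x y)
      then show ?case unfolding Dl_linear res_linear by (intro L.eqv_add)
    next
      case (scale x c)
      then show ?case unfolding Dl_linear res_linear by (intro L.eqv_scale)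
    qed
    have e2: "?P (Dl (up 0 js) (e - e1)) = 0"
    proof (rule poly_mapping_eqI)
      \<comment> \<open>Restricting labels and degree ensures that a word over \<open>V\<close>
        occurring here belongs to \<open>WA\<close>, where orthogonality applies; words with an
        index outside \<open>V\<close> are removed by the projection.\<close>
      define EA where "EA = {X (Inr s) i | s i. s \<in> S}"
      have EA: "D k l a \<in> Free EA" if "a \<in> Free EA" for a k l
        using that by (rule Free_D) (auto simp: EA_def Free_0 Free_word intro!: Free_scale)
      have DlEA: "Dl ps a \<in> Free EA" if "a \<in> Free EA" for a ps
        using that by (induction ps) (auto intro: EA)
      have "xw r (map Inr ss) \<in> lists EA" for r
        using assms by (induction ss arbitrary: r) (auto simp: EA_def)
      then have "e \<in> Free EA" by (simp add: e_def Free_word)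
      moreover have "G h \<in> Free EA" if "h \<in> J \<times> WA" for h
        using that unfolding G_def by (intro DlEA) (auto simp: Free_word WA_def XA_def EA_def)
      ultimately have F: "Dl (up 0 js) (e - e1) \<in> Free EA"
        unfolding e1_def by (intro DlEA Free_diff Free_sum Free_scale) auto
      have "e \<in> Deg ?d" by (simp add: e_def Deg_word)
      moreover have "G h \<in> Deg ?d" if "h \<in> J \<times> WA" for h
        using that unfolding G_def by (intro Deg_Dl) (auto simp: Deg_word WA_def)
      ultimately have De: "Dl (up 0 js) (e - e1) \<in> Deg ?d"
        unfolding e1_def by (intro Deg_Dl Deg_diff Deg_sum Deg_scale) auto
      fix v
      show "Poly_Mapping.lookup (?P (Dl (up 0 js) (e - e1))) v = Poly_Mapping.lookup 0 v"
      proof (cases "v \<in> WA")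
        case True
        have "ip (e - e1) (G (js, v)) = 0" using c[of "(js, v)"] js True by (simp add: e1_def)
        then have "ip (Dl (up 0 js) (e - e1)) (word v) = 0"
          by (simp add: ip_Dl rev_up G_def)
        then have "ip (word v) (Dl (up 0 js) (e - e1)) = 0" by (subst ip_commute) simp
        then show ?thesis by (simp add: ip_word_left lookup_res)
      next
        case False
        show ?thesis
        proof (cases "\<forall>g\<in>set v. inV V g")
          case True
          then have "v \<notin> Poly_Mapping.keys (Dl (up 0 js) (e - e1))"
            using False F De by (fastforce simp: WA_def XA_def EA_def Free_def Deg_def subset_iff)
          then show ?thesis by (simp add: lookup_res in_keys_iff)
        qed (auto simp: lookup_res)
      qed
    qed
    have eV: "Dl (up 0 js) e \<in> Free (VX V)"
      using Dl_up_xw[of "map Inr ss" js 0] len by (simp add: e_def)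
    \<comment> \<open>The projection fixes the left argument and annihilates the contribution of
      \<open>e - e1\<close>, so \<open>e1\<close> can stand in for \<open>e\<close>.\<close>
    have "TT (Dl (up 0 js) e) = TT (?P (Dl (up 0 js) e1))"
      using e2 res_inV_VX[OF eV] by (simp add: Dl_linear res_linear)
    also have "\<dots> = (\<Sum>h\<in>J \<times> WA. c h \<cdot> TT (?P (Dl (up 0 js @ dn 0 (fst h)) (word (snd h)))))"
      by (simp add: e1_def G_def Dl_linear res_linear TT_linear Dl_append)
    also have "\<dots> \<approx> (\<Sum>h\<in>J \<times> WA. c h \<cdot> ?P (Dl (up 0 js @ dn 0 (fst h)) (b (snd h))))"
    proof (intro L.eqv_sum L.eqv_scale)
      fix h assume h: "h \<in> J \<times> WA"
      \<comment> \<open>Lowering followed by raising leaves \<open>V\<close>, but its compression is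
        an operator from the enveloping algebra of \<open>gl(V)\<close>, and these commute with
        \<open>TT\<close>.\<close>
      obtain F where F: "Uop V F" "\<And>v. v \<in> Free (VX V) \<Longrightarrow> ?P (Dl (up 0 js @ dn 0 (fst h)) v) = F v"
        using compression[of V "up 0 js @ dn 0 (fst h)"] by blast
      have w: "word (snd h) \<in> Free (VX V)" "b (snd h) \<in> Free (VX V)"
        using h XA_VX XT_VX b[of "snd h"] by (auto simp: Free_word WA_def intro: Free_mono)
      have "TT (F (word (snd h))) \<approx> F (TT (word (snd h)))" by (rule TT_Uop[OF F(1)])
      also have "\<dots> \<approx> F (b (snd h))"
        using h by (intro L.eqv_clinear[OF Uop_clinear[OF F(1)] Uop_sid[OF F(1)]] b) auto
      finally show "TT (?P (Dl (up 0 js @ dn 0 (fst h)) (word (snd h))))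
          \<approx> ?P (Dl (up 0 js @ dn 0 (fst h)) (b (snd h)))"
        by (simp only: F(2)[OF w(1)] F(2)[OF w(2)])
    qed
    also have "\<dots> = ?P (Dl (up 0 js) z)"
      by (simp add: z_def Dl_linear res_linear Dl_append)
    also have "\<dots> \<approx> Dl (up 0 js) z" by (rule PDl[OF z])
    finally show ?thesis .
  qed
  with z show ?thesis unfolding e_def J_def by blast
qed

end

section \<open>Contraction with dual letters\<close>

context fft_words
begin

text \<open>The sign is the part depending on \<open>j\<close> of the sign for exchanging the two
  factors, so reversing them gives a multiple of \<open>zz\<close> (\<open>kk_zz\<close>). For
  \<open>t = Inr s\<close> it reduces to \<open>ksgn (ipar j)\<close>, the sign in
  \<open>rletter\<close>.\<close>

definition kk :: "idx \<Rightarrow> idx + idx \<Rightarrow> letter falg" where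
  "kk s t = (\<Sum>j\<in>V. ksgn (ipar j + ipar j * ipar s + ipar j * tpar t) \<cdot> (word [Y j s] * word [X t j]))"

definition zz :: "idx \<Rightarrow> idx \<Rightarrow> letter falg" where
  "zz t s = (\<Sum>i\<in>V. word [X (Inl t) i] * word [Y i s])"

text \<open>The subalgebra generated by the scalar products, as its full preimage in the free
  algebra.\<close>

inductive_set Bz :: "letter falg set" where
  const: "const c \<in> Bz"
| zz: "t \<in> T \<Longrightarrow> s \<in> S \<Longrightarrow> zz t s \<in> Bz"
| add: "a \<in> Bz \<Longrightarrow> b \<in> Bz \<Longrightarrow> a + b \<in> Bz"
| mult: "a \<in> Bz \<Longrightarrow> b \<in> Bz \<Longrightarrow> a * b \<in> Bz"
| eqv: "a \<in> Bz \<Longrightarrow> a \<approx> b \<Longrightarrow> b \<in> Bz"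

lemma Bz_scale: "a \<in> Bz \<Longrightarrow> c \<cdot> a \<in> Bz"
  unfolding sc_def by (intro Bz.mult Bz.const)

lemma Bz_0: "0 \<in> Bz"
  using Bz.const[of 0] by simp

lemma Bz_sum: "(\<And>i. i \<in> A \<Longrightarrow> f i \<in> Bz) \<Longrightarrow> sum f A \<in> Bz"
  by (induction A rule: infinite_finite_induct) (auto intro: Bz_0 Bz.add)

text \<open>Only the summands with \<open>i = l\<close> and \<open>i = k\<close> contribute, and
  they cancel exactly, without use of the ideal.\<close>

lemma DF_zz:
  assumes "k \<in> V" and "l \<in> V"
  shows "DF k l (zz t s) = 0"
proof -
  let ?e = "epar k l"
  let ?x = "word [X (Inl t) k] * word [Y l s]"
  have "DF k l (word [X (Inl t) i] * word [Y i s])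
      = (if i = l then ksgn (?e * ipar t) \<cdot> ?x else 0) - (if i = k then ksgn (?e * ipar t) \<cdot> ?x else 0)" for i
  proof -
    have "ksgn (?e * (ipar t + ipar k)) * ksgn (?e * ipar k) = ksgn (?e * ipar t)"
      by (simp add: distrib_left ksgn_add)
    then show ?thesis
      by (simp add: DF_mult DF_letter L.tw_letter sc_simps mult.commute)
  qed
  then show ?thesis
    using assms finite_sindex by (simp add: zz_def DF_linear sum_subtractf sum.delta)
qed

lemma DF_Bz:
  assumes "a \<in> Bz" and "k \<in> V" and "l \<in> V"
  shows "DF k l a \<in> L.sid"
  using assms(1)
proof (induction rule: Bz.induct)
  case (mult a b)
  then show ?case by (auto simp: DF_mult intro: L.sid.add L.sid_left L.sid_right)
next
  case (eqv a b)
  have "DF k l b \<approx> DF k l a" using DF_eqv[OF L.eqv_sym[OF eqv.hyps(2)]] .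
  with eqv.IH show ?case using L.eqv_trans L.eqv_0 by blast
qed (auto simp: DF_zz assms DF_linear L.sid.zero intro: L.sid.add)

lemma kk_zz: "kk s (Inl t) \<approx> ksgn (ipar t * ipar s) \<cdot> zz t s"
  unfolding kk_def zz_def sc_sum
proof (intro L.eqv_sum)
  fix j
  let ?x = "X (Inl t) j" and ?y = "Y j s"
  let ?c = "ksgn (ipar j + ipar j * ipar s + ipar j * tpar (Inl t))"
  have "?c \<cdot> (word [?y] * word [?x]) \<approx> ?c \<cdot> ksgn (lpar ?y * lpar ?x) \<cdot> (word [?x] * word [?y])"
    by (intro L.eqv_scale scomm_eqv)
  moreover have "?c * ksgn (lpar ?y * lpar ?x) = ksgn (ipar t * ipar s)"
    by (cases "ipar j"; cases "ipar s"; cases "ipar t"; simp)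
  ultimately show "?c \<cdot> (word [?y] * word [?x]) \<approx> ksgn (ipar t * ipar s) \<cdot> (word [?x] * word [?y])"
    by (simp only: sc_simps)
qed

lemma kk_Bz: "t \<in> T \<Longrightarrow> s \<in> S \<Longrightarrow> kk s (Inl t) \<in> Bz"
  by (rule Bz.eqv[OF Bz_scale[OF Bz.zz] L.eqv_sym[OF kk_zz]])

text \<open>Contracts the new index \<open>aux r\<close> with the letters \<open>Y j s\<close>. It
  is composed of raising operators and left multiplications by \<open>Y\<close>, which is what
  \<open>TT\<close> can be compared with.\<close>

definition Phi :: "idx \<Rightarrow> nat \<Rightarrow> letter falg \<Rightarrow> letter falg" where
  "Phi s r v = (\<Sum>j\<in>V. ksgn (ipar j + ipar j * ipar s) \<cdot> (word [Y j s] * D j (aux r) v))"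

lemma clinear_Phi: "clinear (Phi s r)"
proof -
  have "Phi s r = (\<lambda>v. \<Sum>j\<in>V. ksgn (ipar j + ipar j * ipar s) \<cdot> (word [Y j s] * D j (aux r) v))"
    by (intro ext) (simp add: Phi_def)
  then show ?thesis by simp (intro clin)
qed

lemma Phi_sid: "a \<in> L.sid \<Longrightarrow> Phi s r a \<in> L.sid"
  unfolding Phi_def by (intro L.sid_sum L.sid_scale L.sid_left D_sid)

lemma Phi_eqv: "a \<approx> b \<Longrightarrow> Phi s r a \<approx> Phi s r b"
  by (rule L.eqv_clinear[OF clinear_Phi Phi_sid])

lemmas Phi_linear = clinear_add[OF clinear_Phi] clinear_scale[OF clinear_Phi]
  clinear_diff[OF clinear_Phi] clinear_sum[OF clinear_Phi] clinear_zero[OF clinear_Phi]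

lemma Phi_letter: "Phi s r (word [X t (aux r)]) = kk s t"
  by (simp add: Phi_def kk_def D_letter sc_simps ksgn_add)

text \<open>The parity of \<open>j\<close> enters twice, once through the twist of
  \<open>D j (aux r)\<close> and once in moving \<open>Y j s\<close> past \<open>g\<close>, and
  cancels. Thus \<open>Phi s r\<close> behaves like an operator of parity
  \<open>ipar s\<close>.\<close>

lemma Phi_letter_mult:
  assumes "\<And>j. hD j (aux r) g = 0"
  shows "Phi s r (word [g] * q) \<approx> ksgn (ipar s * lpar g) \<cdot> (word [g] * Phi s r q)"
proof -
  have "Phi s r (word [g] * q)
      = (\<Sum>j\<in>V. (ksgn (ipar j + ipar j * ipar s) * ksgn (ipar j * lpar g)) \<cdot> (word [Y j s] * word [g]) * D j (aux r) q)"
    by (simp add: Phi_def D_mult D_letter assms L.tw_letter sc_simps mult.assoc)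
  also have "\<dots> \<approx> (\<Sum>j\<in>V. (ksgn (ipar j + ipar j * ipar s) * ksgn (ipar j * lpar g)) \<cdot>
      (ksgn (lpar (Y j s) * lpar g) \<cdot> (word [g] * word [Y j s])) * D j (aux r) q)"
    by (intro L.eqv_sum L.eqv_mult_right L.eqv_scale scomm_eqv)
  also have "\<dots> = (\<Sum>j\<in>V. ksgn (ipar s * lpar g) \<cdot> (word [g] * (ksgn (ipar j + ipar j * ipar s) \<cdot>
      (word [Y j s] * D j (aux r) q))))"
  proof (rule sum.cong[OF refl])
    fix j
    have "ksgn (ipar j + ipar j * ipar s) * ksgn (ipar j * lpar g) * ksgn (lpar (Y j s) * lpar g)
        = ksgn (ipar s * lpar g) * ksgn (ipar j + ipar j * ipar s)"
      by (simp add: distrib_right ksgn_add)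
    then show "(ksgn (ipar j + ipar j * ipar s) * ksgn (ipar j * lpar g)) \<cdot>
        (ksgn (lpar (Y j s) * lpar g) \<cdot> (word [g] * word [Y j s])) * D j (aux r) q
      = ksgn (ipar s * lpar g) \<cdot> (word [g] * (ksgn (ipar j + ipar j * ipar s) \<cdot>
      (word [Y j s] * D j (aux r) q)))"
      by (simp only: sc_simps mult.assoc)
  qed
  also have "\<dots> = ksgn (ipar s * lpar g) \<cdot> (word [g] * Phi s r q)"
    by (simp only: Phi_def sc_sum sum_distrib_left)
  finally show ?thesis .
qed

fun Phis :: "nat \<Rightarrow> idx list \<Rightarrow> letter falg \<Rightarrow> letter falg" where
  "Phis r [] v = v"
| "Phis r (s # ss) v = Phi s r (Phis (Suc r) ss v)"

lemma clinear_Phis: "clinear (Phis r ss)"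
proof (induction ss arbitrary: r)
  case Nil
  have "Phis r [] = (\<lambda>v. v)" by (intro ext) simp
  then show ?case by (simp add: clinear_id)
next
  case (Cons s ss)
  have "Phis r (s # ss) = (\<lambda>v. Phi s r (Phis (Suc r) ss v))" by (intro ext) simp
  then show ?case using clinear_comp[OF clinear_Phi Cons] by simp
qed

lemmas Phis_linear = clinear_add[OF clinear_Phis] clinear_scale[OF clinear_Phis]
  clinear_zero[OF clinear_Phis]

lemma Phis_sid: "a \<in> L.sid \<Longrightarrow> Phis r ss a \<in> L.sid"
  by (induction ss arbitrary: r) (auto intro: Phi_sid)

lemma Phis_eqv: "a \<approx> b \<Longrightarrow> Phis r ss a \<approx> Phis r ss b"
  by (rule L.eqv_clinear[OF clinear_Phis Phis_sid])

lemma Phis_letter_mult: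
  assumes "r0 < r"
  shows "\<exists>c. c \<noteq> 0 \<and> Phis r ss (word [X t (aux r0)] * q) \<approx> c \<cdot> (word [X t (aux r0)] * Phis r ss q)"
  using assms
proof (induction ss arbitrary: r)
  case Nil
  then show ?case by (intro exI[of _ 1]) simp
next
  case (Cons s ss)
  let ?x = "X t (aux r0)"
  obtain c where c: "c \<noteq> 0" "Phis (Suc r) ss (word [?x] * q) \<approx> c \<cdot> (word [?x] * Phis (Suc r) ss q)"
    using Cons.IH[of "Suc r"] Cons.prems by auto
  have "Phis r (s # ss) (word [?x] * q) \<approx> Phi s r (c \<cdot> (word [?x] * Phis (Suc r) ss q))"
    unfolding Phis.simps by (rule Phi_eqv[OF c(2)])
  also have "\<dots> = c \<cdot> Phi s r (word [?x] * Phis (Suc r) ss q)" by (simp only: Phi_linear)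
  also have "\<dots> \<approx> c \<cdot> ksgn (ipar s * lpar ?x) \<cdot> (word [?x] * Phis r (s # ss) q)"
    unfolding Phis.simps using Cons.prems by (intro L.eqv_scale Phi_letter_mult) auto
  finally show ?case
    using c(1) by (intro exI[of _ "c * ksgn (ipar s * lpar ?x)"]) (auto simp: sc_simps ksgn_def)
qed

definition Yall :: "letter set" where
  "Yall = {Y i s | i s. True}"

lemma kk_Free: "kk s t \<in> Free (VX V \<union> Yall)"
  unfolding kk_def by (intro Free_sum Free_scale Free_mult) (auto simp: Free_word VX_def Yall_def)

lemma prod_kk_Free: "length ss = length ts \<Longrightarrow> prod_list (map2 kk ss ts) \<in> Free (VX V \<union> Yall)"
  by (induction ss ts rule: list_induct2) (auto intro: Free_1 Free_mult kk_Free)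

text \<open>The rightmost letter is contracted first. The sign need not be known, only that
  \<open>c\<close> can be divided out in \<open>TT_prod_kk\<close>.\<close>

lemma Phis_xw:
  "length ss = length ts \<Longrightarrow>
    \<exists>c. c \<noteq> 0 \<and> Phis r ss (word (xw r ts)) \<approx> c \<cdot> prod_list (map2 kk ss ts)"
proof (induction ss ts arbitrary: r rule: list_induct2)
  case Nil
  then show ?case by (intro exI[of _ 1]) simp
next
  case (Cons s ss t ts)
  let ?x = "X t (aux r)" and ?q = "prod_list (map2 kk ss ts)"
  obtain c where c: "c \<noteq> 0" "Phis (Suc r) ss (word (xw (Suc r) ts)) \<approx> c \<cdot> ?q"
    using Cons.IH[of "Suc r"] by blast
  obtain d where d: "d \<noteq> 0" "Phis (Suc r) ss (word [?x] * word (xw (Suc r) ts))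
      \<approx> d \<cdot> (word [?x] * Phis (Suc r) ss (word (xw (Suc r) ts)))"
    using Phis_letter_mult[of r "Suc r"] by blast
  \<comment> \<open>The part already contracted contains no new index, so \<open>Phi s r\<close>
    acts on the first letter only.\<close>
  have 0: "D j (aux r) ?q = 0" for j
    by (rule D_eq_0[OF prod_kk_Free[OF Cons.hyps]]) (auto simp: VX_def Yall_def)
  have "Phis (Suc r) ss (word (xw r (t # ts))) \<approx> d \<cdot> (word [?x] * Phis (Suc r) ss (word (xw (Suc r) ts)))"
    using d(2) by (simp add: word_Cons[of _ "xw (Suc r) ts"])
  also have "\<dots> \<approx> d \<cdot> (word [?x] * c \<cdot> ?q)"
    by (intro L.eqv_scale L.eqv_mult_left c)
  finally have "Phi s r (Phis (Suc r) ss (word (xw r (t # ts)))) \<approx> Phi s r (d \<cdot> (word [?x] * c \<cdot> ?q))"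
    by (rule Phi_eqv)
  also have "\<dots> = (d * c) \<cdot> Phi s r (word [?x] * ?q)"
    by (simp add: Phi_linear sc_simps)
  also have "Phi s r (word [?x] * ?q) = Phi s r (word [?x]) * ?q"
    by (simp add: Phi_def D_mult 0 sum_distrib_right sc_simps mult.assoc)
  also have "\<dots> = kk s t * ?q" by (simp only: Phi_letter)
  finally show ?case using c d by (intro exI[of _ "d * c"]) simp
qed

text \<open>Composites of the maps \<open>Phi\<close> expand into words in \<open>Y\<close> times raising operators.\<close>

inductive yr :: "nat \<Rightarrow> nat \<Rightarrow> (letter falg \<Rightarrow> letter falg) \<Rightarrow> bool" where
  zero: "yr r d (\<lambda>v. 0)"
| add: "yr r d F \<Longrightarrow> yr r d G \<Longrightarrow> yr r d (\<lambda>v. F v + G v)"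
| base: "p \<in> Free Yall \<Longrightarrow> set js \<subseteq> V \<Longrightarrow> length js = d \<Longrightarrow> yr r d (\<lambda>v. p * Dl (up r js) v)"

lemma yr_sum: "(\<And>i. i \<in> A \<Longrightarrow> yr r d (F i)) \<Longrightarrow> yr r d (\<lambda>v. \<Sum>i\<in>A. F i v)"
  by (induction A rule: infinite_finite_induct) (auto intro: yr.intros)

lemma yr_step:
  "yr r' d G \<Longrightarrow> r' = Suc r \<Longrightarrow> j \<in> V \<Longrightarrow> yr r (Suc d) (\<lambda>v. c \<cdot> (word [Y j s] * D j (aux r) (G v)))"
proof (induction rule: yr.induct)
  case (zero r' d)
  then show ?case by (simp add: D_linear yr.zero)
next
  case (add r' d F G)
  then show ?case by (simp add: D_linear distrib_left sc_simps yr.add)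
next
  case (base p js d r')
  let ?p = "c \<cdot> (word [Y j s] * L.tw (epar j (aux r)) p)"
  have "D j (aux r) p = 0" using base.hyps(1) by (rule D_eq_0) (auto simp: Yall_def)
  then have "(\<lambda>v. c \<cdot> (word [Y j s] * D j (aux r) (p * Dl (up r' js) v))) = (\<lambda>v. ?p * Dl (up r (j # js)) v)"
    using base by (intro ext) (simp add: D_mult sc_simps mult.assoc)
  moreover have "?p \<in> Free Yall"
    using base by (intro Free_scale Free_mult Free_tw) (auto simp: Free_word Yall_def)
  ultimately show ?case
    using base yr.base[of ?p "j # js" "Suc d" r] by simp
qed

lemma yr_Phis: "yr r (length ss) (Phis r ss)"
proof (induction ss arbitrary: r)
  case Nil
  have "Phis r [] = (\<lambda>v. 1 * Dl (up r []) v)" by (intro ext) simp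
  then show ?case using yr.base[of 1 "[]" 0 r] by (simp add: Free_1)
next
  case (Cons s ss)
  have "Phis r (s # ss) = (\<lambda>v. \<Sum>j\<in>V. ksgn (ipar j + ipar j * ipar s) \<cdot>
      (word [Y j s] * D j (aux r) (Phis (Suc r) ss v)))"
    by (intro ext) (simp add: Phi_def)
  then show ?case
    using yr_step[OF Cons refl, of _ r] by (simp add: yr_sum)
qed

section \<open>Taylor's formula\<close>

definition KK :: "letter falg" where
  "KK = (\<Sum>s\<in>S. kk s (Inr s))"

lemma kk_Inr: "kk s (Inr s) = (\<Sum>j\<in>V. ksgn (ipar j) \<cdot> (word [Y j s] * word [X (Inr s) j]))"
proof -
  have "a + b + b = a" for a b :: bit by (cases a; cases b) simp_all
  then show ?thesis by (simp add: kk_def)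
qed

text \<open>The factors \<open>Y j s\<close> and \<open>X (Inr s) j\<close> have the same parity, so
  \<open>KK\<close> is even and its powers can be differentiated as in the commutative case.\<close>

lemma tw_KK: "L.tw d KK = KK"
proof -
  have "ksgn (d * epar s j) * ksgn (d * epar j s) = 1" for j s
    by (subst (2) add.commute) (rule ksgn_sq)
  then show ?thesis
    by (simp add: KK_def kk_Inr L.tw_linear L.tw_mult L.tw_letter sc_simps mult.assoc)
qed

lemma rder_KK:
  assumes "j \<in> V" and "s \<in> S"
  shows "L.rder (X (Inr s) j) KK = ksgn (ipar j) \<cdot> word [Y j s]"
proof -
  have "L.rder (X (Inr s) j) KK = (\<Sum>s'\<in>S. \<Sum>i\<in>V. if s' = s \<and> i = j then ksgn (ipar i) \<cdot> word [Y i s'] else 0)"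
    unfolding KK_def kk_Inr L.rder_linear L.rder_mult L.rder_letter
    by (intro sum.cong refl) auto
  also have "\<dots> = (\<Sum>s'\<in>S. if s' = s then ksgn (ipar j) \<cdot> word [Y j s'] else 0)"
    using assms finite_sindex by (intro sum.cong refl) (auto simp: sum.delta')
  also have "\<dots> = ksgn (ipar j) \<cdot> word [Y j s]"
    using assms finite_S by (simp add: sum.delta')
  finally show ?thesis .
qed

lemma tw_KK_power: "L.tw d (KK ^ k) = KK ^ k"
  by (induction k) (simp_all add: L.tw_mult tw_KK)

lemma rder_KK_power:
  assumes "j \<in> V" and "s \<in> S"
  shows "L.rder (X (Inr s) j) (KK ^ Suc k) \<approx> (of_nat (Suc k) * ksgn (ipar j)) \<cdot> (KK ^ k * word [Y j s])"
proof (induction k)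
  case 0
  then show ?case using rder_KK[OF assms] by simp
next
  case (Suc k)
  let ?r = "L.rder (X (Inr s) j)"
  have "?r (KK ^ Suc (Suc k)) = ksgn (ipar j) \<cdot> (word [Y j s] * KK ^ Suc k) + KK * ?r (KK ^ Suc k)"
    by (simp only: power_Suc[of _ "Suc k"] L.rder_mult rder_KK[OF assms] tw_KK_power sc_simps)
  also have "\<dots> \<approx> ksgn (ipar j) \<cdot> (KK ^ Suc k * word [Y j s])
      + KK * (of_nat (Suc k) * ksgn (ipar j)) \<cdot> (KK ^ k * word [Y j s])"
    using L.supercommute_letter[of "Y j s" "KK ^ Suc k"] unfolding tw_KK_power
    by (intro L.eqv_add L.eqv_scale L.eqv_mult_left Suc)
  also have "\<dots> = (ksgn (ipar j) + of_nat (Suc k) * ksgn (ipar j)) \<cdot> (KK ^ Suc k * word [Y j s])"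
    by (simp only: sc_simps sc_add power_Suc mult.assoc)
  also have "ksgn (ipar j) + of_nat (Suc k) * ksgn (ipar j) = of_nat (Suc (Suc k)) * ksgn (ipar j)"
    by (simp add: algebra_simps)
  finally show ?case .
qed

fun numY :: "letter list \<Rightarrow> nat" where
  "numY [] = 0"
| "numY (X t i # w) = numY w"
| "numY (Y i s # w) = Suc (numY w)"

lemma numY_le: "numY w \<le> length w"
  by (induction w rule: numY.induct) auto

text \<open>The divided powers of \<open>KK\<close>, that is, the terms of its exponential
  series.\<close>

definition kpow :: "nat \<Rightarrow> letter falg" where
  "kpow d = (1 / fact d) \<cdot> KK ^ d"

text \<open>One degree of the rule that the derivative of the exponential of \<open>KK\<close> is
  this exponential times the derivative of \<open>KK\<close>. The factor
  \<open>ksgn (ipar j)\<close> cancels against the one in \<open>rletter\<close>.\<close>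

lemma rder_kpow:
  assumes "j \<in> V" and "s \<in> S"
  shows "L.rder (X (Inr s) j) (kpow (Suc d)) \<approx> ksgn (ipar j) \<cdot> (kpow d * word [Y j s])"
proof -
  have "(1 / fact (Suc d)) * (of_nat (Suc d) * ksgn (ipar j)) = ksgn (ipar j) * (1 / fact d)"
    by (simp add: fact_Suc field_simps del: of_nat_Suc)
  then show ?thesis
    using L.eqv_scale[OF rder_KK_power[OF assms, of d], of "1 / fact (Suc d)"]
    by (simp only: kpow_def L.rder_linear sc_simps)
qed

text \<open>On the exponential of \<open>KK\<close> the derivative \<open>Y j s\<close> acts as
  right multiplication by \<open>Y j s\<close> itself, so \<open>w\<close> acts as right
  multiplication by \<open>w\<close>; each \<open>Y\<close> lowers the divided power by one. The
  factor \<open>p\<close> collects the letters already processed.\<close>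

lemma ra_kpow:
  assumes "set w \<subseteq> XT \<union> YS" and "p \<in> Free (XT \<union> YS)"
  shows "ra (kpow d * p) (word w) \<approx> (if numY w \<le> d then kpow (d - numY w) * (p * word w) else 0)"
  using assms
proof (induction w arbitrary: p d rule: list.induct)
  case (Cons g w)
  have ra: "ra v (word (g # w)) = ra (rletter g v) (word w)" for v by (simp add: ra_word)
  have pg: "p * word [g] \<in> Free (XT \<union> YS)"
    using Cons.prems by (intro Free_mult) (auto simp: Free_word)
  consider t i where "g = X (Inl t) i" | j s where "g = Y j s" "j \<in> V" "s \<in> S"
    using Cons.prems by (auto simp: XT_def YS_def)
  then show ?case
  proof cases
    case 1
    have "p * word (g # w) = p * word [g] * word w" by (simp only: word_Cons[of g w] mult.assoc)
    moreover have "rletter g (kpow d * p) = kpow d * (p * word [g])" by (simp add: 1 mult.assoc)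
    moreover have "numY (g # w) = numY w" by (simp add: 1)
    ultimately show ?thesis
      using Cons.IH[OF _ pg, of d] Cons.prems(1) by (simp only: ra) simp
  next
    case 2
    let ?x = "X (Inr s) j"
    have p0: "L.rder ?x p = 0"
      by (rule rder_eq_0[OF Cons.prems(2)]) (auto simp: XT_def YS_def)
    have r: "rletter g (kpow d * p) = ksgn (ipar j) \<cdot> (L.rder ?x (kpow d) * L.tw (lpar ?x) p)"
      by (simp add: 2 L.rder_mult p0)
    show ?thesis
    proof (cases d)
      case 0
      then have "rletter g (kpow d * p) = 0"
        unfolding r by (simp add: kpow_def)
      then have "ra (kpow d * p) (word (g # w)) = 0" by (simp only: ra ra_left_linear)
      then show ?thesis using 0 2 by simp
    next
      case (Suc d')
      have "rletter g (kpow d * p) \<approx> ksgn (ipar j) \<cdot> ((ksgn (ipar j) \<cdot> (kpow d' * word [Y j s])) * L.tw (lpar ?x) p)"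
        unfolding r unfolding Suc by (intro L.eqv_scale L.eqv_mult_right rder_kpow 2)
      \<comment> \<open>The letters \<open>X (Inr s) j\<close> and \<open>Y j s\<close> have equal
        parity, so the twist left by the derivative is the sign for moving the new \<open>Y\<close>
        past \<open>p\<close>.\<close>
      also have "\<dots> = kpow d' * (word [g] * L.tw (lpar g) p)"
        by (simp add: 2 sc_simps mult.assoc add.commute)
      also have "\<dots> \<approx> kpow d' * (p * word [g])"
        by (intro L.eqv_mult_left L.supercommute_letter)
      finally have "ra (rletter g (kpow d * p)) (word w) \<approx> ra (kpow d' * (p * word [g])) (word w)"
        by (intro L.eqv_clinear[OF clinear_ra_left]) (auto intro: ra_sid_left)
      also have "\<dots> \<approx> (if numY w \<le> d' then kpow (d' - numY w) * (p * word [g] * word w) else 0)"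
        using Cons.prems by (intro Cons.IH pg) simp
      finally have *: "ra (rletter g (kpow d * p)) (word w)
          \<approx> (if numY w \<le> d' then kpow (d' - numY w) * (p * word [g] * word w) else 0)" .
      have "p * word (g # w) = p * word [g] * word w" by (simp only: word_Cons[of g w] mult.assoc)
      moreover have "numY (g # w) = Suc (numY w)" by (simp add: 2)
      ultimately show ?thesis using * Suc by (cases "numY w \<le> d'") (simp_all add: ra)
    qed
  qed
qed simp

lemma eps_mult: "eps (a * b) = eps a * eps b"
  by (simp add: eps_def res_mult)

lemma eps_KK: "eps KK = 0"
proof -
  have "eps (c \<cdot> (word [Y j s] * word [X (Inr s) j])) = 0" for c j s
    by (simp add: eps_def res_linear res_mult res_letter)
  then show ?thesis
    by (simp add: KK_def kk_Inr eps_def res_linear)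
qed

lemma eps_kpow: "eps (kpow d) = (if d = 0 then 1 else 0)"
proof -
  have "eps 1 = 1" by (simp add: eps_def)
  then have "eps (KK ^ d) = (if d = 0 then 1 else 0)"
    by (cases d) (simp_all add: eps_mult eps_KK)
  then show ?thesis by (simp add: kpow_def eps_def res_linear)
qed

end

section \<open>The values of the operator on powers of \<open>KK\<close>\<close>

context fft_invariant
begin

text \<open>Operators act from the right, the derivatives do not see \<open>Y\<close>, and
  \<open>eps\<close> fixes \<open>Y\<close>; hence there is no sign.\<close>

lemma TT_Yall_mult:
  assumes "p \<in> Free Yall"
  shows "TT (p * v) = p * TT v"
proof -
  have p0: "L.rder (X t i) p = 0" for t i
    by (rule rder_eq_0[OF assms]) (simp add: Yall_def)
  have r: "rletter g (p * v) = p * rletter g v" for g v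
    by (cases "(g, v)" rule: rletter.cases)
      (simp_all add: mult.assoc L.rder_mult p0 sc_simps)
  have "ra (p * v) f = p * ra v f" for f
  proof (rule clinear_eqI[where a=f])
    fix w show "ra (p * v) (word w) = p * ra v (word w)"
      by (induction w arbitrary: v) (simp_all add: ra_word r)
  qed (intro clin)+
  moreover have "eps p = p"
    using assms unfolding eps_def by (rule res_Free) (auto simp: Yall_def)
  ultimately show ?thesis
    by (simp add: TT_def eps_def res_mult)
qed

lemma yr_TT:
  assumes "yr r d G" and "\<And>js. set js \<subseteq> V \<Longrightarrow> length js = d \<Longrightarrow> TT (Dl (up r js) e) \<approx> Dl (up r js) z"
  shows "TT (G e) \<approx> G z"
  using assms
proof (induction rule: yr.induct)
  case (add r d F G)
  then show ?case unfolding TT_linear by (intro L.eqv_add) auto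
next
  case (base p js d r)
  then show ?case unfolding TT_Yall_mult[OF base.hyps(1)] by (intro L.eqv_mult_left) auto
qed (simp add: TT_linear)

text \<open>Contracting the multilinear vector gives this product up to a nonzero factor, and
  contracting its counterpart \<open>z\<close> gives products of scalar products. \<open>TT\<close>
  respects the contraction by \<open>yr_TT\<close>.\<close>

lemma TT_prod_kk:
  assumes "set ss \<subseteq> S"
  shows "TT (prod_list (map (\<lambda>s. kk s (Inr s)) ss)) \<in> Bz"
proof -
  let ?e = "word (xw 0 (map Inr ss))"
  have map2: "map2 kk ss (map Inr ss) = map (\<lambda>s. kk s (Inr s)) ss"
    by (induction ss) auto
  obtain c where c: "c \<noteq> 0" "Phis 0 ss ?e \<approx> c \<cdot> prod_list (map (\<lambda>s. kk s (Inr s)) ss)"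
    using Phis_xw[of ss "map Inr ss" 0] unfolding map2 by auto
  have "ss \<in> lists S" using assms by auto
  from multilinear_vector[OF this] obtain z where z: "z \<in> Z (length ss)"
    "\<And>js. set js \<subseteq> V \<Longrightarrow> length js = length ss \<Longrightarrow> TT (Dl (up 0 js) ?e) \<approx> Dl (up 0 js) z"
    by blast
  have "Phis 0 ss z \<in> Bz"
    using z(1) unfolding Z_def
  proof (induction rule: spn.induct)
    case (base b)
    then obtain ts where ts: "b = word (xw 0 (map Inl ts))" "set ts \<subseteq> T" "length ts = length ss"
      by auto
    obtain d where "Phis 0 ss b \<approx> d \<cdot> prod_list (map2 kk ss (map Inl ts))"
      using Phis_xw[of ss "map Inl ts" 0] ts by auto
    moreover have "prod_list (map2 kk ss (map Inl ts)) \<in> Bz"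
      using ts(3)[symmetric] ts(2) assms
    proof (induction ss ts rule: list_induct2)
      case Nil
      then show ?case using Bz.const[of 1] by simp
    qed (auto intro!: Bz.mult kk_Bz)
    ultimately show ?case
      using Bz.eqv[OF Bz_scale L.eqv_sym] by blast
  next
    case (eqv a b)
    then show ?case using Bz.eqv Phis_eqv by blast
  qed (auto simp: Phis_linear intro: Bz_0 Bz.add Bz_scale)
  moreover have "TT (Phis 0 ss ?e) \<approx> Phis 0 ss z"
    by (rule yr_TT[OF yr_Phis z(2)])
  ultimately have "TT (Phis 0 ss ?e) \<in> Bz"
    using Bz.eqv L.eqv_sym by blast
  moreover have "TT (Phis 0 ss ?e) \<approx> c \<cdot> TT (prod_list (map (\<lambda>s. kk s (Inr s)) ss))"
    using TT_eqv[OF c(2)] by (simp add: TT_linear)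
  ultimately have "c \<cdot> TT (prod_list (map (\<lambda>s. kk s (Inr s)) ss)) \<in> Bz"
    by (rule Bz.eqv)
  from Bz_scale[OF this, of "1 / c"] show ?thesis
    using c(1) by (simp add: sc_simps)
qed

text \<open>\<open>KK\<close> is expanded one factor at a time; \<open>ss\<close> records the
  summands already chosen.\<close>

lemma TT_KK_power:
  "set ss \<subseteq> S \<Longrightarrow> TT (prod_list (map (\<lambda>s. kk s (Inr s)) ss) * KK ^ d) \<in> Bz"
proof (induction d arbitrary: ss)
  case 0
  then show ?case by (simp add: TT_prod_kk)
next
  case (Suc d)
  let ?p = "\<lambda>ss. prod_list (map (\<lambda>s. kk s (Inr s)) ss)"
  have "?p ss * KK ^ Suc d = (\<Sum>s\<in>S. ?p (ss @ [s]) * KK ^ d)"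
    by (subst power_Suc, subst (1) KK_def)
      (simp add: sum_distrib_left sum_distrib_right mult.assoc)
  then show ?case
    using Suc.prems by (simp only: TT_linear) (intro Bz_sum Suc.IH, simp)
qed

theorem invariant_in_Bz: "f \<in> Bz"
proof -
  \<comment> \<open>A crude bound for the number of letters \<open>Y\<close> in any word of
    \<open>f\<close>, so that the truncated series contains every contributing term.\<close>
  let ?N = "\<Sum>v\<in>Poly_Mapping.keys f. length v"
  have "(\<Sum>d\<le>?N. eps (ra (kpow d) f)) \<approx> f"
  proof (rule L.eqv_clinear_on[where a=f and F="\<lambda>a. \<Sum>d\<le>?N. eps (ra (kpow d) a)"])
    show "clinear (\<lambda>a. \<Sum>d\<le>?N. eps (ra (kpow d) a))" unfolding eps_def by (intro clin)
    fix w assume w: "w \<in> Poly_Mapping.keys f"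
    then have sw: "set w \<subseteq> XT \<union> YS" using f_Free by (auto simp: Free_def)
    have ew: "eps (word w) = word w"
      unfolding eps_def by (rule res_Free[of _ "XT \<union> YS"]) (use sw in \<open>auto simp: Free_word XT_def YS_def\<close>)
    have "length w \<le> ?N" using w by (intro member_le_sum) auto
    then have N: "numY w \<le> ?N" using numY_le[of w] by linarith
    \<comment> \<open>The letters \<open>Y\<close> of \<open>w\<close> use up \<open>numY w\<close>
      factors \<open>KK\<close>, and \<open>eps\<close> annihilates any factor that remains.\<close>
    have "(\<Sum>d\<le>?N. eps (ra (kpow d) (word w))) \<approx> (\<Sum>d\<le>?N. if d = numY w then word w else 0)"
    proof (rule L.eqv_sum)
      fix d
      have "eps (ra (kpow d) (word w)) \<approx> eps (if numY w \<le> d then kpow (d - numY w) * word w else 0)"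
        using ra_kpow[OF sw Free_1, of d] unfolding eps_def mult_1_left mult_1_right by (rule res_eqv)
      also have "\<dots> = (if d = numY w then word w else 0)"
        by (auto simp: eps_mult eps_kpow ew) (simp_all add: eps_def res_linear)
      finally show "eps (ra (kpow d) (word w)) \<approx> (if d = numY w then word w else 0)" .
    qed
    also have "\<dots> = word w" using N by (simp add: sum.delta')
    finally show "(\<Sum>d\<le>?N. eps (ra (kpow d) (word w))) \<approx> word w" .
  qed (rule clinear_id)
  moreover have "(\<Sum>d\<le>?N. eps (ra (kpow d) f)) \<in> Bz"
  proof (rule Bz_sum)
    fix d
    have "TT (KK ^ d) \<in> Bz" using TT_KK_power[of "[]" d] by simp
    then show "eps (ra (kpow d) f) \<in> Bz"
      unfolding TT_def[symmetric] kpow_def TT_linear by (rule Bz_scale)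
  qed
  ultimately show ?thesis by (rule Bz.eqv[rotated])
qed

end

section \<open>Coordinates in superspaces\<close>

text \<open>The coordinate functions are a parameter, so that the given dual basis can serve for
  \<open>V\<close> and representation functions for \<open>U\<close> and \<open>W\<close>.\<close>

locale coords =
  fixes U :: "'a::ab_group_add sspace" and k l :: nat and u :: "idx \<Rightarrow> 'a" and c :: "idx \<Rightarrow> 'a \<Rightarrow> complex"
  assumes superspace: "superspace U"
    and basis: "homogeneous_basis U k l u"
    and c_add: "\<And>t x y. t \<in> sindex k l \<Longrightarrow> c t (x + y) = c t x + c t y"
    and c_scale: "\<And>t r x. t \<in> sindex k l \<Longrightarrow> c t (scl U r x) = r * c t x"
    and c_basis: "\<And>t t'. t \<in> sindex k l \<Longrightarrow> t' \<in> sindex k l \<Longrightarrow> c t (u t') = (if t = t' then 1 else 0)"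
begin

sublocale vs: vector_space "scl U"
  using superspace by (simp add: superspace_def)

lemma subspace_gr: "vs.subspace (gr U a)"
  using superspace by (simp add: superspace_def)

lemma gr_Int: "x \<in> gr U a \<Longrightarrow> x \<in> gr U (a + 1) \<Longrightarrow> x = 0"
  using superspace by (cases a) (auto simp: superspace_def)

lemma c_zero: "t \<in> sindex k l \<Longrightarrow> c t 0 = 0"
  using c_scale[of t 0 0] by simp

lemma c_sum: "t \<in> sindex k l \<Longrightarrow> c t (\<Sum>i\<in>A. f i) = (\<Sum>i\<in>A. c t (f i))"
  by (induction A rule: infinite_finite_induct) (auto simp: c_zero c_add)

lemma expand: "x = (\<Sum>t\<in>sindex k l. scl U (c t x) (u t))"
proof -
  let ?T = "{x. x = (\<Sum>t\<in>sindex k l. scl U (c t x) (u t))}"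
  have "vs.subspace ?T"
  proof (rule vs.subspaceI)
    fix x y assume "x \<in> ?T" "y \<in> ?T"
    then have "x = (\<Sum>t\<in>sindex k l. scl U (c t x) (u t))" "y = (\<Sum>t\<in>sindex k l. scl U (c t y) (u t))"
      by blast+
    moreover have "(\<Sum>t\<in>sindex k l. scl U (c t (x + y)) (u t))
        = (\<Sum>t\<in>sindex k l. scl U (c t x) (u t)) + (\<Sum>t\<in>sindex k l. scl U (c t y) (u t))"
      by (simp add: c_add vs.scale_left_distrib sum.distrib)
    ultimately show "x + y \<in> ?T" by simp
  next
    fix r x assume "x \<in> ?T"
    then have "x = (\<Sum>t\<in>sindex k l. scl U (c t x) (u t))" by blast
    moreover have "(\<Sum>t\<in>sindex k l. scl U (c t (scl U r x)) (u t)) = scl U r (\<Sum>t\<in>sindex k l. scl U (c t x) (u t))"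
      by (simp add: c_scale vs.scale_sum_right)
    ultimately show "scl U r x \<in> ?T" by simp
  qed (simp add: c_zero)
  moreover have "u ` sindex k l \<subseteq> ?T"
  proof safe
    fix s assume "s \<in> sindex k l"
    moreover from this have "(\<Sum>t\<in>sindex k l. scl U (c t (u s)) (u t)) = (\<Sum>t\<in>sindex k l. if t = s then u t else 0)"
      by (intro sum.cong) (auto simp: c_basis)
    ultimately show "u s = (\<Sum>t\<in>sindex k l. scl U (c t (u s)) (u t))"
      using finite_sindex by (simp add: sum.delta')
  qed
  ultimately have "vs.span (u ` sindex k l) \<subseteq> ?T" by (intro vs.span_minimal)
  then show ?thesis using basis by (auto simp: homogeneous_basis_def)
qed

lemma coords_eqI: "(\<And>t. t \<in> sindex k l \<Longrightarrow> c t x = c t y) \<Longrightarrow> x = y"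
  using expand[of x] expand[of y] by simp

lemma hpart_eqI:
  assumes "y \<in> gr U a" and "x - y \<in> gr U (a + 1)"
  shows "hpart U a x = y"
  unfolding hpart_def
proof (rule the_equality)
  fix z assume z: "z \<in> gr U a \<and> x - z \<in> gr U (a + 1)"
  then have "z - y \<in> gr U a" using assms by (intro vs.subspace_diff[OF subspace_gr]) auto
  moreover have "(x - y) - (x - z) \<in> gr U (a + 1)"
    using assms z by (intro vs.subspace_diff[OF subspace_gr, of "x - y" _ "x - z"]) auto
  ultimately show "z = y" using gr_Int[of "z - y" a] by simp
qed (use assms in auto)

lemma hpart_coords: "hpart U a x = (\<Sum>t\<in>sindex k l. scl U (if ipar t = a then c t x else 0) (u t))"
proof (rule hpart_eqI)
  let ?y = "\<lambda>a. \<Sum>t\<in>sindex k l. scl U (if ipar t = a then c t x else 0) (u t)"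
  have gr: "?y a \<in> gr U a" for a
  proof (rule vs.subspace_sum[OF subspace_gr])
    fix t assume "t \<in> sindex k l"
    then have "u t \<in> gr U (ipar t)" using basis by (simp add: homogeneous_basis_def)
    then show "scl U (if ipar t = a then c t x else 0) (u t) \<in> gr U a"
      by (auto intro: vs.subspace_scale[OF subspace_gr] vs.subspace_0[OF subspace_gr])
  qed
  then show "?y a \<in> gr U a" .
  have "ipar t \<noteq> a \<longleftrightarrow> ipar t = a + 1" for t by (cases a; cases "ipar t") simp_all
  then have "?y a + ?y (a + 1) = (\<Sum>t\<in>sindex k l. scl U (c t x) (u t))"
    unfolding sum.distrib[symmetric] by (intro sum.cong) auto
  then have "x - ?y a = ?y (a + 1)" using expand[of x] by (simp add: algebra_simps)
  then show "x - ?y a \<in> gr U (a + 1)" using gr by simp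
qed

lemma c_comb:
  assumes "t \<in> sindex k l"
  shows "c t (\<Sum>s\<in>sindex k l. scl U (g s) (u s)) = g t"
proof -
  have "c t (\<Sum>s\<in>sindex k l. scl U (g s) (u s)) = (\<Sum>s\<in>sindex k l. if s = t then g s else 0)"
    using assms by (auto simp: c_sum c_scale c_basis intro!: sum.cong)
  then show ?thesis using assms finite_sindex by (simp add: sum.delta')
qed

lemma c_hpart: "t \<in> sindex k l \<Longrightarrow> c t (hpart U a x) = (if ipar t = a then c t x else 0)"
  unfolding hpart_coords by (rule c_comb)

lemma c_gr:
  assumes "x \<in> gr U a" and "t \<in> sindex k l" and "ipar t \<noteq> a"
  shows "c t x = 0"
proof -
  have "hpart U a x = x"
    using assms vs.subspace_0[OF subspace_gr] by (intro hpart_eqI) auto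
  then show ?thesis using c_hpart[of t a x] assms by simp
qed

lemma c_twist: "t \<in> sindex k l \<Longrightarrow> c t (twist U d x) = ksgn (d * ipar t) * c t x"
  by (cases "ipar t") (simp_all add: twist_def c_add c_scale c_hpart)

lemma hpart_add: "hpart U a (x + y) = hpart U a x + hpart U a y"
  by (rule coords_eqI) (simp add: c_hpart c_add)

lemma hpart_scale: "hpart U a (scl U r x) = scl U r (hpart U a x)"
  by (rule coords_eqI) (simp add: c_hpart c_scale)

lemma twist_add: "twist U d (x + y) = twist U d x + twist U d y"
  by (rule coords_eqI) (simp add: c_twist c_add distrib_left)

lemma twist_scale: "twist U d (scl U r x) = scl U r (twist U d x)"
  by (rule coords_eqI) (simp add: c_twist c_scale)

lemma dual_iff: "f \<in> dual U \<longleftrightarrow> (\<forall>x y. f (x + y) = f x + f y) \<and> (\<forall>r x. f (scl U r x) = r * f x)"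
proof -
  have "vector_space ((*) :: complex \<Rightarrow> complex \<Rightarrow> complex)"
    by unfold_locales (auto simp: algebra_simps)
  then show ?thesis
    by (simp add: dual_def Vector_Spaces.linear_iff vs.vector_space_axioms)
qed

lemma gl_iff: "R \<in> gl U \<longleftrightarrow> (\<forall>x y. R (x + y) = R x + R y) \<and> (\<forall>r x. R (scl U r x) = scl U r (R x))"
  by (simp add: gl_def Vector_Spaces.linear_iff vs.vector_space_axioms)

lemma dual_expand:
  assumes "f \<in> dual U"
  shows "f x = (\<Sum>t\<in>sindex k l. f (u t) * c t x)"
proof -
  have f0: "f 0 = 0" using assms unfolding dual_iff by (metis mult_zero_left vs.scale_zero_left)
  have "f (\<Sum>i\<in>A. g i) = (\<Sum>i\<in>A. f (g i))" for A :: "idx set" and g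
    using assms by (induction A rule: infinite_finite_induct) (auto simp: dual_iff f0)
  then have "f (\<Sum>t\<in>sindex k l. scl U (c t x) (u t)) = (\<Sum>t\<in>sindex k l. f (u t) * c t x)"
    using assms by (simp add: dual_iff mult.commute)
  then show ?thesis using expand[of x] by simp
qed

lemma gl_coords:
  assumes "R \<in> gl U" and "t \<in> sindex k l"
  shows "c t (R x) = (\<Sum>s\<in>sindex k l. c t (R (u s)) * c s x)"
proof -
  have "(\<lambda>x. c t (R x)) \<in> dual U"
    using assms by (auto simp: dual_iff gl_iff c_add c_scale)
  from dual_expand[OF this, of x] show ?thesis .
qed

lemma gl_part_in_gl: "R \<in> gl U \<Longrightarrow> gl_part U d R \<in> gl U"
  by (auto simp: gl_iff gl_part_def hpart_add hpart_scale vs.scale_right_distrib)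

lemma c_gl_part:
  assumes "R \<in> gl U" and "t \<in> sindex k l" and "s \<in> sindex k l"
  shows "c t (gl_part U d R (u s)) = (if ipar t + ipar s = d then c t (R (u s)) else 0)"
proof -
  have X0: "R 0 = 0" using assms(1) unfolding gl_iff by (metis vs.scale_zero_left)
  have h: "hpart U a (u s) = (if ipar s = a then u s else 0)" for a
    using assms by (intro coords_eqI) (auto simp: c_hpart c_basis c_zero)
  show ?thesis
    using assms by (cases d; cases "ipar t"; cases "ipar s")
      (simp_all add: gl_part_def h X0 c_add c_hpart c_zero)
qed

end

lemma ex_coords:
  assumes "superspace U" and "homogeneous_basis U k l u"
  shows "\<exists>c. coords U k l u c"
proof -
  interpret vs: vector_space "scl U" using assms(1) by (simp add: superspace_def)
  let ?B = "u ` sindex k l"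
  have B: "vs.independent ?B" "vs.span ?B = UNIV" "inj_on u (sindex k l)"
    using assms(2) by (auto simp: homogeneous_basis_def)
  have "coords U k l u (\<lambda>t x. vs.representation ?B x (u t))"
  proof (unfold_locales, goal_cases)
    case (3 t x y)
    then show ?case using B by (simp add: vs.representation_add)
  next
    case (4 t r x)
    then show ?case using B by (simp add: vs.representation_scale)
  next
    case (5 t t')
    then show ?case using B by (auto simp: vs.representation_basis inj_on_def)
  qed (use assms in auto)
  then show ?thesis by blast
qed


section \<open>The free algebra as a ring\<close>

lemma free_algebra_simps [simp]:
  "carrier (free_algebra G) = Free G" "mult (free_algebra G) = (*)" "one (free_algebra G) = 1"
  "zero (free_algebra G) = 0" "add (free_algebra G) = (+)"
  by (simp_all add: free_algebra_def Free_def)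

lemma ring_free_algebra: "ring (free_algebra G)"
proof (rule ringI)
  show "abelian_group (free_algebra G)"
    by (rule abelian_groupI)
      (auto simp: Free_add Free_0 add.assoc add.commute intro: bexI[of _ "- _"] Free_minus)
  show "monoid (free_algebra G)"
    by (rule monoidI) (auto simp: Free_mult Free_1 mult.assoc)
qed (auto simp: distrib_left distrib_right)

lemma a_inv_free_algebra: "a \<in> Free G \<Longrightarrow> a_inv (free_algebra G) a = - a"
proof -
  interpret ring "free_algebra G" by (rule ring_free_algebra)
  show "a \<in> Free G \<Longrightarrow> a_inv (free_algebra G) a = - a"
    by (rule minus_equality) (auto simp: Free_minus)
qed

lemma ideal_free_algebraI:
  assumes "M \<subseteq> Free G" and "0 \<in> M" and "\<And>a b. a \<in> M \<Longrightarrow> b \<in> M \<Longrightarrow> a + b \<in> M"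
    and "\<And>a. a \<in> M \<Longrightarrow> - a \<in> M"
    and "\<And>a b. a \<in> M \<Longrightarrow> b \<in> Free G \<Longrightarrow> b * a \<in> M"
    and "\<And>a b. a \<in> M \<Longrightarrow> b \<in> Free G \<Longrightarrow> a * b \<in> M"
  shows "ideal M (free_algebra G)"
proof (rule idealI[OF ring_free_algebra])
  show "subgroup M (add_monoid (free_algebra G))"
  proof (rule subgroup.intro)
    fix x assume "x \<in> M"
    then have "a_inv (free_algebra G) x = - x" using assms(1) by (intro a_inv_free_algebra) auto
    then show "inv\<^bsub>add_monoid (free_algebra G)\<^esub> x \<in> M"
      using assms(4) \<open>x \<in> M\<close> by (simp add: a_inv_def)
  qed (use assms in auto)
qed (use assms in auto)

section \<open>Passage to coordinates\<close>

lemma sc_sum_left: "(\<Sum>i\<in>A. c i) \<cdot> a = (\<Sum>i\<in>A. c i \<cdot> a)"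
  by (induction A rule: infinite_finite_induct) (auto simp: sc_add)

text \<open>Homogeneous linear forms. A zero coefficient may stand before a letter of any parity, so
  coordinate expansions over all indices fit.\<close>

inductive_set hlin :: "bit \<Rightarrow> letter falg set" for d where
  zero: "0 \<in> hlin d"
| add: "a \<in> hlin d \<Longrightarrow> b \<in> hlin d \<Longrightarrow> a + b \<in> hlin d"
| letter: "c = 0 \<or> lpar g = d \<Longrightarrow> c \<cdot> word [g] \<in> hlin d"

lemma hlin_sum: "(\<And>i. i \<in> A \<Longrightarrow> f i \<in> hlin d) \<Longrightarrow> sum f A \<in> hlin d"
  by (induction A rule: infinite_finite_induct) (auto intro: hlin.intros)

lemma hlin_supercommute:
  assumes "a \<in> hlin d" and "b \<in> hlin e"
  shows "a * b \<approx> ksgn (d * e) \<cdot> (b * a)"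
  using assms(1)
proof (induction rule: hlin.induct)
  case (add a a')
  then show ?case unfolding distrib_left distrib_right sc_simps by (intro L.eqv_add)
next
  case (letter c g)
  show ?case using assms(2)
  proof (induction rule: hlin.induct)
    case (add b b')
    then show ?case unfolding distrib_left distrib_right sc_simps by (intro L.eqv_add)
  next
    case (letter r h)
    show ?case
    proof (cases "c = 0 \<or> r = 0")
      case False
      then have "lpar g = d" "lpar h = e" using letter \<open>c = 0 \<or> lpar g = d\<close> by auto
      then have "(r * c) \<cdot> (word [g] * word [h]) \<approx> (r * c) \<cdot> ksgn (d * e) \<cdot> (word [h] * word [g])"
        using scomm_eqv[of g h] by (intro L.eqv_scale) simp
      then show ?thesis by (simp add: sc_simps ac_simps)
    qed auto
  qed simp
qed simp

text \<open>The parity \<open>d\<close> part of the operator with matrix \<open>M\<close>. All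
  matrix units that occur have parity \<open>d\<close>, so one twist suffices in
  \<open>AD_mult\<close>.\<close>

definition AD :: "idx set \<Rightarrow> bit \<Rightarrow> (idx \<Rightarrow> idx \<Rightarrow> complex) \<Rightarrow> letter falg \<Rightarrow> letter falg" where
  "AD I d M a = (\<Sum>i\<in>I. \<Sum>j\<in>I. (if epar i j = d then M i j else 0) \<cdot> DF i j a)"

lemma clinear_AD: "clinear (AD I d M)"
proof -
  have "AD I d M = (\<lambda>a. \<Sum>i\<in>I. \<Sum>j\<in>I. (if epar i j = d then M i j else 0) \<cdot> DF i j a)"
    by (intro ext) (simp add: AD_def)
  then show ?thesis by simp (intro clin)
qed

lemma AD_1: "AD I d M 1 = 0"
  by (simp add: AD_def)

lemma AD_mult: "AD I d M (a * b) = AD I d M a * b + L.tw d a * AD I d M b"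
proof -
  have "(if epar i j = d then M i j else 0) \<cdot> DF i j (a * b)
      = (if epar i j = d then M i j else 0) \<cdot> DF i j a * b
        + L.tw d a * ((if epar i j = d then M i j else 0) \<cdot> DF i j b)" for i j
    by (auto simp: DF_mult sc_simps)
  then show ?thesis
    by (simp add: AD_def sum.distrib sum_distrib_left sum_distrib_right)
qed

lemma AD_X:
  assumes "finite I" and "j \<in> I"
  shows "AD I d M (word [X t j]) = (\<Sum>i\<in>I. (if epar i j = d then M i j * ksgn (d * tpar t) else 0) \<cdot> word [X t i])"
proof -
  have "AD I d M (word [X t j]) = (\<Sum>i\<in>I. \<Sum>j'\<in>I. if j' = j
      then (if epar i j = d then M i j * ksgn (d * tpar t) else 0) \<cdot> word [X t i] else 0)"
    unfolding AD_def by (intro sum.cong refl) (auto simp: DF_letter sc_simps)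
  then show ?thesis using assms by (simp add: sum.delta)
qed

lemma AD_Y:
  assumes "finite I" and "i \<in> I"
  shows "AD I d M (word [Y i s]) = (\<Sum>j\<in>I. (if epar i j = d then - (M i j * ksgn (d * ipar i)) else 0) \<cdot> word [Y j s])"
proof -
  have "AD I d M (word [Y i s]) = (\<Sum>i'\<in>I. \<Sum>j\<in>I. if i' = i
      then (if epar i j = d then - (M i j * ksgn (d * ipar i)) else 0) \<cdot> word [Y j s] else 0)"
    unfolding AD_def by (intro sum.cong refl) (auto simp: DF_letter sc_simps sc_minus)
  also have "\<dots> = (\<Sum>j\<in>I. \<Sum>i'\<in>I. if i' = i
      then (if epar i j = d then - (M i j * ksgn (d * ipar i)) else 0) \<cdot> word [Y j s] else 0)"
    by (rule sum.swap)
  finally show ?thesis using assms by (simp add: sum.delta)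
qed

lemma gl_part_split: "AD I 0 M a + AD I 1 M a = (\<Sum>i\<in>I. \<Sum>j\<in>I. M i j \<cdot> DF i j a)"
proof -
  have "(if epar i j = 0 then M i j else 0) \<cdot> DF i j a + (if epar i j = 1 then M i j else 0) \<cdot> DF i j a
      = M i j \<cdot> DF i j a" for i j
    by (cases "epar i j") auto
  then show ?thesis by (simp add: AD_def sum.distrib[symmetric])
qed

section \<open>The presentation by tensors and the letters are equivalent\<close>

locale presentation =
  U: coords U k l u cu + V: coords V n m e e' + W: coords W p q w cw
  for U :: "'u::ab_group_add sspace" and k l u cu
    and V :: "'v::ab_group_add sspace" and n m e e'
    and W :: "'w::ab_group_add sspace" and p q w cw +
  assumes e'_dual: "\<And>i. i \<in> sindex n m \<Longrightarrow> e' i \<in> dual V"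
begin

abbreviation G :: "('u, 'v, 'w) tens set" where
  "G \<equiv> gens V"

abbreviation A :: "('u, 'v, 'w) tens falg ring" where
  "A \<equiv> free_algebra G"

abbreviation J :: "('u, 'v, 'w) tens falg set" where
  "J \<equiv> sym_ideal U V W"

abbreviation T :: "idx set" where "T \<equiv> sindex k l"
abbreviation I :: "idx set" where "I \<equiv> sindex n m"
abbreviation S :: "idx set" where "S \<equiv> sindex p q"

sublocale core: fft_words n m T S
  by unfold_locales (rule finite_sindex)+

sublocale A: ring A
  by (rule ring_free_algebra)

lemma UV_in_gens [simp]: "UV a b \<in> G"
  by (auto simp: gens_def)

lemma DW_in_gens [simp]: "DW f b \<in> G \<longleftrightarrow> f \<in> dual V"
  by (auto simp: gens_def)

lemma hgens_gens: "g \<in> hgens U V W a \<Longrightarrow> g \<in> G"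
  by (auto simp: hgens_def dual_gr_def)

lemma dual_0: "(\<lambda>x. 0) \<in> dual V"
  and dual_add: "f \<in> dual V \<Longrightarrow> f' \<in> dual V \<Longrightarrow> (\<lambda>x. f x + f' x) \<in> dual V"
  and dual_scale: "f \<in> dual V \<Longrightarrow> (\<lambda>x. r * f x) \<in> dual V"
  by (auto simp: V.dual_iff algebra_simps)

lemma rels_carrier: "rels U V W \<subseteq> Free G"
proof
  fix a assume "a \<in> rels U V W"
  then show "a \<in> Free G"
    by (cases rule: rels.cases)
      (auto simp: Free_word dual_add dual_scale hgens_gens
        intro!: Free_diff Free_mult[OF Free_const])
qed

sublocale J: ideal J A
  unfolding sym_ideal_def using rels_carrier by (intro A.genideal_ideal) simp

lemma rels_J: "a \<in> rels U V W \<Longrightarrow> a \<in> J"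
  unfolding sym_ideal_def using A.genideal_self[of "rels U V W"] rels_carrier by auto

lemma J_add: "a \<in> J \<Longrightarrow> b \<in> J \<Longrightarrow> a + b \<in> J"
  using J.a_closed[of a b] by simp

lemma J_0: "0 \<in> J"
  using J.zero_closed by simp

lemma J_Free: "a \<in> J \<Longrightarrow> a \<in> Free G"
  using J.a_Hcarr[of a] by simp

lemma J_minus: "a \<in> J \<Longrightarrow> - a \<in> J"
  using J.a_inv_closed[of a] by (simp add: a_inv_free_algebra J_Free)

lemma J_left: "a \<in> J \<Longrightarrow> b \<in> Free G \<Longrightarrow> b * a \<in> J"
  using J.I_l_closed[of a b] by simp

lemma J_right: "a \<in> J \<Longrightarrow> b \<in> Free G \<Longrightarrow> a * b \<in> J"
  using J.I_r_closed[of a b] by simp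

lemma J_scale: "a \<in> J \<Longrightarrow> c \<cdot> a \<in> J"
  unfolding sc_def by (rule J_left[OF _ Free_const])

definition jeq :: "('u, 'v, 'w) tens falg \<Rightarrow> ('u, 'v, 'w) tens falg \<Rightarrow> bool" (infix "\<simeq>\<^sub>J" 50) where
  "a \<simeq>\<^sub>J b \<longleftrightarrow> a - b \<in> J"

lemma jeq_refl [simp]: "a \<simeq>\<^sub>J a"
  by (simp add: jeq_def J_0)

lemma jeq_sym: "a \<simeq>\<^sub>J b \<Longrightarrow> b \<simeq>\<^sub>J a"
  unfolding jeq_def using J_minus[of "a - b"] by simp

lemma jeq_trans [trans]: "a \<simeq>\<^sub>J b \<Longrightarrow> b \<simeq>\<^sub>J c \<Longrightarrow> a \<simeq>\<^sub>J c"
  unfolding jeq_def using J_add[of "a - b" "b - c"] by simp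

lemma jeq_add: "a \<simeq>\<^sub>J b \<Longrightarrow> c \<simeq>\<^sub>J d \<Longrightarrow> a + c \<simeq>\<^sub>J b + d"
  unfolding jeq_def using J_add[of "a - b" "c - d"] by (simp add: algebra_simps)

lemma jeq_scale: "a \<simeq>\<^sub>J b \<Longrightarrow> c \<cdot> a \<simeq>\<^sub>J c \<cdot> b"
  unfolding jeq_def using J_scale[of "a - b" c] by (simp add: sc_simps)

lemma jeq_sum: "(\<And>i. i \<in> B \<Longrightarrow> f i \<simeq>\<^sub>J g i) \<Longrightarrow> sum f B \<simeq>\<^sub>J sum g B"
  by (induction B rule: infinite_finite_induct) (auto intro: jeq_add)

lemma jeq_mult:
  assumes "a \<simeq>\<^sub>J b" and "c \<simeq>\<^sub>J d" and "b \<in> Free G" and "c \<in> Free G"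
  shows "a * c \<simeq>\<^sub>J b * d"
  using J_add[OF J_right[of "a - b" c] J_left[of "c - d" b]] assms
  by (simp add: jeq_def algebra_simps)

definition phig :: "('u, 'v, 'w) tens \<Rightarrow> letter falg" where
  "phig g = (case g of
      UV a b \<Rightarrow> (\<Sum>t\<in>T. \<Sum>i\<in>I. (cu t a * e' i b) \<cdot> word [X (Inl t) i])
    | DW f b \<Rightarrow> (\<Sum>i\<in>I. \<Sum>s\<in>S. (f (e i) * cw s b) \<cdot> word [Y i s]))"

lemma phig_UV: "phig (UV a b) = (\<Sum>t\<in>T. \<Sum>i\<in>I. (cu t a * e' i b) \<cdot> word [X (Inl t) i])"
  and phig_DW: "phig (DW f c) = (\<Sum>i\<in>I. \<Sum>s\<in>S. (f (e i) * cw s c) \<cdot> word [Y i s])"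
  by (simp_all add: phig_def)

text \<open>There are more letters than basis tensors. The surplus ones, including the auxiliary
  letters, go to 0; they do not occur in the values of \<open>phi\<close> (\<open>phi_Free\<close>),
  so \<open>psi\<close> is a left inverse of \<open>phi\<close> modulo \<open>J\<close>.\<close>

definition psig :: "letter \<Rightarrow> ('u, 'v, 'w) tens falg" where
  "psig g = (case g of
      X t i \<Rightarrow> (case t of
        Inl t \<Rightarrow> if t \<in> T \<and> i \<in> I then word [UV (u t) (e i)] else 0
      | Inr s \<Rightarrow> 0)
    | Y i s \<Rightarrow> if i \<in> I \<and> s \<in> S then word [DW (e' i) (w s)] else 0)"

abbreviation phi :: "('u, 'v, 'w) tens falg \<Rightarrow> letter falg" where
  "phi \<equiv> subst phig"

abbreviation psi :: "letter falg \<Rightarrow> ('u, 'v, 'w) tens falg" where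
  "psi \<equiv> subst psig"

lemma phig_Free: "phig g \<in> Free (core.XT \<union> core.YS)"
  by (cases g)
    (auto simp: phig_UV phig_DW Free_word core.XT_def core.YS_def intro!: Free_sum Free_scale)

lemma phi_Free: "phi a \<in> Free (core.XT \<union> core.YS)"
  by (rule subst_Free[OF Free_UNIV phig_Free])

lemma psi_Free: "psi a \<in> Free G"
proof (rule subst_Free[OF Free_UNIV])
  fix g show "psig g \<in> Free G"
    by (auto simp: psig_def Free_0 Free_word e'_dual split: letter.split sum.split)
qed

lemma phig_hlin: "g \<in> hgens U V W a \<Longrightarrow> phig g \<in> hlin a"
proof -
  assume "g \<in> hgens U V W a"
  then consider x y b c where "g = UV x y" "x \<in> gr U b" "y \<in> gr V c" "a = b + c"
    | f y b c where "g = DW f y" "f \<in> dual_gr V b" "y \<in> gr W c" "a = b + c"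
    unfolding hgens_def by blast
  then show ?thesis
  proof cases
    case 1
    have "cu t x * e' i y = 0 \<or> ipar t + ipar i = a" if "t \<in> T" "i \<in> I" for t i
      using U.c_gr[of x b t] V.c_gr[of y c i] 1 that by auto
    then show ?thesis
      unfolding 1(1) phig_UV by (intro hlin_sum hlin.letter) simp
  next
    case 2
    have "f (e i) * cw s y = 0 \<or> ipar i + ipar s = a" if "i \<in> I" "s \<in> S" for i s
    proof -
      have "e i \<in> gr V (ipar i)" using V.basis that by (simp add: homogeneous_basis_def)
      moreover have "ipar i \<noteq> b \<Longrightarrow> ipar i = b + 1" by (cases b; cases "ipar i") simp_all
      ultimately have "ipar i \<noteq> b \<Longrightarrow> f (e i) = 0" using 2 by (auto simp: dual_gr_def)
      then show ?thesis using W.c_gr[of y c s] 2 that by auto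
    qed
    then show ?thesis
      unfolding 2(1) phig_DW by (intro hlin_sum hlin.letter) simp
  qed
qed

lemma phi_rels: "a \<in> rels U V W \<Longrightarrow> phi a \<in> L.sid"
proof (induction rule: rels.induct)
  case (supercomm g a h b)
  have "word [g, h] = word [g] * word [h]" for g h :: "('u, 'v, 'w) tens"
    using word_Cons[of g "[h]"] .
  then have "phi (word [g, h] - const (ksgn (a * b)) * word [h, g])
      = phig g * phig h - ksgn (a * b) \<cdot> (phig h * phig g)"
    by (simp add: subst_linear subst_mult sc_def[symmetric])
  then show ?case
    using hlin_supercommute[OF phig_hlin phig_hlin, OF supercomm] by (simp add: L.eqv_def)
next
  case (UV_add_left a a' b)
  have "phig (UV (a + a') b) = phig (UV a b) + phig (UV a' b)"
    by (simp add: phig_UV U.c_add distrib_right sc_add sum.distrib)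
  then show ?case by (simp add: subst_linear L.sid.zero)
next
  case (UV_add_right a b b')
  have "phig (UV a (b + b')) = phig (UV a b) + phig (UV a b')"
    by (simp add: phig_UV V.c_add distrib_left sc_add sum.distrib)
  then show ?case by (simp add: subst_linear L.sid.zero)
next
  case (UV_scale_left r a b)
  have "phig (UV (scl U r a) b) = r \<cdot> phig (UV a b)"
    by (simp add: phig_UV U.c_scale sc_sum sc_simps mult.assoc)
  then show ?case by (simp add: subst_linear sc_def[symmetric] L.sid.zero)
next
  case (UV_scale_right a r b)
  have "phig (UV a (scl V r b)) = r \<cdot> phig (UV a b)"
    by (simp add: phig_UV V.c_scale sc_sum sc_simps ac_simps)
  then show ?case by (simp add: subst_linear sc_def[symmetric] L.sid.zero)
next
  case (DW_add_left f f' b)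
  have "phig (DW (\<lambda>x. f x + f' x) b) = phig (DW f b) + phig (DW f' b)"
    by (simp add: phig_DW distrib_right sc_add sum.distrib)
  then show ?case by (simp add: subst_linear L.sid.zero)
next
  case (DW_add_right f b b')
  have "phig (DW f (b + b')) = phig (DW f b) + phig (DW f b')"
    by (simp add: phig_DW W.c_add distrib_left sc_add sum.distrib)
  then show ?case by (simp add: subst_linear L.sid.zero)
next
  case (DW_scale_left f r b)
  have "phig (DW (\<lambda>x. r * f x) b) = r \<cdot> phig (DW f b)"
    by (simp add: phig_DW sc_sum sc_simps mult.assoc)
  then show ?case by (simp add: subst_linear sc_def[symmetric] L.sid.zero)
next
  case (DW_scale_right f r b)
  have "phig (DW f (scl W r b)) = r \<cdot> phig (DW f b)"
    by (simp add: phig_DW W.c_scale sc_sum sc_simps ac_simps)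
  then show ?case by (simp add: subst_linear sc_def[symmetric] L.sid.zero)
qed

text \<open>The elements sent into the supercommutator ideal form an ideal containing the relations,
  and \<open>J\<close> is the smallest such ideal.\<close>

lemma phi_J: "a \<in> J \<Longrightarrow> phi a \<in> L.sid"
proof -
  let ?M = "{a \<in> Free G. phi a \<in> L.sid}"
  have "ideal ?M A"
    by (rule ideal_free_algebraI)
      (auto simp: subst_linear subst_mult Free_0 Free_add Free_minus Free_mult
        intro: L.sid.intros L.sid_minus L.sid_left L.sid_right)
  moreover have "rels U V W \<subseteq> ?M" using rels_carrier phi_rels by blast
  ultimately have "J \<subseteq> ?M" unfolding sym_ideal_def by (rule A.genideal_minimal)
  then show "a \<in> J \<Longrightarrow> phi a \<in> L.sid" by blast
qed

lemma psig_hgens: "\<exists>c h. psig g = c \<cdot> word [h] \<and> h \<in> hgens U V W (lpar g)"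
proof -
  have u: "t \<in> T \<Longrightarrow> u t \<in> gr U (ipar t)" and e: "i \<in> I \<Longrightarrow> e i \<in> gr V (ipar i)"
    and w: "s \<in> S \<Longrightarrow> w s \<in> gr W (ipar s)" for t i s
    using U.basis V.basis W.basis by (simp_all add: homogeneous_basis_def)
  have e': "i \<in> I \<Longrightarrow> e' i \<in> dual_gr V (ipar i)" for i
    using e'_dual V.c_gr[of _ "ipar i + 1" i] by (auto simp: dual_gr_def)
  \<comment> \<open>A letter sent to 0 is written as 0 times a homogeneous generator of the required
    parity; the tensor of two zeros has every parity.\<close>
  have z: "\<exists>h. h \<in> hgens U V W d" for d :: bit
  proof -
    have "0 \<in> gr U d" "0 \<in> gr V 0"
      using U.vs.subspace_0[OF U.subspace_gr] V.vs.subspace_0[OF V.subspace_gr] by auto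
    then have "UV 0 0 \<in> hgens U V W d" unfolding hgens_def by force
    then show ?thesis by blast
  qed
  show ?thesis
  proof (cases "psig g = 0")
    case True
    then show ?thesis using z[of "lpar g"] by (metis sc_0(1))
  next
    case False
    then consider t i where "g = X (Inl t) i" "t \<in> T" "i \<in> I" | i s where "g = Y i s" "i \<in> I" "s \<in> S"
      by (auto simp: psig_def split: letter.splits sum.splits if_splits)
    then show ?thesis
    proof cases
      case 1
      then have "UV (u t) (e i) \<in> hgens U V W (lpar g)"
        unfolding hgens_def using u e by auto
      then show ?thesis using 1 by (intro exI[of _ 1] exI[of _ "UV (u t) (e i)"]) (simp add: psig_def)
    next
      case 2
      then have "DW (e' i) (w s) \<in> hgens U V W (lpar g)"
        unfolding hgens_def using e' w by auto
      then show ?thesis using 2 by (intro exI[of _ 1] exI[of _ "DW (e' i) (w s)"]) (simp add: psig_def)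
    qed
  qed
qed

lemma psi_sid:
  assumes "a \<in> L.sid"
  shows "psi a \<in> J"
proof (rule L.sid_clinear[OF clinear_subst assms])
  fix x g h y
  obtain c g' d h' where g: "psig g = c \<cdot> word [g']" "g' \<in> hgens U V W (lpar g)"
    and h: "psig h = d \<cdot> word [h']" "h' \<in> hgens U V W (lpar h)"
    using psig_hgens by meson
  have "psi (L.scomm g h) = (c * d) \<cdot> (word [g', h'] - const (ksgn (lpar g * lpar h)) * word [h', g'])"
    using word_Cons[of g' "[h']"] word_Cons[of h' "[g']"]
    by (simp add: L.scomm_def word2 subst_linear subst_mult g h sc_def[symmetric] sc_simps ac_simps)
  moreover have "word [g', h'] - const (ksgn (lpar g * lpar h)) * word [h', g'] \<in> J"
    by (rule rels_J[OF rels.supercomm[OF g(2) h(2)]])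
  ultimately have "psi (L.scomm g h) \<in> J" by (simp add: J_scale)
  then show "psi (word x * (L.scomm g h * word y)) \<in> J"
    unfolding subst_mult by (intro J_left J_right psi_Free)
qed (auto intro: J_0 J_add J_scale)

lemma UV_sum_left: "word [UV (\<Sum>i\<in>B. scl U (r i) (f i)) b] \<simeq>\<^sub>J (\<Sum>i\<in>B. r i \<cdot> word [UV (f i) b])"
proof (induction B rule: infinite_finite_induct)
  case (insert x B)
  have "word [UV (scl U (r x) (f x) + (\<Sum>i\<in>B. scl U (r i) (f i))) b]
      \<simeq>\<^sub>J word [UV (scl U (r x) (f x)) b] + word [UV (\<Sum>i\<in>B. scl U (r i) (f i)) b]"
    using rels_J[OF rels.UV_add_left] by (simp add: jeq_def diff_diff_eq)
  also have "\<dots> \<simeq>\<^sub>J r x \<cdot> word [UV (f x) b] + (\<Sum>i\<in>B. r i \<cdot> word [UV (f i) b])"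
    using rels_J[OF rels.UV_scale_left] insert.IH by (intro jeq_add) (simp_all add: jeq_def sc_def)
  finally show ?case using insert.hyps by simp
qed (use rels_J[OF rels.UV_scale_left[of U 0 0 b]] in \<open>simp_all add: jeq_def\<close>)

lemma UV_sum_right: "word [UV b (\<Sum>i\<in>B. scl V (r i) (f i))] \<simeq>\<^sub>J (\<Sum>i\<in>B. r i \<cdot> word [UV b (f i)])"
proof (induction B rule: infinite_finite_induct)
  case (insert x B)
  have "word [UV b (scl V (r x) (f x) + (\<Sum>i\<in>B. scl V (r i) (f i)))]
      \<simeq>\<^sub>J word [UV b (scl V (r x) (f x))] + word [UV b (\<Sum>i\<in>B. scl V (r i) (f i))]"
    using rels_J[OF rels.UV_add_right] by (simp add: jeq_def diff_diff_eq)
  also have "\<dots> \<simeq>\<^sub>J r x \<cdot> word [UV b (f x)] + (\<Sum>i\<in>B. r i \<cdot> word [UV b (f i)])"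
    using rels_J[OF rels.UV_scale_right] insert.IH by (intro jeq_add) (simp_all add: jeq_def sc_def)
  finally show ?case using insert.hyps by simp
qed (use rels_J[OF rels.UV_scale_right[of b V 0 0]] in \<open>simp_all add: jeq_def\<close>)

lemma DW_sum_left:
  assumes "finite B" and "\<And>i. i \<in> B \<Longrightarrow> f i \<in> dual V"
  shows "word [DW (\<lambda>x. \<Sum>i\<in>B. r i * f i x) b] \<simeq>\<^sub>J (\<Sum>i\<in>B. r i \<cdot> word [DW (f i) b])
    \<and> (\<lambda>x. \<Sum>i\<in>B. r i * f i x) \<in> dual V"
  using assms
proof (induction B rule: finite_induct)
  case empty
  have "word [DW (\<lambda>x. 0 * 0) b] - const 0 * word [DW (\<lambda>x. 0) b] \<in> J"
    by (rule rels_J[OF rels.DW_scale_left[OF dual_0]])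
  then show ?case by (simp add: jeq_def dual_0)
next
  case (insert x B)
  let ?g = "\<lambda>y. \<Sum>i\<in>B. r i * f i y" and ?h = "\<lambda>y. r x * f x y"
  have d: "?g \<in> dual V" "?h \<in> dual V" using insert by (auto intro: dual_scale)
  have "word [DW (\<lambda>y. ?h y + ?g y) b] \<simeq>\<^sub>J word [DW ?h b] + word [DW ?g b]"
    using rels_J[OF rels.DW_add_left[OF d(2,1)]] by (simp add: jeq_def diff_diff_eq)
  also have "\<dots> \<simeq>\<^sub>J r x \<cdot> word [DW (f x) b] + (\<Sum>i\<in>B. r i \<cdot> word [DW (f i) b])"
    using rels_J[OF rels.DW_scale_left[of "f x" V]] insert
    by (intro jeq_add) (auto simp: jeq_def sc_def)
  finally show ?case using insert.hyps dual_add[OF d(2,1)] by simp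
qed

lemma DW_sum_right:
  assumes "f \<in> dual V"
  shows "word [DW f (\<Sum>i\<in>B. scl W (r i) (g i))] \<simeq>\<^sub>J (\<Sum>i\<in>B. r i \<cdot> word [DW f (g i)])"
proof (induction B rule: infinite_finite_induct)
  case (insert x B)
  have "word [DW f (scl W (r x) (g x) + (\<Sum>i\<in>B. scl W (r i) (g i)))]
      \<simeq>\<^sub>J word [DW f (scl W (r x) (g x))] + word [DW f (\<Sum>i\<in>B. scl W (r i) (g i))]"
    using rels_J[OF rels.DW_add_right[OF assms]] by (simp add: jeq_def diff_diff_eq)
  also have "\<dots> \<simeq>\<^sub>J r x \<cdot> word [DW f (g x)] + (\<Sum>i\<in>B. r i \<cdot> word [DW f (g i)])"
    using rels_J[OF rels.DW_scale_right[OF assms]] insert.IH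
    by (intro jeq_add) (simp_all add: jeq_def sc_def)
  finally show ?case using insert.hyps by simp
qed (use rels_J[OF rels.DW_scale_right[OF assms, of W 0 0]] in \<open>simp_all add: jeq_def\<close>)

lemma psi_phig: "g \<in> G \<Longrightarrow> psi (phig g) \<simeq>\<^sub>J word [g]"
proof (cases g)
  case (UV a b)
  have "word [UV a b] \<simeq>\<^sub>J (\<Sum>t\<in>T. cu t a \<cdot> word [UV (u t) b])"
    using UV_sum_left[of "\<lambda>t. cu t a" u T b] U.expand[of a] by simp
  also have "\<dots> \<simeq>\<^sub>J (\<Sum>t\<in>T. cu t a \<cdot> (\<Sum>i\<in>I. e' i b \<cdot> word [UV (u t) (e i)]))"
    using UV_sum_right[of _ "\<lambda>i. e' i b" e I] V.expand[of b] by (intro jeq_sum jeq_scale) simp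
  also have "\<dots> = psi (phig g)"
    by (simp add: UV phig_UV subst_linear psig_def sc_sum sc_simps)
  finally show ?thesis unfolding UV by (rule jeq_sym)
next
  case (DW f b)
  assume "g \<in> G"
  then have f: "f \<in> dual V" by (simp add: DW)
  have fe: "(\<lambda>x. \<Sum>i\<in>I. f (e i) * e' i x) = f" using V.dual_expand[OF f] by (intro ext) (rule sym)
  have "word [DW f b] \<simeq>\<^sub>J (\<Sum>i\<in>I. f (e i) \<cdot> word [DW (e' i) b])"
    using DW_sum_left[of I e' "\<lambda>i. f (e i)" b, OF finite_sindex e'_dual, THEN conjunct1] unfolding fe .
  also have "\<dots> \<simeq>\<^sub>J (\<Sum>i\<in>I. f (e i) \<cdot> (\<Sum>s\<in>S. cw s b \<cdot> word [DW (e' i) (w s)]))"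
    using DW_sum_right[OF e'_dual, of _ "\<lambda>s. cw s b" w S] W.expand[of b]
    by (intro jeq_sum jeq_scale) simp
  also have "\<dots> = psi (phig g)"
    by (simp add: DW phig_DW subst_linear psig_def sc_sum sc_simps)
  finally show ?thesis unfolding DW by (rule jeq_sym)
qed

lemma psi_phi:
  assumes "a \<in> Free G"
  shows "psi (phi a) \<simeq>\<^sub>J a"
proof -
  have "psi (phi a) - a \<in> J"
  proof (rule clinear_closed[where F="\<lambda>a. psi (phi a) - a"])
    fix x assume "x \<in> Poly_Mapping.keys a"
    then have "set x \<subseteq> G" using assms by (auto simp: Free_def)
    then have "psi (phi (word x)) \<simeq>\<^sub>J word x"
    proof (induction x)
      case (Cons g x)
      then have "psi (phig g) * psi (phi (word x)) \<simeq>\<^sub>J word [g] * word x"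
        by (intro jeq_mult psi_phig psi_Free) (auto simp: Free_word)
      then show ?case by (simp add: word_Cons[of g x] subst_mult)
    qed simp
    then show "psi (phi (word x)) - word x \<in> J" by (simp add: jeq_def)
  qed (intro clin, auto intro: J_0 J_add J_scale)
  then show ?thesis by (simp add: jeq_def)
qed

text \<open>One direction maps the ideal forward; the other maps it back along \<open>psi\<close>
  and uses \<open>psi_phi\<close>. Membership in \<open>J\<close> can thus be tested on
  letters.\<close>

lemma J_iff: "a \<in> Free G \<Longrightarrow> a \<in> J \<longleftrightarrow> phi a \<in> L.sid"
  using phi_J psi_sid[of "phi a"] jeq_sym[OF psi_phi[of a]] J_add[of "a - psi (phi a)" "psi (phi a)"]
  by (auto simp: jeq_def)

section \<open>The action of \<open>gl(V)\<close> in coordinates\<close>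

lemma phig_twist: "g \<in> G \<Longrightarrow> phig (twist_gen U V W d g) = L.tw d (phig g)"
proof (cases g)
  case (UV a b)
  then show ?thesis
    by (simp add: phig_UV U.c_twist V.c_twist L.tw_linear L.tw_letter sc_simps distrib_left ksgn_add ac_simps)
next
  case (DW f b)
  assume "g \<in> G"
  then have f: "f \<in> dual V" by (simp add: DW)
  have "f (twist V d (e i)) = ksgn (d * ipar i) * f (e i)" if "i \<in> I" for i
  proof -
    have "twist V d (e i) = scl V (ksgn (d * ipar i)) (e i)"
      using that by (intro V.coords_eqI) (auto simp: V.c_twist V.c_scale V.c_basis)
    then show ?thesis using f by (simp add: V.dual_iff)
  qed
  then show ?thesis
    by (simp add: DW phig_DW W.c_twist L.tw_linear L.tw_letter sc_simps distrib_left ksgn_add ac_simps)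
qed

text \<open>The operator \<open>R\<close> is the combination of matrix units with coefficients
  \<open>e' i (R (e j))\<close>, and \<open>gl_part\<close> keeps the entries of parity
  \<open>d\<close>. On \<open>DW\<close> the twist after \<open>R\<close> yields
  \<open>ksgn (d * ipar i)\<close>, the sign in \<open>hF\<close>.\<close>

lemma phig_act:
  assumes R: "R \<in> gl V" and g: "g \<in> G"
  shows "phig (act_gen U V d (gl_part V d R) g) = AD I d (\<lambda>i j. e' i (R (e j))) (phig g)"
proof (cases g)
  case (UV a b)
  let ?M = "\<lambda>i j. if epar i j = d then e' i (R (e j)) else 0"
  have M: "e' i (gl_part V d R b) = (\<Sum>j\<in>I. ?M i j * e' j b)" if "i \<in> I" for i
    using V.gl_coords[OF V.gl_part_in_gl[OF R] that, of d b] that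
    by (simp add: V.c_gl_part[OF R] cong: sum.cong)
  have "phig (act_gen U V d (gl_part V d R) g)
      = (\<Sum>t\<in>T. \<Sum>i\<in>I. \<Sum>j\<in>I. (ksgn (d * ipar t) * cu t a * (?M i j * e' j b)) \<cdot> word [X (Inl t) i])"
    by (simp add: UV phig_UV U.c_twist M sum_distrib_left sc_sum_left)
  also have "\<dots> = (\<Sum>t\<in>T. \<Sum>j\<in>I. (cu t a * e' j b) \<cdot> AD I d (\<lambda>i j. e' i (R (e j))) (word [X (Inl t) j]))"
  proof (rule sum.cong[OF refl])
    fix t
    have "(\<Sum>i\<in>I. \<Sum>j\<in>I. (ksgn (d * ipar t) * cu t a * (?M i j * e' j b)) \<cdot> word [X (Inl t) i])
        = (\<Sum>j\<in>I. \<Sum>i\<in>I. (ksgn (d * ipar t) * cu t a * (?M i j * e' j b)) \<cdot> word [X (Inl t) i])"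
      by (rule sum.swap)
    also have "\<dots> = (\<Sum>j\<in>I. (cu t a * e' j b) \<cdot> AD I d (\<lambda>i j. e' i (R (e j))) (word [X (Inl t) j]))"
      by (auto simp: AD_X[OF finite_sindex] sc_sum sc_simps ac_simps intro!: sum.cong)
    finally show "(\<Sum>i\<in>I. \<Sum>j\<in>I. (ksgn (d * ipar t) * cu t a * (?M i j * e' j b)) \<cdot> word [X (Inl t) i])
        = (\<Sum>j\<in>I. (cu t a * e' j b) \<cdot> AD I d (\<lambda>i j. e' i (R (e j))) (word [X (Inl t) j]))" .
  qed
  finally show ?thesis
    by (simp add: UV phig_UV clinear_sum[OF clinear_AD] clinear_scale[OF clinear_AD])
next
  case (DW f b)
  let ?M = "\<lambda>i j. if epar i j = d then e' i (R (e j)) else 0"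
  have f: "f \<in> dual V" using g by (simp add: DW)
  have M: "f (twist V d (gl_part V d R (e j))) = (\<Sum>i\<in>I. f (e i) * (ksgn (d * ipar i) * ?M i j))"
    if "j \<in> I" for j
    using V.dual_expand[OF f, of "twist V d (gl_part V d R (e j))"] that
    by (simp add: V.c_twist V.c_gl_part[OF R] cong: sum.cong)
  have "phig (act_gen U V d (gl_part V d R) g)
      = (\<Sum>j\<in>I. \<Sum>s\<in>S. \<Sum>i\<in>I. (- (f (e i) * (ksgn (d * ipar i) * ?M i j)) * cw s b) \<cdot> word [Y j s])"
    by (simp add: DW phig_DW M sum_distrib_right sc_sum_left sum_negf[symmetric])
  also have "\<dots> = (\<Sum>i\<in>I. \<Sum>s\<in>S. (f (e i) * cw s b) \<cdot> AD I d (\<lambda>i j. e' i (R (e j))) (word [Y i s]))"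
    (is "?L = ?R")
  proof -
    have "?L = (\<Sum>j\<in>I. \<Sum>i\<in>I. \<Sum>s\<in>S. (- (f (e i) * (ksgn (d * ipar i) * ?M i j)) * cw s b) \<cdot> word [Y j s])"
      by (intro sum.cong[OF refl] sum.swap)
    also have "\<dots> = (\<Sum>i\<in>I. \<Sum>j\<in>I. \<Sum>s\<in>S. (- (f (e i) * (ksgn (d * ipar i) * ?M i j)) * cw s b) \<cdot> word [Y j s])"
      by (rule sum.swap)
    also have "\<dots> = (\<Sum>i\<in>I. \<Sum>s\<in>S. \<Sum>j\<in>I. (- (f (e i) * (ksgn (d * ipar i) * ?M i j)) * cw s b) \<cdot> word [Y j s])"
      by (intro sum.cong[OF refl] sum.swap)
    also have "\<dots> = ?R"
      by (auto simp: AD_Y[OF finite_sindex] sc_sum sc_simps sc_minus ac_simps intro!: sum.cong)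
    finally show ?thesis .
  qed
  finally show ?thesis
    by (simp add: DW phig_DW clinear_sum[OF clinear_AD] clinear_scale[OF clinear_AD])
qed

lemma act_gen_gens: "R \<in> gl V \<Longrightarrow> g \<in> G \<Longrightarrow> act_gen U V d R g \<in> G"
  by (cases g) (auto simp: V.dual_iff V.gl_iff V.twist_add V.twist_scale)

lemma twist_gen_gens: "g \<in> G \<Longrightarrow> twist_gen U V W d g \<in> G"
  by (cases g) (auto simp: V.dual_iff V.twist_add V.twist_scale)

lemma act_word_Free: "R \<in> gl V \<Longrightarrow> set x \<subseteq> G \<Longrightarrow> act_word U V W d R x \<in> Free G"
  by (induction x) (auto simp: Free_0 Free_word act_gen_gens twist_gen_gens intro!: Free_add Free_mult)

lemma phi_act_word:
  assumes "R \<in> gl V" and "set x \<subseteq> G"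
  shows "phi (act_word U V W d (gl_part V d R) x) = AD I d (\<lambda>i j. e' i (R (e j))) (phi (word x))"
  using assms(2)
proof (induction x)
  case (Cons g x)
  then show ?case
    by (simp add: word_Cons[of g x] subst_linear subst_mult AD_mult phig_act[OF assms(1)] phig_twist)
qed (simp add: subst_linear AD_1)

lemma act_free_lin: "act_free U V W R = lin (\<lambda>x. act_word U V W 0 (gl_part V 0 R) x + act_word U V W 1 (gl_part V 1 R) x)"
  by (intro ext) (simp add: act_free_def lin_def sc_def)

lemma act_free_Free: "R \<in> gl V \<Longrightarrow> a \<in> Free G \<Longrightarrow> act_free U V W R a \<in> Free G"
  unfolding act_free_lin
  by (rule Free_clinear[OF clinear_lin]) (auto intro!: Free_add act_word_Free V.gl_part_in_gl)

lemma phi_act_free: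
  assumes "R \<in> gl V" and "a \<in> Free G"
  shows "phi (act_free U V W R a) = (\<Sum>i\<in>I. \<Sum>j\<in>I. e' i (R (e j)) \<cdot> DF i j (phi a))"
proof -
  let ?M = "\<lambda>i j. e' i (R (e j))"
  have "phi (act_free U V W R a) = AD I 0 ?M (phi a) + AD I 1 ?M (phi a)"
  proof (rule clinear_eq_on[where F="\<lambda>a. phi (act_free U V W R a)" and G="\<lambda>a. AD I 0 ?M (phi a) + AD I 1 ?M (phi a)"])
    show "clinear (\<lambda>a. phi (act_free U V W R a))"
      unfolding act_free_lin by (rule clinear_comp[OF clinear_subst clinear_lin])
    show "clinear (\<lambda>a. AD I 0 ?M (phi a) + AD I 1 ?M (phi a))"
      by (intro clinear_plus clinear_comp[OF clinear_AD clinear_subst])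
    fix x assume "x \<in> Poly_Mapping.keys a"
    then have "set x \<subseteq> G" using assms by (auto simp: Free_def)
    then show "phi (act_free U V W R (word x)) = AD I 0 ?M (phi (word x)) + AD I 1 ?M (phi (word x))"
      unfolding act_free_lin lin_word by (simp add: subst_linear phi_act_word[OF assms(1)])
  qed
  then show ?thesis by (simp only: gl_part_split)
qed

text \<open>The rank one map built from \<open>e' j\<close> and \<open>e i\<close> is the matrix
  unit, which makes the single operators \<open>DF i j\<close> available from the abstract
  action.\<close>

lemma phi_act_free_unit:
  assumes "i \<in> I" and "j \<in> I" and "a \<in> Free G"
  shows "(\<lambda>x. scl V (e' j x) (e i)) \<in> gl V"
    and "phi (act_free U V W (\<lambda>x. scl V (e' j x) (e i)) a) = DF i j (phi a)"
proof -
  let ?R = "\<lambda>x. scl V (e' j x) (e i)"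
  show R: "?R \<in> gl V"
    using assms by (simp add: V.gl_iff V.c_add V.c_scale V.vs.scale_left_distrib)
  have "(\<Sum>i'\<in>I. \<Sum>j'\<in>I. e' i' (?R (e j')) \<cdot> DF i' j' (phi a))
      = (\<Sum>i'\<in>I. \<Sum>j'\<in>I. if i' = i then (if j' = j then DF i j (phi a) else 0) else 0)"
    using assms by (intro sum.cong refl) (auto simp: V.c_scale V.c_basis)
  also have "\<dots> = (\<Sum>i'\<in>I. if i' = i then DF i j (phi a) else 0)"
    using assms finite_sindex by (intro sum.cong refl) (simp add: sum.delta')
  finally show "phi (act_free U V W ?R a) = DF i j (phi a)"
    using assms finite_sindex by (simp add: phi_act_free[OF R] sum.delta')
qed

section \<open>The quotient ring and its invariants\<close>

abbreviation Q :: "('u, 'v, 'w) tens falg set ring" where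
  "Q \<equiv> sym_alg U V W"

abbreviation cl :: "('u, 'v, 'w) tens falg \<Rightarrow> ('u, 'v, 'w) tens falg set" where
  "cl \<equiv> sym_class U V W"

lemma cl_iff: "b \<in> cl a \<longleftrightarrow> b \<simeq>\<^sub>J a"
proof -
  have "(\<exists>h\<in>J. b = h + a) \<longleftrightarrow> b - a \<in> J"
    by (metis add_diff_cancel_right' diff_add_cancel)
  then show ?thesis
    by (simp add: sym_class_def a_r_coset_def' jeq_def)
qed

lemma cl_eq: "a \<simeq>\<^sub>J b \<Longrightarrow> cl a = cl b"
  by (simp add: set_eq_iff cl_iff) (meson jeq_trans jeq_sym)

sublocale cl: ring_hom_ring A Q cl
proof -
  have "cl = (+>\<^bsub>A\<^esub>) J" by (intro ext) (simp add: sym_class_def)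
  then show "ring_hom_ring A Q cl"
    unfolding sym_alg_def using J.rcos_ring_hom_ring by simp
qed

lemma zero_Q: "zero Q = J"
  by (simp add: sym_alg_def FactRing_def)

lemma cl_cases: "C \<in> carrier Q \<Longrightarrow> \<exists>a\<in>Free G. C = cl a"
  by (auto simp: sym_alg_def FactRing_def A_RCOSETS_def' sym_class_def)

lemma cl_add: "a \<in> Free G \<Longrightarrow> b \<in> Free G \<Longrightarrow> cl a \<oplus>\<^bsub>Q\<^esub> cl b = cl (a + b)"
  using cl.hom_add[of a b] by simp

lemma cl_mult: "a \<in> Free G \<Longrightarrow> b \<in> Free G \<Longrightarrow> cl a \<otimes>\<^bsub>Q\<^esub> cl b = cl (a * b)"
  using cl.hom_mult[of a b] by simp

lemma cl_minus: "a \<in> Free G \<Longrightarrow> \<ominus>\<^bsub>Q\<^esub> cl a = cl (- a)"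
  using cl.hom_a_inv[of a] by (simp add: a_inv_free_algebra)

lemma cl_one: "cl 1 = \<one>\<^bsub>Q\<^esub>"
  using cl.hom_one by simp

lemma cl_carrier: "a \<in> Free G \<Longrightarrow> cl a \<in> carrier Q"
  using cl.hom_closed[of a] by simp

lemma cl_sum:
  "finite B \<Longrightarrow> (\<And>i. i \<in> B \<Longrightarrow> f i \<in> Free G) \<Longrightarrow> (\<Oplus>\<^bsub>Q\<^esub>i\<in>B. cl (f i)) = cl (\<Sum>i\<in>B. f i)"
proof (induction B rule: finite_induct)
  case empty
  then show ?case using cl.hom_zero by simp
next
  case (insert x B)
  then show ?case by (simp add: cl.S.finsum_insert cl_carrier cl_add Free_sum)
qed

lemma scalar_product_cl:
  assumes "t \<in> T" and "s \<in> S"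
  shows "scalar_product U V W n m e e' (u t) (w s) = cl (psi (core.zz t s))"
proof -
  have "scalar_product U V W n m e e' (u t) (w s)
      = (\<Oplus>\<^bsub>Q\<^esub>i\<in>I. cl (word [UV (u t) (e i)] * word [DW (e' i) (w s)]))"
    unfolding scalar_product_def
    by (intro cl.S.finsum_cong') (auto simp: cl_mult Free_word e'_dual intro!: cl_carrier Free_mult)
  also have "\<dots> = cl (\<Sum>i\<in>I. word [UV (u t) (e i)] * word [DW (e' i) (w s)])"
    by (rule cl_sum[OF finite_sindex]) (auto simp: Free_word e'_dual intro!: Free_mult)
  also have "(\<Sum>i\<in>I. word [UV (u t) (e i)] * word [DW (e' i) (w s)]) = psi (core.zz t s)"
    using assms by (simp add: core.zz_def subst_linear subst_mult psig_def)
  finally show ?thesis .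
qed

lemma phi_psi_letter:
  "t \<in> T \<Longrightarrow> i \<in> I \<Longrightarrow> phi (word [UV (u t) (e i)]) = word [X (Inl t) i]"
  "i \<in> I \<Longrightarrow> s \<in> S \<Longrightarrow> phi (word [DW (e' i) (w s)]) = word [Y i s]"
proof -
  assume a: "t \<in> T" "i \<in> I"
  have "phig (UV (u t) (e i)) = (\<Sum>t'\<in>T. \<Sum>i'\<in>I. if t' = t then (if i' = i then word [X (Inl t) i] else 0) else 0)"
    unfolding phig_UV using a by (intro sum.cong refl) (auto simp: U.c_basis V.c_basis)
  also have "\<dots> = (\<Sum>t'\<in>T. if t' = t then word [X (Inl t) i] else 0)"
    using a finite_sindex by (intro sum.cong refl) (simp add: sum.delta')
  finally show "phi (word [UV (u t) (e i)]) = word [X (Inl t) i]"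
    using a finite_sindex by (simp add: sum.delta')
next
  assume a: "i \<in> I" "s \<in> S"
  have "phig (DW (e' i) (w s)) = (\<Sum>i'\<in>I. \<Sum>s'\<in>S. if i' = i then (if s' = s then word [Y i s] else 0) else 0)"
    unfolding phig_DW using a by (intro sum.cong refl) (auto simp: W.c_basis V.c_basis)
  also have "\<dots> = (\<Sum>i'\<in>I. if i' = i then word [Y i s] else 0)"
    using a finite_sindex by (intro sum.cong refl) (simp add: sum.delta')
  finally show "phi (word [DW (e' i) (w s)]) = word [Y i s]"
    using a finite_sindex by (simp add: sum.delta')
qed

lemma phi_psi_zz: "t \<in> T \<Longrightarrow> s \<in> S \<Longrightarrow> phi (psi (core.zz t s)) = core.zz t s"
  by (simp add: core.zz_def subst_linear subst_mult psig_def phi_psi_letter[simplified])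

text \<open>\<open>act_sym\<close> is a union of cosets over all representatives, so its vanishing
  is a condition on each of them; this condition takes the place of well-definedness.\<close>

lemma act_sym_eq_zero_iff:
  assumes "a \<in> Free G"
  shows "act_sym U V W R (cl a) = \<zero>\<^bsub>Q\<^esub> \<longleftrightarrow> (\<forall>b. b \<simeq>\<^sub>J a \<longrightarrow> act_free U V W R b \<in> J)"
proof
  assume z: "act_sym U V W R (cl a) = \<zero>\<^bsub>Q\<^esub>"
  show "\<forall>b. b \<simeq>\<^sub>J a \<longrightarrow> act_free U V W R b \<in> J"
  proof (intro allI impI)
    fix b assume "b \<simeq>\<^sub>J a"
    then have "cl (act_free U V W R b) \<subseteq> J"
      using z unfolding act_sym_def zero_Q by (auto simp: cl_iff)
    then show "act_free U V W R b \<in> J" by (auto simp: cl_iff)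
  qed
next
  assume *: "\<forall>b. b \<simeq>\<^sub>J a \<longrightarrow> act_free U V W R b \<in> J"
  have "cl x = J" if "x \<in> J" for x
    using that cl_iff[of _ x] J_add[of _ x] J_add[of _ "- x"] J_minus[of x]
    by (auto simp: jeq_def) (metis diff_add_cancel)
  then have "cl (act_free U V W R b) = J" if "b \<in> cl a" for b
    using * that by (simp add: cl_iff)
  moreover have "a \<in> cl a" by (simp add: cl_iff)
  ultimately show "act_sym U V W R (cl a) = \<zero>\<^bsub>Q\<^esub>"
    unfolding act_sym_def zero_Q by (metis (no_types, lifting) SUP_eq_const empty_iff)
qed

lemma jeq_phi: "a \<simeq>\<^sub>J b \<Longrightarrow> phi a \<approx> phi b"
  using phi_J[of "a - b"] by (simp add: jeq_def L.eqv_def subst_linear)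

lemma jeq_Free: "b \<simeq>\<^sub>J a \<Longrightarrow> a \<in> Free G \<Longrightarrow> b \<in> Free G"
  using Free_add[of "b - a" G a] J_Free[of "b - a"] by (simp add: jeq_def)

lemma Bz_invariant:
  assumes "a \<in> Free G" and "phi a \<in> core.Bz"
  shows "cl a \<in> gl_invariants U V W"
proof -
  have "act_free U V W R b \<in> J" if R: "R \<in> gl V" and b: "b \<simeq>\<^sub>J a" for R b
  proof -
    have bF: "b \<in> Free G" using jeq_Free[OF b assms(1)] .
    have "phi b \<in> core.Bz"
      using core.Bz.eqv[OF assms(2)] jeq_phi[OF jeq_sym[OF b]] by blast
    then have "phi (act_free U V W R b) \<in> L.sid"
      unfolding phi_act_free[OF R bF] by (intro L.sid_sum L.sid_scale core.DF_Bz)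
    then show ?thesis using J_iff[OF act_free_Free[OF R bF]] by simp
  qed
  then show ?thesis
    using assms cl_carrier by (auto simp: gl_invariants_def act_sym_eq_zero_iff)
qed

text \<open>Invariance tested on matrix units provides the assumption of
  \<open>fft_invariant\<close>, and \<open>phi_Free\<close> the restriction on letters.\<close>

lemma invariant_Bz:
  assumes "a \<in> Free G" and "cl a \<in> gl_invariants U V W"
  shows "phi a \<in> core.Bz"
proof -
  have "DF i j (phi a) \<in> L.sid" if ij: "i \<in> I" "j \<in> I" for i j
  proof -
    let ?R = "\<lambda>x. scl V (e' j x) (e i)"
    have R: "?R \<in> gl V" using phi_act_free_unit(1)[OF ij assms(1)] .
    then have "act_free U V W ?R a \<in> J"
      using assms by (simp add: gl_invariants_def act_sym_eq_zero_iff)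
    then show ?thesis using phi_J phi_act_free_unit(2)[OF ij assms(1)] by metis
  qed
  then interpret inv: fft_invariant n m T S "phi a"
    by unfold_locales (auto simp: phi_Free)
  show ?thesis by (rule inv.invariant_in_Bz)
qed

abbreviation H :: "('u, 'v, 'w) tens falg set set" where
  "H \<equiv> {scalar_product U V W n m e e' (u t) (w s) | t s. t \<in> T \<and> s \<in> S}"

lemma Bz_generated: "b \<in> core.Bz \<Longrightarrow> cl (psi b) \<in> generated_subalgebra U V W H"
proof (induction rule: core.Bz.induct)
  case (const c)
  then show ?case unfolding generated_subalgebra_def by (auto intro: generate_ring.incl)
next
  case (zz t s)
  then show ?case unfolding generated_subalgebra_def scalar_product_cl[symmetric, OF zz]
    by (intro generate_ring.incl) blast
next
  case (add a b)
  have "cl (psi (a + b)) = cl (psi a) \<oplus>\<^bsub>Q\<^esub> cl (psi b)"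
    by (simp add: cl_add psi_Free subst_linear)
  with add.IH show ?case unfolding generated_subalgebra_def
    by (simp only: generate_ring.eng_add)
next
  case (mult a b)
  have "cl (psi (a * b)) = cl (psi a) \<otimes>\<^bsub>Q\<^esub> cl (psi b)"
    by (simp add: cl_mult psi_Free subst_mult)
  with mult.IH show ?case unfolding generated_subalgebra_def
    by (simp only: generate_ring.eng_mult)
next
  case (eqv a b)
  have "psi a \<simeq>\<^sub>J psi b"
    using psi_sid[of "a - b"] eqv.hyps(2) by (simp add: jeq_def L.eqv_def subst_linear)
  then have "cl (psi a) = cl (psi b)" by (rule cl_eq)
  with eqv.IH show ?case by simp
qed

lemma generated_Bz:
  assumes "C \<in> generated_subalgebra U V W H"
  shows "\<exists>a\<in>Free G. C = cl a \<and> phi a \<in> core.Bz"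
  using assms unfolding generated_subalgebra_def
proof (induction rule: generate_ring.induct)
  case one
  then show ?case using cl_one core.Bz.const[of 1] Free_1[of G] by (intro bexI[of _ 1]) auto
next
  case (incl C)
  then consider c where "C = cl (const c)" | t s where "t \<in> T" "s \<in> S" "C = cl (psi (core.zz t s))"
    using scalar_product_cl by auto
  then show ?case
  proof cases
    case 1
    then show ?thesis using core.Bz.const Free_const by (intro bexI[of _ "const c"]) auto
  next
    case 2
    then show ?thesis using core.Bz.zz psi_Free phi_psi_zz by (intro bexI[of _ "psi (core.zz t s)"]) auto
  qed
next
  case (a_inv C)
  then obtain a where a: "a \<in> Free G" "C = cl a" "phi a \<in> core.Bz" by blast
  have "phi (- a) = (- 1) \<cdot> phi a" by (simp add: subst_linear sc_minus)
  then show ?case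
    using a core.Bz_scale[of "phi a" "- 1"] by (intro bexI[of _ "- a"]) (auto simp: cl_minus Free_minus)
next
  case (eng_add C D)
  then obtain a b where "a \<in> Free G" "C = cl a" "phi a \<in> core.Bz" "b \<in> Free G" "D = cl b" "phi b \<in> core.Bz"
    by blast
  then show ?case
    by (intro bexI[of _ "a + b"]) (auto simp: cl_add subst_linear Free_add intro: core.Bz.add)
next
  case (eng_mult C D)
  then obtain a b where "a \<in> Free G" "C = cl a" "phi a \<in> core.Bz" "b \<in> Free G" "D = cl b" "phi b \<in> core.Bz"
    by blast
  then show ?case
    by (intro bexI[of _ "a * b"]) (auto simp: cl_mult subst_mult Free_mult intro: core.Bz.mult)
qed

text \<open>Both inclusions pass through \<open>Bz\<close>. An invariant class is recovered from
  letters because \<open>psi (phi a)\<close> represents the class of \<open>a\<close>.\<close>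

theorem generated_eq_invariants: "generated_subalgebra U V W H = gl_invariants U V W"
proof
  show "generated_subalgebra U V W H \<subseteq> gl_invariants U V W"
    using generated_Bz Bz_invariant by blast
  show "gl_invariants U V W \<subseteq> generated_subalgebra U V W H"
  proof
    fix C assume C: "C \<in> gl_invariants U V W"
    then obtain a where a: "a \<in> Free G" "C = cl a"
      using cl_cases[of C] by (auto simp: gl_invariants_def)
    then have "cl (psi (phi a)) \<in> generated_subalgebra U V W H"
      using C by (intro Bz_generated invariant_Bz) auto
    then show "C \<in> generated_subalgebra U V W H"
      using a cl_eq[OF psi_phi[of a]] by simp
  qed
qed

end

theorem corollary1p1p1:
  fixes U :: "'u::ab_group_add sspace"
    and V :: "'v::ab_group_add sspace"
    and W :: "'w::ab_group_add sspace"
    and k l n m p q :: nat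
    and u :: "nat + nat \<Rightarrow> 'u"
    and e :: "nat + nat \<Rightarrow> 'v"
    and e' :: "nat + nat \<Rightarrow> 'v \<Rightarrow> complex"
    and w :: "nat + nat \<Rightarrow> 'w"
  assumes "superspace U" and "superspace V" and "superspace W"
    and "homogeneous_basis U k l u"
    and "homogeneous_basis V n m e"
    and "homogeneous_basis W p q w"
    and "dual_basis V n m e e'"
  shows "generated_subalgebra U V W
           {scalar_product U V W n m e e' (u t) (w s) | t s. t \<in> sindex k l \<and> s \<in> sindex p q}
         = gl_invariants U V W"
proof -
  obtain cu where "coords U k l u cu"
    using ex_coords[OF assms(1,4)] by blast
  moreover obtain cw where "coords W p q w cw"
    using ex_coords[OF assms(3,6)] by blast
  \<comment> \<open>For \<open>V\<close> the coordinates are the given \<open>e'\<close>, since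
    these functionals occur in the scalar products; for \<open>U\<close> and \<open>W\<close> any
    coordinates adapted to the basis will do.\<close>
  moreover have "coords V n m e e'"
    using assms(2,5,7) by unfold_locales (auto simp: dual_basis_def dual_def Vector_Spaces.linear_iff)
  ultimately interpret presentation U k l u cu V n m e e' W p q w cw
    using assms(7) by (auto simp: presentation_def presentation_axioms_def dual_basis_def)
  show ?thesis by (rule generated_eq_invariants)
qed

end
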